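(* Let $d\geq 3$ and let $(M,g)$ be the Kasner spacetime $M=(0,\infty)\times\mathbb{R}^d$, $g=-dt^2+\sum_{i=1}^d t^{2p_i}\,dx_i^2$, with $\sum_i p_i=1$, $\sum_i p_i^2=1$ and at least one $p_i<0$, time-oriented by $\partial_t$. Then $(M,g)$ is past $C^0$-inextendible, i.e. there is no $C^0$-extension $\iota:M\hookrightarrow\tilde M$ with $\partial^-\iota(M)\neq\emptyset$.
   Context: A $C^0$-extension is a smooth isometric embedding $\iota:M\hookrightarrow\tilde M$ into a Lorentzian manifold $(\tilde M,\tilde g)$ of the same dimension with continuous metric $\tilde g$, such that $\partial\iota(M)\neq\emptyset$. A timelike curve is a piecewise smooth curve whose tangent vectors (where defined) are timelike and whose one-sided derivatives at break points lie in the same component of the timelike cone; it is past directed timelike (PDTL) if its tangents lie in the past cone. The past boundary $\partial^-\iota(M)$ is the set of $p\in\partial\iota(M)$ for which there is a smooth timelike curve $\gamma:[0,1]\to\tilde M$ with $\gamma([0,1))\subseteq\iota(M)$, $\iota^{-1}\circ\gamma|_{[0,1)}$ PDTL in $M$, and $\gamma(1)=p$. *)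

theory Defs
  imports "HOL-Analysis.Analysis"
begin

inductive_set iter_derivs :: "'a::real_normed_vector set \<Rightarrow> ('a \<Rightarrow> 'b::real_normed_vector) \<Rightarrow> ('a \<Rightarrow> 'b) set"
  for S :: "'a set" and f :: "'a \<Rightarrow> 'b" where
  base: "f \<in> iter_derivs S f"
| step: "g \<in> iter_derivs S f \<Longrightarrow> (\<lambda>x. frechet_derivative g (at x within S) v) \<in> iter_derivs S f"

definition Cinf_on :: "'a::real_normed_vector set \<Rightarrow> ('a \<Rightarrow> 'b::real_normed_vector) \<Rightarrow> bool" where
  "Cinf_on S f \<longleftrightarrow> (\<forall>g\<in>iter_derivs S f. g differentiable_on S)"

type_synonym 'n spt = "real \<times> (real ^ 'n)"

definition minkowski :: "'n::finite spt \<Rightarrow> 'n spt \<Rightarrow> real" where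
  "minkowski v w = - fst v * fst w + snd v \<bullet> snd w"

definition lorentzian_form :: "('n::finite spt \<Rightarrow> 'n spt \<Rightarrow> real) \<Rightarrow> bool" where
  "lorentzian_form B \<longleftrightarrow> (\<exists>L::'n spt \<Rightarrow> 'n spt. linear L \<and> bij L \<and> (\<forall>v w. B (L v) (L w) = minkowski v w))"

definition chart :: "'m::topological_space set \<Rightarrow> ('m \<Rightarrow> 'n::finite spt) \<Rightarrow> bool" where
  "chart U \<phi> \<longleftrightarrow> open U \<and> inj_on \<phi> U \<and> continuous_on U \<phi> \<and> open (\<phi> ` U)
      \<and> continuous_on (\<phi> ` U) (inv_into U \<phi>)"

definition transition :: "('m set \<times> ('m \<Rightarrow> 'n spt)) \<Rightarrow> ('m set \<times> ('m \<Rightarrow> 'n spt)) \<Rightarrow> 'n spt \<Rightarrow> 'n spt" where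
  "transition c c' = snd c' \<circ> inv_into (fst c) (snd c)"

definition smooth_atlas :: "('m::topological_space set \<times> ('m \<Rightarrow> 'n::finite spt)) set \<Rightarrow> bool" where
  "smooth_atlas A \<longleftrightarrow> (\<forall>c\<in>A. chart (fst c) (snd c)) \<and> \<Union>(fst ` A) = UNIV
     \<and> (\<forall>c\<in>A. \<forall>c'\<in>A. Cinf_on (snd c ` (fst c \<inter> fst c')) (transition c c'))"

text \<open>A continuous Lorentzian metric, given by its local coordinate expressions
  G c y v w (chart c, point y = chart coordinates, tangent vectors v w in coordinates),
  continuous in y and transforming as a (0,2)-tensor under chart changes.\<close>
definition C0_lorentz_metric ::
  "('m::topological_space set \<times> ('m \<Rightarrow> 'n::finite spt)) set
   \<Rightarrow> ('m set \<times> ('m \<Rightarrow> 'n spt) \<Rightarrow> 'n spt \<Rightarrow> 'n spt \<Rightarrow> 'n spt \<Rightarrow> real) \<Rightarrow> bool" where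
  "C0_lorentz_metric A G \<longleftrightarrow>
     (\<forall>c\<in>A. (\<forall>y\<in>snd c ` fst c. lorentzian_form (G c y))
        \<and> (\<forall>v w. continuous_on (snd c ` fst c) (\<lambda>y. G c y v w)))
   \<and> (\<forall>c\<in>A. \<forall>c'\<in>A. \<forall>y\<in>snd c ` (fst c \<inter> fst c'). \<forall>v w.
        G c y v w = G c' (transition c c' y)
                      (frechet_derivative (transition c c') (at y) v)
                      (frechet_derivative (transition c c') (at y) w))"

definition lorentzian_C0_manifold ::
  "('m::{t2_space,second_countable_topology} set \<times> ('m \<Rightarrow> 'n::finite spt)) set
   \<Rightarrow> ('m set \<times> ('m \<Rightarrow> 'n spt) \<Rightarrow> 'n spt \<Rightarrow> 'n spt \<Rightarrow> 'n spt \<Rightarrow> real) \<Rightarrow> bool" where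
  "lorentzian_C0_manifold A G \<longleftrightarrow> smooth_atlas A \<and> C0_lorentz_metric A G"

definition kasner_M :: "'n::finite spt set" where
  "kasner_M = {x. fst x > 0}"

definition kasner_g :: "real ^ 'n::finite \<Rightarrow> 'n spt \<Rightarrow> 'n spt \<Rightarrow> 'n spt \<Rightarrow> real" where
  "kasner_g p x v w = - fst v * fst w + (\<Sum>i\<in>UNIV. fst x powr (2 * p $ i) * (snd v $ i) * (snd w $ i))"

text \<open>Past directed timelike vector (time orientation by d/dt: past directed iff g(v, d/dt) > 0).\<close>
definition kasner_pdtl_vec :: "real ^ 'n::finite \<Rightarrow> 'n spt \<Rightarrow> 'n spt \<Rightarrow> bool" where
  "kasner_pdtl_vec p x v \<longleftrightarrow> kasner_g p x v v < 0 \<and> kasner_g p x v (1, 0) > 0"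

text \<open>Piecewise smooth past directed timelike curve c : I -> M (I a real interval):
  c is continuous, and there are finitely many break points such that on every compact
  subinterval free of break points in its interior c is smooth with PDTL tangents (including
  one-sided tangents at the end points). Since the past cone is one component, the one-sided
  derivatives at break points automatically lie in the same component.\<close>
definition kasner_pdtl_curve :: "real ^ 'n::finite \<Rightarrow> real set \<Rightarrow> (real \<Rightarrow> 'n spt) \<Rightarrow> bool" where
  "kasner_pdtl_curve p I c \<longleftrightarrow> c ` I \<subseteq> kasner_M \<and> continuous_on I c \<and>
     (\<exists>K. finite K \<and> (\<forall>a b. a < b \<and> {a..b} \<subseteq> I \<and> {a<..<b} \<inter> K = {} \<longrightarrow>
         Cinf_on {a..b} c \<and>
         (\<forall>s\<in>{a..b}. kasner_pdtl_vec p (c s) (frechet_derivative c (at s within {a..b}) 1))))"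

definition smooth_isometric_embedding ::
  "real ^ 'n::finite
   \<Rightarrow> ('m::{t2_space,second_countable_topology} set \<times> ('m \<Rightarrow> 'n spt)) set
   \<Rightarrow> ('m set \<times> ('m \<Rightarrow> 'n spt) \<Rightarrow> 'n spt \<Rightarrow> 'n spt \<Rightarrow> 'n spt \<Rightarrow> real)
   \<Rightarrow> ('n spt \<Rightarrow> 'm) \<Rightarrow> bool" where
  "smooth_isometric_embedding p A G \<iota> \<longleftrightarrow>
     inj_on \<iota> kasner_M \<and> continuous_on kasner_M \<iota>
   \<and> continuous_on (\<iota> ` kasner_M) (inv_into kasner_M \<iota>)
   \<and> (\<forall>c\<in>A. Cinf_on (kasner_M \<inter> \<iota> -` fst c) (snd c \<circ> \<iota>))
   \<and> (\<forall>c\<in>A. \<forall>x\<in>kasner_M \<inter> \<iota> -` fst c. \<forall>v w.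
        G c (snd c (\<iota> x)) (frechet_derivative (snd c \<circ> \<iota>) (at x) v)
                          (frechet_derivative (snd c \<circ> \<iota>) (at x) w)
        = kasner_g p x v w)"

definition kasner_C0_extension ::
  "real ^ 'n::finite
   \<Rightarrow> ('m::{t2_space,second_countable_topology} set \<times> ('m \<Rightarrow> 'n spt)) set
   \<Rightarrow> ('m set \<times> ('m \<Rightarrow> 'n spt) \<Rightarrow> 'n spt \<Rightarrow> 'n spt \<Rightarrow> 'n spt \<Rightarrow> real)
   \<Rightarrow> ('n spt \<Rightarrow> 'm) \<Rightarrow> bool" where
  "kasner_C0_extension p A G \<iota> \<longleftrightarrow> lorentzian_C0_manifold A G
     \<and> smooth_isometric_embedding p A G \<iota> \<and> frontier (\<iota> ` kasner_M) \<noteq> {}"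

definition smooth_curve01 ::
  "('m::topological_space set \<times> ('m \<Rightarrow> 'n::finite spt)) set \<Rightarrow> (real \<Rightarrow> 'm) \<Rightarrow> bool" where
  "smooth_curve01 A \<gamma> \<longleftrightarrow> continuous_on {0..1} \<gamma>
     \<and> (\<forall>c\<in>A. Cinf_on ({0..1} \<inter> \<gamma> -` fst c) (snd c \<circ> \<gamma>))"

definition timelike_curve01 ::
  "('m::topological_space set \<times> ('m \<Rightarrow> 'n::finite spt)) set
   \<Rightarrow> ('m set \<times> ('m \<Rightarrow> 'n spt) \<Rightarrow> 'n spt \<Rightarrow> 'n spt \<Rightarrow> 'n spt \<Rightarrow> real)
   \<Rightarrow> (real \<Rightarrow> 'm) \<Rightarrow> bool" where
  "timelike_curve01 A G \<gamma> \<longleftrightarrow> smooth_curve01 A \<gamma> \<and>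
     (\<forall>c\<in>A. \<forall>t\<in>{0..1} \<inter> \<gamma> -` fst c.
        (let u = frechet_derivative (snd c \<circ> \<gamma>) (at t within ({0..1} \<inter> \<gamma> -` fst c)) 1
         in G c (snd c (\<gamma> t)) u u < 0))"

definition past_boundary ::
  "real ^ 'n::finite
   \<Rightarrow> ('m::{t2_space,second_countable_topology} set \<times> ('m \<Rightarrow> 'n spt)) set
   \<Rightarrow> ('m set \<times> ('m \<Rightarrow> 'n spt) \<Rightarrow> 'n spt \<Rightarrow> 'n spt \<Rightarrow> 'n spt \<Rightarrow> real)
   \<Rightarrow> ('n spt \<Rightarrow> 'm) \<Rightarrow> 'm set" where
  "past_boundary p A G \<iota> = {q \<in> frontier (\<iota> ` kasner_M). \<exists>\<gamma>.
      timelike_curve01 A G \<gamma> \<and> \<gamma> ` {0..<1} \<subseteq> \<iota> ` kasner_M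
      \<and> kasner_pdtl_curve p {0..<1} (inv_into kasner_M \<iota> \<circ> \<gamma>) \<and> \<gamma> 1 = q}"

end

theory Submission
  imports Defs
begin

text \<open>
  Suppose a timelike curve \<open>\<gamma>\<close> runs into a past boundary point, and look at a chart there, in which
  all light cones are close to that of the boundary point. Towards \<open>t = 0\<close> the comoving coordinates
  along \<open>\<gamma>\<close> converge, say to \<open>x\<close>. A past directed causal curve of the Kasner spacetime joining two
  points of \<open>\<gamma>\<close> is homotopic, through causal curves with the same end points, to the segment of
  \<open>\<gamma>\<close> between them (interpolate linearly at equal times), so it cannot leave the chart. Hence the
  chart contains a point on the boundary of the future of the ideal point \<open>(0, x)\<close> in a direction
  \<open>j\<close> with \<open>p\<^sub>j < 0\<close>.

  Parallel timelike chart lines above the boundary all run into \<open>t = 0\<close>, and the slices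
  \<open>t = \<tau>\<close> are graphs over the transversal directions, of uniformly bounded diameter. As
  \<open>\<tau>\<^bsup>p\<^sub>j\<^esup>\<close> tends to infinity, all these lines end at the same \<open>j\<close>-th coordinate, that of
  \<open>x\<close>. This is impossible for the line through the point found above, because the \<open>j\<close>-th coordinate
  of a timelike curve changes by less than the horizon radius.
\<close>

section \<open>Kasner kinematics\<close>

definition kasner_scale :: "real ^ 'n::finite \<Rightarrow> real \<Rightarrow> real ^ 'n \<Rightarrow> real ^ 'n" where
  "kasner_scale p t w = (\<chi> i. t powr (p $ i) * w $ i)"

definition horizon :: "real \<Rightarrow> real \<Rightarrow> real" where
  "horizon q t = t powr (1 - q) / (1 - q)"

lemma open_kasner_M: "open (kasner_M :: 'n::finite spt set)"
  unfolding kasner_M_def by (intro open_Collect_less continuous_intros)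

lemma linear_kasner_scale: "linear (kasner_scale p t)"
  by (auto simp: linear_iff kasner_scale_def vec_eq_iff algebra_simps)

lemma kasner_g_eq:
  assumes "x \<in> kasner_M"
  shows "kasner_g p x v v = (norm (kasner_scale p (fst x) (snd v)))\<^sup>2 - (fst v)\<^sup>2"
proof -
  have "fst x powr (2 * p $ i) = (fst x powr (p $ i))\<^sup>2" for i
    by (simp add: power2_eq_square powr_add [symmetric])
  then show ?thesis
    unfolding kasner_g_def power2_norm_eq_inner
    by (simp add: inner_vec_def kasner_scale_def power2_eq_square algebra_simps)
qed

lemma kasner_causal_iff:
  assumes "x \<in> kasner_M"
  shows "kasner_g p x v v \<le> 0 \<longleftrightarrow> norm (kasner_scale p (fst x) (snd v)) \<le> \<bar>fst v\<bar>"
  using abs_le_square_iff[of "norm (kasner_scale p (fst x) (snd v))" "fst v"]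
  by (simp add: kasner_g_eq[OF assms])

lemma kasner_timelike_iff:
  assumes "x \<in> kasner_M"
  shows "kasner_g p x v v < 0 \<longleftrightarrow> norm (kasner_scale p (fst x) (snd v)) < \<bar>fst v\<bar>"
  using abs_le_square_iff[of "fst v" "norm (kasner_scale p (fst x) (snd v))"]
  by (simp add: kasner_g_eq[OF assms] not_le[symmetric])

lemma kasner_timelike_fst_nonzero:
  assumes "x \<in> kasner_M" "kasner_g p x v v < 0"
  shows "fst v \<noteq> 0"
  using assms by (auto simp: kasner_timelike_iff)

lemma kasner_scale_component_le:
  assumes "t > 0"
  shows "\<bar>w $ i\<bar> \<le> t powr (- (p $ i)) * norm (kasner_scale p t w)"
proof -
  have "t powr (p $ i) * \<bar>w $ i\<bar> = \<bar>kasner_scale p t w $ i\<bar>"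
    by (simp add: kasner_scale_def abs_mult)
  also have "\<dots> \<le> norm (kasner_scale p t w)"
    by (rule component_le_norm_cart)
  finally show ?thesis
    using assms by (simp add: powr_minus field_simps)
qed

lemma norm_kasner_scale_axis:
  assumes "t > 0"
  shows "norm (kasner_scale p t ((t powr (- (p $ j)) * a) *\<^sub>R axis j 1)) = \<bar>a\<bar>"
proof -
  have "kasner_scale p t ((t powr (- (p $ j)) * a) *\<^sub>R axis j 1) = a *\<^sub>R axis j 1"
    using assms by (auto simp: kasner_scale_def axis_def vec_eq_iff powr_minus)
  then show ?thesis by simp
qed

lemma kasner_timelike_component_less:
  assumes "x \<in> kasner_M" "kasner_g p x v v < 0"
  shows "\<bar>snd v $ i\<bar> < fst x powr (- (p $ i)) * \<bar>fst v\<bar>"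
proof -
  have pos: "fst x > 0" using assms(1) by (simp add: kasner_M_def)
  have "\<bar>snd v $ i\<bar> \<le> fst x powr (- (p $ i)) * norm (kasner_scale p (fst x) (snd v))"
    by (rule kasner_scale_component_le[OF pos])
  also have "\<dots> < fst x powr (- (p $ i)) * \<bar>fst v\<bar>"
    using assms pos by (simp add: kasner_timelike_iff)
  finally show ?thesis .
qed

lemma kasner_g_nondegenerate:
  assumes "x \<in> kasner_M" "\<And>w. kasner_g p x v w = 0"
  shows "v = 0"
proof -
  have "fst v = 0" using assms(2)[of "(1, 0)"] by (simp add: kasner_g_def)
  moreover have "snd v $ i = 0" for i
  proof -
    have "(\<Sum>a\<in>UNIV. fst x powr (2 * p $ a) * snd v $ a * axis i 1 $ a) = 0"
      using assms(2)[of "(0, axis i 1)"] by (simp add: kasner_g_def)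
    moreover have "(\<Sum>a\<in>UNIV. fst x powr (2 * p $ a) * snd v $ a * axis i 1 $ a)
        = (\<Sum>a\<in>UNIV. if a = i then fst x powr (2 * p $ a) * snd v $ a else 0)"
      by (intro sum.cong) (auto simp: axis_def)
    ultimately have "fst x powr (2 * p $ i) * snd v $ i = 0" by simp
    then show ?thesis using assms(1) by (simp add: kasner_M_def)
  qed
  ultimately show ?thesis by (simp add: prod_eq_iff vec_eq_iff)
qed

lemma kasner_exponent_less_1:
  fixes p :: "real ^ 'n::finite"
  assumes "(\<Sum>i\<in>UNIV. (p $ i)\<^sup>2) = 1" "p $ j < 0"
  shows "p $ i < 1"
proof (cases "i = j")
  case False
  have "(\<Sum>l\<in>{i, j}. (p $ l)\<^sup>2) \<le> (\<Sum>l\<in>UNIV. (p $ l)\<^sup>2)"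
    by (rule sum_mono2) auto
  then have "(p $ i)\<^sup>2 + (p $ j)\<^sup>2 \<le> 1" using assms(1) False by simp
  moreover have "(p $ j)\<^sup>2 > 0" using assms(2) by simp
  ultimately have "(p $ i)\<^sup>2 < 1\<^sup>2" unfolding one_power2 by linarith
  then show ?thesis using power2_less_imp_less[of "p $ i" 1] by simp
qed (use assms in simp)

lemma horizon_has_derivative:
  assumes "t > 0" "q < 1"
  shows "(horizon q has_real_derivative t powr (- q)) (at t)"
proof -
  have "((\<lambda>t. t powr (1 - q) / (1 - q)) has_real_derivative
      ((1 - q) * t powr (1 - q - 1)) / (1 - q)) (at t)"
    using assms by (auto intro!: derivative_eq_intros)
  then show ?thesis
    using assms by (simp add: horizon_def[abs_def])
qed

lemma horizon_mono:
  assumes "0 < s" "s \<le> t" "q < 1"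
  shows "horizon q s \<le> horizon q t"
  using assms by (simp add: horizon_def divide_right_mono powr_mono2)

lemma horizon_pos: "0 < t \<Longrightarrow> q < 1 \<Longrightarrow> 0 < horizon q t"
  by (simp add: horizon_def)

lemma continuous_on_horizon:
  assumes "continuous_on S f" "\<And>x. x \<in> S \<Longrightarrow> 0 < f x"
  shows "continuous_on S (\<lambda>x. horizon q (f x))"
proof (cases "q = 1")
  case False
  show ?thesis
    unfolding horizon_def
    by (intro continuous_on_divide continuous_on_powr continuous_on_const assms(1))
      (use False assms(2) in fastforce)+
qed (simp add: horizon_def)

lemma tendsto_horizon_0:
  assumes "q < 1" "(f \<longlongrightarrow> 0) A" "\<forall>\<^sub>F x in A. 0 \<le> f x"
  shows "((\<lambda>x. horizon q (f x)) \<longlongrightarrow> 0) A"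
proof -
  have "((\<lambda>x. f x powr (1 - q)) \<longlongrightarrow> 0 powr (1 - q)) A"
    using assms by (intro tendsto_powr2) auto
  then show ?thesis
    unfolding horizon_def using tendsto_divide[of _ 0 A "\<lambda>_. 1 - q" "1 - q"] assms by simp
qed

lemma abs_diff_less_of_abs_deriv_less:
  fixes f h :: "real \<Rightarrow> real"
  assumes "a < b" and cont: "continuous_on {a..b} f" "continuous_on {a..b} h"
    and f: "\<And>s. s \<in> {a<..<b} \<Longrightarrow> (f has_real_derivative f' s) (at s)"
    and h: "\<And>s. s \<in> {a<..<b} \<Longrightarrow> (h has_real_derivative h' s) (at s)"
    and less: "\<And>s. s \<in> {a<..<b} \<Longrightarrow> \<bar>f' s\<bar> < - h' s"
  shows "\<bar>f b - f a\<bar> < h a - h b"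
proof -
  have "h b + \<sigma> * f b < h a + \<sigma> * f a" if \<sigma>: "\<bar>\<sigma>\<bar> = 1" for \<sigma>
  proof (rule DERIV_neg_imp_decreasing_open[OF \<open>a < b\<close>])
    fix s assume "a < s" "s < b"
    then have s: "s \<in> {a<..<b}" by simp
    have "((\<lambda>s. h s + \<sigma> * f s) has_real_derivative h' s + \<sigma> * f' s) (at s)"
      by (intro DERIV_add DERIV_cmult f h s)
    moreover have "h' s + \<sigma> * f' s < 0"
      using less[OF s] abs_ge_self[of "\<sigma> * f' s"] \<sigma> by (simp add: abs_mult)
    ultimately show "\<exists>y. ((\<lambda>s. h s + \<sigma> * f s) has_real_derivative y) (at s) \<and> y < 0" by blast
  qed (intro continuous_intros cont)
  from this[of 1] this[of "- 1"] show ?thesis by simp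
qed

lemma
  fixes c c' :: "real \<Rightarrow> 'n::finite spt"
  assumes "a < b" and cont: "continuous_on {a..b} c"
    and M: "\<And>s. s \<in> {a..b} \<Longrightarrow> c s \<in> kasner_M"
    and deriv: "\<And>s. s \<in> {a<..<b} \<Longrightarrow> (c has_vector_derivative c' s) (at s)"
    and past: "\<And>s. s \<in> {a<..<b} \<Longrightarrow> kasner_g p (c s) (c' s) (c' s) < 0 \<and> fst (c' s) < 0"
  shows kasner_past_curve_fst_less: "fst (c b) < fst (c a)"
    and kasner_past_curve_snd_less: "p $ i < 1 \<Longrightarrow> \<bar>snd (c b) $ i - snd (c a) $ i\<bar>
           < horizon (p $ i) (fst (c a)) - horizon (p $ i) (fst (c b))"
proof -
  have dT: "((\<lambda>s. fst (c s)) has_real_derivative fst (c' s)) (at s)" if "s \<in> {a<..<b}" for s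
    using bounded_linear.has_vector_derivative[OF bounded_linear_fst deriv[OF that]]
    by (simp add: has_real_derivative_iff_has_vector_derivative)
  have contT: "continuous_on {a..b} (\<lambda>s. fst (c s))"
    by (intro continuous_on_fst cont)
  show "fst (c b) < fst (c a)"
  proof (rule DERIV_neg_imp_decreasing_open[OF \<open>a < b\<close> _ contT])
    show "\<exists>y. ((\<lambda>s. fst (c s)) has_real_derivative y) (at s) \<and> y < 0" if "a < s" "s < b" for s
      using dT[of s] past[of s] that by auto
  qed
  show "\<bar>snd (c b) $ i - snd (c a) $ i\<bar>
      < horizon (p $ i) (fst (c a)) - horizon (p $ i) (fst (c b))" if p: "p $ i < 1"
  proof -
    have dX: "((\<lambda>s. snd (c s) $ i) has_real_derivative snd (c' s) $ i) (at s)"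
      if "s \<in> {a<..<b}" for s
      using bounded_linear.has_vector_derivative[OF bounded_linear_compose
          [OF bounded_linear_vec_nth bounded_linear_snd] deriv[OF that]]
      by (simp add: has_real_derivative_iff_has_vector_derivative)
    show ?thesis
    proof (rule abs_diff_less_of_abs_deriv_less[OF \<open>a < b\<close> _ _ dX])
      show "continuous_on {a..b} (\<lambda>s. snd (c s) $ i)"
        by (intro continuous_intros cont)
      show "continuous_on {a..b} (\<lambda>s. horizon (p $ i) (fst (c s)))"
        using M by (intro continuous_on_horizon contT) (auto simp: kasner_M_def)
      fix s assume s: "s \<in> {a<..<b}"
      then have M': "c s \<in> kasner_M" using M by auto
      show "((\<lambda>s. horizon (p $ i) (fst (c s))) has_real_derivative
          fst (c s) powr (- (p $ i)) * fst (c' s)) (at s)"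
        using DERIV_chain2[OF horizon_has_derivative[OF _ p] dT[OF s]] M'
        by (simp add: kasner_M_def)
      show "\<bar>snd (c' s) $ i\<bar> < - (fst (c s) powr (- (p $ i)) * fst (c' s))"
        using kasner_timelike_component_less[OF M', of p "c' s" i] past[OF s] by simp
    qed
  qed
qed

text \<open>Contains the part after time \<open>\<tau>\<close> of the timelike past of \<open>m\<close>.\<close>

definition past_box :: "real ^ 'n::finite \<Rightarrow> real \<Rightarrow> 'n spt \<Rightarrow> 'n spt set" where
  "past_box p \<tau> m = {\<tau>..fst m} \<times> cball (snd m) (\<Sum>i\<in>UNIV. horizon (p $ i) (fst m))"

lemma compact_past_box: "compact (past_box p \<tau> m)"
  unfolding past_box_def by (intro compact_Times compact_Icc compact_cball)

lemma past_box_subset_kasner_M: "0 < \<tau> \<Longrightarrow> past_box p \<tau> m \<subseteq> kasner_M"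
  by (auto simp: past_box_def kasner_M_def)

lemma in_past_boxI:
  assumes "0 < \<tau>" "\<tau> \<le> fst m'" "fst m' \<le> fst m" "\<And>i. p $ i < 1"
    and "\<And>i. \<bar>snd m' $ i - snd m $ i\<bar> \<le> horizon (p $ i) (fst m) - horizon (p $ i) (fst m')"
  shows "m' \<in> past_box p \<tau> m"
proof -
  have "norm (snd m' - snd m) \<le> (\<Sum>i\<in>UNIV. \<bar>(snd m' - snd m) $ i\<bar>)"
    by (rule norm_le_l1_cart)
  also have "\<dots> \<le> (\<Sum>i\<in>UNIV. horizon (p $ i) (fst m))"
  proof (rule sum_mono)
    show "\<bar>(snd m' - snd m) $ i\<bar> \<le> horizon (p $ i) (fst m)" for i
      using assms(5)[of i] horizon_pos[of "fst m'" "p $ i"] assms(1,2,4) by fastforce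
  qed
  finally show ?thesis
    using assms(2,3) by (simp add: past_box_def mem_Times_iff dist_norm norm_minus_commute)
qed

section \<open>Topological preliminaries\<close>

lemma closedin_tendsto_mem:
  assumes "closedin (top_of_set S) A" "(f \<longlongrightarrow> x) G" "\<forall>\<^sub>F t in G. f t \<in> A" "G \<noteq> bot" "x \<in> S"
  shows "x \<in> A"
proof -
  obtain C where C: "closed C" "A = S \<inter> C" using assms(1) by (auto simp: closedin_closed)
  have "\<forall>\<^sub>F t in G. f t \<in> C" using assms(3) by eventually_elim (simp add: C(2))
  then have "x \<in> C" by (rule Lim_in_closed_set[OF C(1) _ assms(4,2)])
  then show ?thesis using assms(5) C(2) by simp
qed

lemma openin_forall_compact:
  assumes "compact K" "openin (top_of_set (S \<times> K)) W"
  shows "openin (top_of_set S) {x \<in> S. \<forall>k\<in>K. (x, k) \<in> W}"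
proof (subst openin_subopen, intro ballI)
  obtain W' where W': "open W'" "W = (S \<times> K) \<inter> W'"
    using assms(2) by (auto simp: openin_open)
  fix x assume x: "x \<in> {x \<in> S. \<forall>k\<in>K. (x, k) \<in> W}"
  then have "{x} \<times> K \<subseteq> W'" using W'(2) by auto
  then obtain X where X: "x \<in> X" "open X" "X \<times> K \<subseteq> W'"
    using Elementary_Topology.tube_lemma[OF assms(1) W'(1)] by blast
  then have "S \<inter> X \<subseteq> {x \<in> S. \<forall>k\<in>K. (x, k) \<in> W}" using W'(2) by auto
  then show "\<exists>T. openin (top_of_set S) T \<and> x \<in> T \<and> T \<subseteq> {x \<in> S. \<forall>k\<in>K. (x, k) \<in> W}"
    using X x openin_open_Int[OF X(2)] by blast
qed

lemma eventually_forall_compact_less: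
  fixes f :: "'a::topological_space \<times> 'b::topological_space \<Rightarrow> 'c::linorder_topology"
  assumes "open S" "x \<in> S" "compact K" "continuous_on (S \<times> K) f" "\<And>k. k \<in> K \<Longrightarrow> f (x, k) < c"
  shows "\<forall>\<^sub>F y in nhds x. \<forall>k\<in>K. f (y, k) < c"
proof -
  let ?A = "{y \<in> S. \<forall>k\<in>K. (y, k) \<in> (S \<times> K) \<inter> f -` {..<c}}"
  have "openin (top_of_set (S \<times> K)) ((S \<times> K) \<inter> f -` {..<c})"
    by (rule continuous_openin_preimage_gen[OF assms(4)]) simp
  then have "open ?A"
    using openin_forall_compact[OF assms(3)] openin_open_eq[OF assms(1)] by blast
  moreover have "x \<in> ?A" using assms(2,5) by auto
  ultimately show ?thesis
    by (rule eventually_nhds_in_open[THEN eventually_mono]) auto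
qed

lemma closed_segment_subset_iff:
  fixes z w :: "'a::real_vector"
  shows "closed_segment z w \<subseteq> S \<longleftrightarrow> (\<forall>s\<in>{0..1}. w - s *\<^sub>R (w - z) \<in> S)"
proof -
  have "(1 - s) *\<^sub>R w + s *\<^sub>R z = w - s *\<^sub>R (w - z)" for s
    by (simp add: algebra_simps)
  then have "closed_segment w z = (\<lambda>s. w - s *\<^sub>R (w - z)) ` {0..1}"
    by (simp add: closed_segment_image_interval)
  then show ?thesis unfolding closed_segment_commute[of z] by auto
qed

lemma open_closed_segment_subset:
  fixes S :: "'a::euclidean_space set"
  assumes "open S"
  shows "open {q. closed_segment (fst q) (snd q) \<subseteq> S}"
proof -
  let ?h = "\<lambda>x::('a \<times> 'a) \<times> real. (1 - snd x) *\<^sub>R fst (fst x) + snd x *\<^sub>R snd (fst x)"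
  have "open (?h -` S)"
    using assms by (intro open_vimage continuous_intros)
  then have "open {q. \<forall>t\<in>{0..1}. ?h (q, t) \<in> S}"
    using openin_forall_compact[OF compact_Icc, of UNIV 0 1 "(UNIV \<times> {0..1}) \<inter> ?h -` S"]
    by (simp add: openin_open_Int)
  moreover have "{q. \<forall>t\<in>{0..1}. ?h (q, t) \<in> S} = {q. closed_segment (fst q) (snd q) \<subseteq> S}"
    unfolding closed_segment_def by fastforce
  ultimately show ?thesis by simp
qed

section \<open>Uniform cones of a continuous family of Lorentzian forms\<close>

definition cone_around :: "'a::real_normed_vector \<Rightarrow> real \<Rightarrow> 'a set" where
  "cone_around n k = {v. \<exists>a>0. norm (v - a *\<^sub>R n) \<le> k * a}"

lemma cone_aroundI: "0 < a \<Longrightarrow> norm (v - a *\<^sub>R n) \<le> k * a \<Longrightarrow> v \<in> cone_around n k"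
  by (auto simp: cone_around_def)

lemma minus_in_cone_around: "norm (v + n) \<le> k \<Longrightarrow> - v \<in> cone_around n k"
proof (rule cone_aroundI[of 1])
  assume "norm (v + n) \<le> k"
  moreover have "- v - 1 *\<^sub>R n = - (v + n)" by simp
  ultimately show "norm (- v - 1 *\<^sub>R n) \<le> k * 1" by (simp only: norm_minus_cancel mult_1_right)
qed simp

lemma cone_aroundE:
  assumes "v \<in> cone_around n k"
  obtains a u where "0 < a" "u \<in> cball n k" "v = a *\<^sub>R u"
proof -
  obtain a where a: "0 < a" "norm (v - a *\<^sub>R n) \<le> k * a"
    using assms by (auto simp: cone_around_def)
  have "v - a *\<^sub>R n = a *\<^sub>R (v /\<^sub>R a - n)"
    using a(1) by (simp add: scaleR_diff_right)
  then have "v /\<^sub>R a \<in> cball n k"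
    using a by (simp add: dist_norm norm_minus_commute mult.commute)
  then show thesis using that[OF a(1)] a(1) by simp
qed

lemma cone_around_add:
  assumes "v \<in> cone_around n k" "w \<in> cone_around n k"
  shows "v + w \<in> cone_around n k"
proof -
  obtain a b where ab: "a > 0" "norm (v - a *\<^sub>R n) \<le> k * a" "b > 0" "norm (w - b *\<^sub>R n) \<le> k * b"
    using assms by (auto simp: cone_around_def)
  have "norm (v + w - (a + b) *\<^sub>R n) \<le> norm (v - a *\<^sub>R n) + norm (w - b *\<^sub>R n)"
    using norm_triangle_ineq[of "v - a *\<^sub>R n" "w - b *\<^sub>R n"] by (simp add: algebra_simps)
  then show ?thesis
    using ab by (intro cone_aroundI[of "a + b"]) (auto simp: algebra_simps)
qed

lemma bilinear_eq_sum_Basis: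
  fixes B :: "'a::euclidean_space \<Rightarrow> 'b::euclidean_space \<Rightarrow> real"
  assumes "bilinear B"
  shows "B v w = (\<Sum>i\<in>Basis. \<Sum>j\<in>Basis. (v \<bullet> i) * (w \<bullet> j) * B i j)"
proof -
  have "B v w = B (\<Sum>i\<in>Basis. (v \<bullet> i) *\<^sub>R i) (\<Sum>j\<in>Basis. (w \<bullet> j) *\<^sub>R j)"
    by (simp add: euclidean_representation)
  also have "\<dots> = (\<Sum>(i, j)\<in>Basis \<times> Basis. B ((v \<bullet> i) *\<^sub>R i) ((w \<bullet> j) *\<^sub>R j))"
    by (rule bilinear_sum[OF assms])
  finally show ?thesis
    by (simp add: sum.cartesian_product bilinear_lmul[OF assms] bilinear_rmul[OF assms] mult_ac)
qed

lemma continuous_on_bilinear_family: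
  fixes g :: "'y::topological_space \<Rightarrow> 'a::euclidean_space \<Rightarrow> 'b::euclidean_space \<Rightarrow> real"
    and f :: "'c::topological_space \<Rightarrow> 'y"
  assumes "\<And>v w. continuous_on S (\<lambda>y. g y v w)" "\<And>y. y \<in> S \<Longrightarrow> bilinear (g y)"
    and "continuous_on A f" "f ` A \<subseteq> S" "continuous_on A v" "continuous_on A w"
  shows "continuous_on A (\<lambda>x. g (f x) (v x) (w x))"
proof -
  have "continuous_on A (\<lambda>x. \<Sum>i\<in>Basis. \<Sum>j\<in>Basis. (v x \<bullet> i) * (w x \<bullet> j) * g (f x) i j)"
    by (intro continuous_intros assms(5,6) continuous_on_compose2[OF assms(1,3,4)])
  moreover have "(\<Sum>i\<in>Basis. \<Sum>j\<in>Basis. (v x \<bullet> i) * (w x \<bullet> j) * g (f x) i j) = g (f x) (v x) (w x)"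
    if "x \<in> A" for x
    by (rule bilinear_eq_sum_Basis[OF assms(2), symmetric]) (use assms(4) that in blast)
  ultimately show ?thesis
    by (rule continuous_on_eq)
qed

lemma bilinear_scaleR_scaleR:
  fixes B :: "'a::real_vector \<Rightarrow> 'a \<Rightarrow> real"
  assumes "bilinear B"
  shows "B (a *\<^sub>R v) (b *\<^sub>R w) = a * b * B v w"
  by (simp add: bilinear_lmul[OF assms] bilinear_rmul[OF assms])

lemma lorentzian_form_bilinear:
  fixes B :: "'n::finite spt \<Rightarrow> 'n spt \<Rightarrow> real"
  assumes "lorentzian_form B"
  shows "bilinear B"
proof -
  obtain L :: "'n spt \<Rightarrow> 'n spt" where L: "linear L" "bij L" "\<And>v w. B (L v) (L w) = minkowski v w"
    using assms unfolding lorentzian_form_def by metis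
  have iv: "linear (inv L)"
    using L by (metis bij_betw_def inj_linear_imp_inv_linear)
  have "B v w = minkowski (inv L v) (inv L w)" for v w
    using L(2,3) by (metis bij_inv_eq_iff)
  then have "B = (\<lambda>v w. minkowski (inv L v) (inv L w))" by (simp add: fun_eq_iff)
  then show ?thesis
    using iv
    by (auto simp: bilinear_def linear_iff minkowski_def algebra_simps inner_add_left
        inner_add_right)
qed

lemma lorentzian_form_causal_functional:
  fixes B :: "'n::finite spt \<Rightarrow> 'n spt \<Rightarrow> real"
  assumes "lorentzian_form B" "B n n < 0"
  obtains l where "linear l" "l n > (0::real)" "\<And>v. v \<noteq> 0 \<Longrightarrow> B v v \<le> 0 \<Longrightarrow> norm v < \<bar>l v\<bar>"
proof -
  obtain L :: "'n spt \<Rightarrow> 'n spt" where L: "linear L" "bij L" "\<And>v w. B (L v) (L w) = minkowski v w"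
    using assms(1) unfolding lorentzian_form_def by metis
  define J where "J = inv L"
  have J: "linear J" unfolding J_def using L by (metis bij_betw_def inj_linear_imp_inv_linear)
  have LJ: "L (J v) = v" for v unfolding J_def using L(2) by (simp add: bij_is_surj surj_f_inv_f)
  have B_eq: "B v v = (norm (snd (J v)))\<^sup>2 - (fst (J v))\<^sup>2" for v
    unfolding power2_norm_eq_inner
    using L(3)[of "J v" "J v"] by (simp add: LJ minkowski_def power2_eq_square)
  obtain c where c: "c > 0" "\<And>v. norm (L v) \<le> c * norm v"
    using linear_bounded_pos[OF L(1)] by blast
  define l where "l v = 2 * c * sgn (fst (J n)) * fst (J v)" for v
  have fst_n: "fst (J n) \<noteq> 0" using assms(2) B_eq[of n] by auto
  show thesis
  proof
    show "linear l"
      unfolding l_def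
      by (rule linearI) (simp_all add: linear_add[OF J] linear_cmul[OF J] algebra_simps)
    show "l n > 0" using fst_n c(1) by (simp add: l_def sgn_real_def)
    show "norm v < \<bar>l v\<bar>" if v: "v \<noteq> 0" "B v v \<le> 0" for v
    proof -
      have "J v \<noteq> 0" using v(1) LJ[of v] linear_0[OF L(1)] by auto
      moreover have snd_le: "(norm (snd (J v)))\<^sup>2 \<le> (fst (J v))\<^sup>2" using v(2) by (simp add: B_eq)
      ultimately have "fst (J v) \<noteq> 0" by (auto simp: prod_eq_iff)
      then have "0 < (fst (J v))\<^sup>2" by simp
      then have "(fst (J v))\<^sup>2 + (norm (snd (J v)))\<^sup>2 < 4 * (fst (J v))\<^sup>2" using snd_le by linarith
      then have "(norm (J v))\<^sup>2 < (2 * \<bar>fst (J v)\<bar>)\<^sup>2"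
        by (simp add: norm_prod_def power_mult_distrib)
      then have "norm (J v) < 2 * \<bar>fst (J v)\<bar>"
        by (rule power_less_imp_less_base) simp
      then have "c * norm (J v) < \<bar>l v\<bar>"
        using c(1) fst_n by (simp add: l_def abs_mult sgn_real_def)
      then show ?thesis using c(2)[of "J v"] by (simp add: LJ)
    qed
  qed
qed

text \<open>Completing the square.\<close>

lemma bilinear_transversal_le:
  fixes h :: "'a::real_normed_vector \<Rightarrow> 'a \<Rightarrow> real"
  assumes h: "bilinear h" and bound: "\<And>v w. \<bar>h v w\<bar> \<le> B * norm v * norm w"
    and K: "K > 0" "h n n \<le> - K * (norm n)\<^sup>2"
  shows "h (d - q *\<^sub>R n) (d - q *\<^sub>R n) \<le> (B + B\<^sup>2 / K) * (norm d)\<^sup>2"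
proof -
  define N where "N = \<bar>q\<bar> * norm n"
  have "h (d - q *\<^sub>R n) (d - q *\<^sub>R n) = h d d - h d (q *\<^sub>R n) - h (q *\<^sub>R n) d + q\<^sup>2 * h n n"
    by (simp add: bilinear_lsub[OF h] bilinear_rsub[OF h] bilinear_lmul[OF h] bilinear_rmul[OF h]
        power2_eq_square algebra_simps)
  also have "\<dots> \<le> B * (norm d)\<^sup>2 + B * norm d * N + B * norm d * N - K * N\<^sup>2"
  proof -
    have "h d d \<le> B * (norm d)\<^sup>2" using bound[of d d] by (simp add: power2_eq_square)
    moreover have "- h d (q *\<^sub>R n) \<le> B * norm d * N"
      using bound[of d "q *\<^sub>R n"] by (simp add: N_def)
    moreover have "- h (q *\<^sub>R n) d \<le> B * norm d * N"
      using bound[of "q *\<^sub>R n" d] by (simp add: N_def mult_ac)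
    moreover have "q\<^sup>2 * h n n \<le> q\<^sup>2 * (- K * (norm n)\<^sup>2)" using K(2) by (intro mult_left_mono) auto
    moreover have "q\<^sup>2 * (- K * (norm n)\<^sup>2) = - K * N\<^sup>2" by (simp add: N_def power_mult_distrib)
    ultimately show ?thesis by linarith
  qed
  also have "\<dots> \<le> (B + B\<^sup>2 / K) * (norm d)\<^sup>2"
  proof -
    have "0 \<le> K * (N - B * norm d / K)\<^sup>2" using K(1) by simp
    also have "\<dots> = K * N\<^sup>2 - 2 * (B * norm d * N) + B\<^sup>2 / K * (norm d)\<^sup>2"
      using K(1) by (simp add: power2_eq_square field_simps)
    finally show ?thesis by (simp add: algebra_simps)
  qed
  finally show ?thesis .
qed

locale cone_field =
  fixes \<Omega> :: "'a::euclidean_space set" and g :: "'a \<Rightarrow> 'a \<Rightarrow> 'a \<Rightarrow> real"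
    and l :: "'a \<Rightarrow> real" and n :: 'a and k M :: real
  assumes linear_l: "linear l" and k_pos: "0 < k" and M_nonneg: "0 \<le> M"
    and causal_norm_le: "y \<in> \<Omega> \<Longrightarrow> g y v v \<le> 0 \<Longrightarrow> norm v \<le> \<bar>l v\<bar>"
    and cone_timelike: "y \<in> \<Omega> \<Longrightarrow> v \<in> cone_around n k \<Longrightarrow> g y v v < 0"
    and cone_l_pos: "v \<in> cone_around n k \<Longrightarrow> 0 < l v"
    and transversal_le: "y \<in> \<Omega> \<Longrightarrow> v \<in> cone_around n k \<Longrightarrow>
      g y (d - q *\<^sub>R v) (d - q *\<^sub>R v) \<le> (M * norm d)\<^sup>2"

context cone_field
begin

lemma bounded_linear_l: "bounded_linear l"
  using linear_l by (simp add: linear_conv_bounded_linear)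

lemma onorm_l_nonneg: "0 \<le> onorm l"
  by (rule onorm_pos_le[OF bounded_linear_l])

lemma l_diff_le:
  assumes "norm (y - y0) \<le> \<epsilon>" "norm (y' - y0) \<le> \<epsilon>"
  shows "l y - l y' \<le> 2 * onorm l * \<epsilon>"
proof -
  have "l y - l y' \<le> \<bar>l (y - y')\<bar>" by (simp add: linear_diff[OF linear_l])
  also have "\<dots> \<le> onorm l * norm (y - y')" using onorm[OF bounded_linear_l, of "y - y'"] by simp
  also have "\<dots> \<le> onorm l * (2 * \<epsilon>)"
    using norm_triangle_ineq4[of "y - y0" "y' - y0"] assms
    by (intro mult_left_mono onorm_l_nonneg) simp
  finally show ?thesis by (simp add: mult_ac)
qed

end

locale continuous_bilinear_family =
  fixes S :: "'y::topological_space set" and g :: "'y \<Rightarrow> 'a::euclidean_space \<Rightarrow> 'a \<Rightarrow> real"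
  assumes open_S: "open S" and continuous_g: "continuous_on S (\<lambda>y. g y v w)"
    and bilinear_g: "y \<in> S \<Longrightarrow> bilinear (g y)"
begin

lemma eventually_causal_norm_le:
  assumes "y0 \<in> S" and l: "linear l" "\<And>v. v \<noteq> 0 \<Longrightarrow> g y0 v v \<le> 0 \<Longrightarrow> norm v < \<bar>l v\<bar>"
  shows "\<forall>\<^sub>F y in nhds y0. \<forall>v. g y v v \<le> 0 \<longrightarrow> norm v \<le> \<bar>l v\<bar>"
proof -
  have "\<forall>\<^sub>F y in nhds y0. \<forall>v\<in>sphere 0 1.
      min (- g (fst (y, v)) (snd (y, v)) (snd (y, v))) (1 - \<bar>l (snd (y, v))\<bar>) < 0"
  proof (rule eventually_forall_compact_less[OF open_S assms(1) compact_sphere])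
    show "continuous_on (S \<times> sphere 0 1) (\<lambda>x. min (- g (fst x) (snd x) (snd x)) (1 - \<bar>l (snd x)\<bar>))"
      by (intro continuous_on_min continuous_intros
          continuous_on_bilinear_family[OF continuous_g bilinear_g]
          bounded_linear.continuous_on[of l]) (use l(1) in \<open>auto simp: linear_conv_bounded_linear\<close>)
    show "min (- g (fst (y0, v)) (snd (y0, v)) (snd (y0, v))) (1 - \<bar>l (snd (y0, v))\<bar>) < 0"
      if "v \<in> sphere 0 1" for v
      using l(2)[of v] that by (cases "g y0 v v \<le> 0"; cases "v = 0") (auto simp: min_less_iff_disj)
  qed
  then show ?thesis
    using eventually_nhds_in_open[OF open_S assms(1)]
  proof eventually_elim
    case (elim y)
    show ?case
    proof (intro allI impI)
      fix v assume v: "g y v v \<le> 0"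
      show "norm v \<le> \<bar>l v\<bar>"
      proof (cases "v = 0")
        case False
        let ?u = "v /\<^sub>R norm v"
        have "g y ?u ?u \<le> 0"
          using v bilinear_scaleR_scaleR[OF bilinear_g[OF elim(2)]]
          by (simp add: mult_nonneg_nonpos)
        moreover have "?u \<in> sphere 0 1" using False by simp
        ultimately have "1 < \<bar>l ?u\<bar>" using elim(1) by (fastforce simp: min_less_iff_disj)
        then show ?thesis using False by (simp add: linear_cmul[OF l(1)] abs_mult field_simps)
      qed simp
    qed
  qed
qed

lemma uniformly_timelike_cball:
  assumes "y0 \<in> S" and l: "linear l" "l n > (0::real)" and n: "g y0 n n < 0"
  obtains k K where "k > 0" "K > 0" "\<And>u. u \<in> cball n k \<Longrightarrow> g y0 u u + K * (norm u)\<^sup>2 < 0 \<and> 0 < l u"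
proof -
  have "n \<noteq> 0" using l by (auto simp: linear_0)
  define K where "K = - g y0 n n / (2 * (norm n)\<^sup>2)"
  let ?h = "\<lambda>v. g y0 v v + K * (norm v)\<^sup>2"
  have "isCont ?h n"
    using continuous_on_bilinear_family[OF continuous_g bilinear_g, of UNIV
        "\<lambda>_. y0" "\<lambda>v. v" "\<lambda>v. v"] assms(1)
    by (auto intro!: continuous_intros simp: continuous_on_eq_continuous_at)
  then have "(?h \<longlongrightarrow> ?h n) (nhds n)"
    using tendsto_at_iff_tendsto_nhds[of ?h n] by (simp add: continuous_at)
  moreover have "?h n < 0"
    using n \<open>n \<noteq> 0\<close> by (simp add: K_def)
  ultimately have "\<forall>\<^sub>F v in nhds n. ?h v < 0"
    by (rule order_tendstoD(2))
  moreover have "\<forall>\<^sub>F v in nhds n. 0 < l v"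
    using linear_continuous_at[of l n] l
    by (intro order_tendstoD(1)[of _ "l n"])
      (auto simp: linear_conv_bounded_linear continuous_at tendsto_at_iff_tendsto_nhds)
  ultimately have "\<forall>\<^sub>F v in nhds n. ?h v < 0 \<and> 0 < l v"
    by (rule eventually_conj)
  then obtain d where d: "d > 0" "\<And>v. dist v n < d \<Longrightarrow> ?h v < 0 \<and> 0 < l v"
    unfolding eventually_nhds_metric by blast
  have "K > 0" using n \<open>n \<noteq> 0\<close> by (simp add: K_def divide_neg_pos)
  then show thesis using that[of "d / 2" K] d by (simp add: dist_commute)
qed

lemma eventually_cone_timelike:
  assumes "y0 \<in> S" and l: "linear l" "l n > (0::real)" and n: "g y0 n n < 0"
  obtains k K where "k > 0" "K > 0" "\<And>v. v \<in> cone_around n k \<Longrightarrow> 0 < l v"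
    "\<forall>\<^sub>F y in nhds y0. \<forall>v\<in>cone_around n k. g y v v \<le> - K * (norm v)\<^sup>2"
proof -
  obtain k K where k: "k > 0" "K > 0"
    and near: "\<And>u. u \<in> cball n k \<Longrightarrow> g y0 u u + K * (norm u)\<^sup>2 < 0 \<and> 0 < l u"
    using uniformly_timelike_cball[OF assms] by blast
  let ?h = "\<lambda>x. g (fst x) (snd x) (snd x) + K * (norm (snd x))\<^sup>2"
  have "\<forall>\<^sub>F y in nhds y0. \<forall>u\<in>cball n k. ?h (y, u) < 0"
  proof (rule eventually_forall_compact_less[OF open_S assms(1) compact_cball])
    show "continuous_on (S \<times> cball n k) ?h"
      by (intro continuous_intros continuous_on_bilinear_family[OF continuous_g bilinear_g]) auto
  qed (use near in simp)
  then have "\<forall>\<^sub>F y in nhds y0. \<forall>v\<in>cone_around n k. g y v v \<le> - K * (norm v)\<^sup>2"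
    using eventually_nhds_in_open[OF open_S assms(1)]
  proof eventually_elim
    case (elim y)
    show ?case
    proof
      fix v assume "v \<in> cone_around n k"
      then obtain a u where u: "0 < a" "u \<in> cball n k" "v = a *\<^sub>R u" by (rule cone_aroundE)
      have "a\<^sup>2 * (g y u u + K * (norm u)\<^sup>2) \<le> 0"
        using elim(1) u by (intro mult_nonneg_nonpos) (auto intro: less_imp_le)
      then show "g y v v \<le> - K * (norm v)\<^sup>2"
        by (simp add: u(3) bilinear_scaleR_scaleR[OF bilinear_g[OF elim(2)]] power_mult_distrib
            power2_eq_square algebra_simps)
    qed
  qed
  moreover have "0 < l v" if v: "v \<in> cone_around n k" for v
  proof -
    obtain a u where u: "0 < a" "u \<in> cball n k" "v = a *\<^sub>R u"
      using v by (rule cone_aroundE)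
    then show ?thesis using near by (simp add: linear_cmul[OF l(1)])
  qed
  ultimately show thesis using that[of k K] k by simp
qed

lemma eventually_bilinear_bounded:
  assumes "y0 \<in> S"
  obtains B where "B > 0" "\<forall>\<^sub>F y in nhds y0. \<forall>v w. \<bar>g y v w\<bar> \<le> B * norm v * norm w"
proof -
  obtain B where B: "B > 0" "\<And>v w. \<bar>g y0 v w\<bar> \<le> B * norm v * norm w"
    using bilinear_bounded_pos[OF bilinear_g[OF assms]] by auto
  let ?K = "sphere 0 1 \<times> sphere 0 1 :: ('a \<times> 'a) set"
  have "\<forall>\<^sub>F y in nhds y0. \<forall>u\<in>?K. \<bar>g (fst (y, u)) (fst (snd (y, u))) (snd (snd (y, u)))\<bar> < B + 1"
  proof (rule eventually_forall_compact_less[OF open_S assms])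
    show "continuous_on (S \<times> ?K) (\<lambda>x. \<bar>g (fst x) (fst (snd x)) (snd (snd x))\<bar>)"
      by (intro continuous_intros continuous_on_bilinear_family[OF continuous_g bilinear_g]) auto
    show "\<bar>g (fst (y0, u)) (fst (snd (y0, u))) (snd (snd (y0, u)))\<bar> < B + 1" if "u \<in> ?K" for u
      using B(2)[of "fst u" "snd u"] that by auto
  qed (intro compact_Times compact_sphere)
  then have "\<forall>\<^sub>F y in nhds y0. \<forall>v w. \<bar>g y v w\<bar> \<le> (B + 1) * norm v * norm w"
    using eventually_nhds_in_open[OF open_S assms]
  proof eventually_elim
    case (elim y)
    show ?case
    proof (intro allI)
      fix v w
      let ?e = "\<lambda>v :: 'a. v /\<^sub>R norm v"
      show "\<bar>g y v w\<bar> \<le> (B + 1) * norm v * norm w"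
      proof (cases "v = 0 \<or> w = 0")
        case True
        then show ?thesis
          using bilinear_lzero[OF bilinear_g[OF elim(2)]] bilinear_rzero[OF bilinear_g[OF elim(2)]]
          by auto
      next
        case False
        then have "(?e v, ?e w) \<in> ?K" by simp
        then have "\<bar>g y (?e v) (?e w)\<bar> < B + 1" using elim(1) by fastforce
        then show ?thesis
          using False bilinear_scaleR_scaleR[OF bilinear_g[OF elim(2)]]
          by (simp add: abs_mult field_simps)
      qed
    qed
  qed
  then show thesis using that[of "B + 1"] B(1) by simp
qed

end

lemma lorentzian_family_cone_field:
  fixes g :: "'n::finite spt \<Rightarrow> 'n spt \<Rightarrow> 'n spt \<Rightarrow> real"
  assumes "open S" "y0 \<in> S" "\<And>v w. continuous_on S (\<lambda>y. g y v w)"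
    and lorentz: "\<And>y. y \<in> S \<Longrightarrow> lorentzian_form (g y)" and n: "g y0 n n < 0"
  obtains R l k M where "R > 0" "ball y0 R \<subseteq> S" "cone_field (ball y0 R) g l n k M"
proof -
  interpret continuous_bilinear_family S g
    by unfold_locales (use assms lorentzian_form_bilinear in blast)+
  obtain l where l: "linear l" "l n > (0::real)" "\<And>v. v \<noteq> 0 \<Longrightarrow> g y0 v v \<le> 0 \<Longrightarrow> norm v < \<bar>l v\<bar>"
    using lorentzian_form_causal_functional[OF lorentz[OF assms(2)] n] by blast
  obtain k K where k: "k > 0" "K > 0" "\<And>v. v \<in> cone_around n k \<Longrightarrow> 0 < l v"
    and cone: "\<forall>\<^sub>F y in nhds y0. \<forall>v\<in>cone_around n k. g y v v \<le> - K * (norm v)\<^sup>2"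
    using eventually_cone_timelike[OF assms(2) l(1,2) n] by blast
  obtain B where B: "B > 0" and bounded: "\<forall>\<^sub>F y in nhds y0. \<forall>v w. \<bar>g y v w\<bar> \<le> B * norm v * norm w"
    using eventually_bilinear_bounded[OF assms(2)] by blast
  obtain R where R: "R > 0" and near: "\<And>y. dist y y0 < R \<Longrightarrow> y \<in> S \<and> (\<forall>v. g y v v \<le> 0 \<longrightarrow> norm v \<le> \<bar>l v\<bar>)
      \<and> (\<forall>v\<in>cone_around n k. g y v v \<le> - K * (norm v)\<^sup>2) \<and> (\<forall>v w. \<bar>g y v w\<bar> \<le> B * norm v * norm w)"
    using eventually_conj[OF eventually_nhds_in_open[OF assms(1,2)] eventually_conj
        [OF eventually_causal_norm_le[OF assms(2) l(1,3)] eventually_conj[OF cone bounded]]]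
    unfolding eventually_nhds_metric by blast
  have "cone_field (ball y0 R) g l n k (sqrt (B + B\<^sup>2 / K))"
  proof (rule cone_field.intro)
    show "g y v v < 0" if "y \<in> ball y0 R" "v \<in> cone_around n k" for y v
    proof -
      have "v \<noteq> 0" using k(3)[OF that(2)] linear_0[OF l(1)] by auto
      then show ?thesis
        using near[of y] that k(2) by (force simp: dist_commute intro: le_less_trans)
    qed
    show "g y (d - q *\<^sub>R v) (d - q *\<^sub>R v) \<le> (sqrt (B + B\<^sup>2 / K) * norm d)\<^sup>2"
      if "y \<in> ball y0 R" "v \<in> cone_around n k" for y v d q
    proof -
      have y: "y \<in> S" "\<And>v w. \<bar>g y v w\<bar> \<le> B * norm v * norm w" "g y v v \<le> - K * (norm v)\<^sup>2"
        using near[of y] that by (simp_all add: dist_commute del: split_paired_All)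
      show ?thesis
        using bilinear_transversal_le[OF bilinear_g[OF y(1)] y(2) k(2) y(3)] B k(2)
        by (simp add: power_mult_distrib)
    qed
    show "norm v \<le> \<bar>l v\<bar>" if "y \<in> ball y0 R" "g y v v \<le> 0" for y v
      using near[of y] that by (simp add: dist_commute del: split_paired_All)
  qed (use l k B in simp_all)
  then show thesis using that[OF R] near by (auto simp: dist_commute subset_iff)
qed

section \<open>Charts of a Kasner extension\<close>

text \<open>The part of a Kasner extension seen in one chart with image \<open>\<Omega>\<close>. The closed graph encodes
  that the extension is a Hausdorff space.\<close>

locale kasner_chart =
  fixes p :: "real ^ 'n::finite" and \<Omega> :: "'n spt set" and g :: "'n spt \<Rightarrow> 'n spt \<Rightarrow> 'n spt \<Rightarrow> real"
    and D :: "'n spt set" and E :: "'n spt \<Rightarrow> 'n spt"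
  assumes exponent_less_1: "p $ i < 1"
    and bilinear_g: "y \<in> \<Omega> \<Longrightarrow> bilinear (g y)"
    and open_D: "open D" and D_subset: "D \<subseteq> kasner_M" and inj_E: "inj_on E D"
      and E_in: "m \<in> D \<Longrightarrow> E m \<in> \<Omega>"
    and E_differentiable: "E differentiable_on D"
    and continuous_derivative_E: "continuous_on D (\<lambda>m. frechet_derivative E (at m) v)"
    and isometric_E: "m \<in> D \<Longrightarrow>
      g (E m) (frechet_derivative E (at m) v) (frechet_derivative E (at m) w) = kasner_g p m v w"
    and closed_graph: "closedin (top_of_set (kasner_M \<times> \<Omega>)) ((\<lambda>m. (m, E m)) ` D)"
begin

abbreviation "E' m \<equiv> frechet_derivative E (at m)"

definition Y :: "'n spt set" where "Y = E ` D"

definition F :: "'n spt \<Rightarrow> 'n spt" where "F = inv_into D E"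

definition F' :: "'n spt \<Rightarrow> 'n spt \<Rightarrow> 'n spt" where "F' y = inv (E' (F y))"

abbreviation "T y \<equiv> fst (F y)"
abbreviation "X y i \<equiv> snd (F y) $ i"
abbreviation "\<eta> i \<equiv> horizon (p $ i)"

lemma F_E: "m \<in> D \<Longrightarrow> F (E m) = m"
  using inj_E by (simp add: F_def)

lemma E_F: "y \<in> Y \<Longrightarrow> E (F y) = y"
  by (simp add: F_def Y_def f_inv_into_f)

lemma E_in_Y: "m \<in> D \<Longrightarrow> E m \<in> Y"
  by (simp add: Y_def)

lemma F_in_D: "y \<in> Y \<Longrightarrow> F y \<in> D"
  by (simp add: F_def Y_def inv_into_into)

lemma F_in_kasner_M: "y \<in> Y \<Longrightarrow> F y \<in> kasner_M"
  using F_in_D D_subset by blast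

lemma T_pos: "y \<in> Y \<Longrightarrow> T y > 0"
  using F_in_kasner_M by (auto simp: kasner_M_def)

lemma Y_subset: "Y \<subseteq> \<Omega>"
  using E_in by (auto simp: Y_def)

lemma E_has_derivative: "m \<in> D \<Longrightarrow> (E has_derivative E' m) (at m)"
  using E_differentiable open_D frechet_derivative_works
  by (metis at_within_open differentiable_on_def)

lemma continuous_on_E: "continuous_on D E"
  using E_differentiable by (rule differentiable_imp_continuous_on)

lemma linear_E': "m \<in> D \<Longrightarrow> linear (E' m)"
  using E_has_derivative has_derivative_linear by blast

lemma bij_E':
  assumes m: "m \<in> D"
  shows "bij (E' m)"
proof -
  have "v = 0" if v: "E' m v = 0" for v
  proof (rule kasner_g_nondegenerate)
    show "m \<in> kasner_M" using m D_subset by blast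
    show "kasner_g p m v w = 0" for w
      using isometric_E[OF m, of v w, symmetric] v bilinear_lzero[OF bilinear_g[OF E_in[OF m]]]
      by simp
  qed
  then have "inj (E' m)" using linear_injective_0[OF linear_E'[OF m]] by blast
  then show ?thesis
    using linear_injective_imp_surjective[OF linear_E'[OF m]] by (simp add: bij_def)
qed

lemma open_Y: "open Y"
  unfolding Y_def by (rule invariance_of_domain[OF continuous_on_E open_D inj_E])

lemma F_has_derivative:
  assumes "y \<in> Y"
  shows "(F has_derivative F' y) (at y)"
proof -
  have D: "F y \<in> D" by (rule F_in_D[OF assms])
  have "E' (F y) \<circ> F' y = id"
    unfolding F'_def using bij_E'[OF D] by (simp add: bij_is_surj surj_iff[symmetric])
  then have "(F has_derivative F' y) (at (E (F y)))"
    using has_derivative_inverse_strong[of D "F y" E F] open_D D continuous_on_E F_E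
      E_has_derivative
    by blast
  then show ?thesis by (simp add: E_F[OF assms])
qed

lemma linear_F': "y \<in> Y \<Longrightarrow> linear (F' y)"
  using F_has_derivative has_derivative_linear by blast

lemma continuous_on_F: "continuous_on Y F"
  using F_has_derivative by (meson has_derivative_continuous continuous_at_imp_continuous_on)

lemma E'_F': "y \<in> Y \<Longrightarrow> E' (F y) (F' y w) = w"
  using bij_E'[OF F_in_D] by (simp add: F'_def bij_is_surj surj_f_inv_f)

lemma isometric_F: "y \<in> Y \<Longrightarrow> kasner_g p (F y) (F' y v) (F' y w) = g y v w"
  using isometric_E[OF F_in_D, of y "F' y v" "F' y w"] by (simp add: E'_F' E_F)

lemma F_comp_has_vector_derivative:
  assumes "(c has_vector_derivative c') (at s)" "c s \<in> Y"
  shows "((\<lambda>s. F (c s)) has_vector_derivative F' (c s) c') (at s)"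
  using vector_derivative_diff_chain_within[OF assms(1)
      has_derivative_at_withinI[OF F_has_derivative[OF assms(2)]]]
  by (simp add: o_def)

lemma closed_graph_extension:
  obtains C where "closed C" "\<And>m y. m \<in> kasner_M \<Longrightarrow> y \<in> \<Omega> \<Longrightarrow> (m, y) \<in> C \<longleftrightarrow> m \<in> D \<and> y = E m"
proof -
  obtain C where C: "closed C" "(\<lambda>m. (m, E m)) ` D = (kasner_M \<times> \<Omega>) \<inter> C"
    using closed_graph by (auto simp: closedin_closed)
  show thesis
  proof (rule that[OF C(1)])
    fix m :: "'n spt" and y assume "m \<in> kasner_M" "y \<in> \<Omega>"
    then have "(m, y) \<in> C \<longleftrightarrow> (m, y) \<in> (\<lambda>m. (m, E m)) ` D" by (simp add: C(2))
    then show "(m, y) \<in> C \<longleftrightarrow> m \<in> D \<and> y = E m" by auto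
  qed
qed

lemma closedin_F_preimage:
  assumes K: "compact K" "K \<subseteq> kasner_M"
  shows "closedin (top_of_set \<Omega>) {y \<in> Y. F y \<in> K}"
proof -
  obtain C where C: "closed C" "\<And>m y. m \<in> kasner_M \<Longrightarrow> y \<in> \<Omega> \<Longrightarrow> (m, y) \<in> C \<longleftrightarrow> m \<in> D \<and> y = E m"
    using closed_graph_extension by blast
  have "closedin (top_of_set \<Omega>) {y. \<exists>m. m \<in> K \<and> (m, y) \<in> (K \<times> \<Omega>) \<inter> C}"
    using C(1) by (intro closedin_compact_projection[OF K(1)]) (simp add: closedin_closed_Int)
  moreover have "{y. \<exists>m. m \<in> K \<and> (m, y) \<in> (K \<times> \<Omega>) \<inter> C} = E ` (D \<inter> K)"
    using C(2) K(2) E_in by blast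
  moreover have "E ` (D \<inter> K) = {y \<in> Y. F y \<in> K}"
    using F_E by (auto simp: Y_def)
  ultimately show ?thesis by simp
qed

lemma closedin_E_preimage:
  assumes S: "compact S" "S \<subseteq> \<Omega>"
  shows "closedin (top_of_set kasner_M) {m \<in> D. E m \<in> S}"
proof -
  obtain C where C: "closed C" "\<And>m y. m \<in> kasner_M \<Longrightarrow> y \<in> \<Omega> \<Longrightarrow> (m, y) \<in> C \<longleftrightarrow> m \<in> D \<and> y = E m"
    using closed_graph_extension by blast
  have "closed (prod.swap -` C)"
    by (intro closed_vimage C(1) continuous_on_swap)
  then have "closedin (top_of_set kasner_M) {m. \<exists>y. y \<in> S \<and> (y, m) \<in> (S \<times> kasner_M) \<inter> prod.swap -` C}"
    by (intro closedin_compact_projection[OF S(1)]) (simp add: closedin_closed_Int)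
  moreover have "{m. \<exists>y. y \<in> S \<and> (y, m) \<in> (S \<times> kasner_M) \<inter> prod.swap -` C} = {m \<in> D. E m \<in> S}"
    using C(2) S(2) D_subset
    by (simp add: set_eq_iff subset_iff del: split_paired_All split_paired_Ex) metis
  ultimately show ?thesis by simp
qed

lemma tendsto_in_Y:
  assumes "compact K" "K \<subseteq> kasner_M" "\<forall>\<^sub>F t in G. f t \<in> Y \<and> F (f t) \<in> K" "(f \<longlongrightarrow> y) G" "G \<noteq> bot"
    "y \<in> \<Omega>"
  shows "y \<in> Y"
  using closedin_tendsto_mem[OF closedin_F_preimage[OF assms(1,2)] assms(4) _ assms(5,6)] assms(3)
  by simp

end

locale kasner_cone_chart = kasner_chart p \<Omega> g D E + cone_field \<Omega> g l n k M
  for p :: "real ^ 'n::finite" and \<Omega> g D E l n k M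
begin

lemma l_E'_nonzero:
  assumes "m \<in> D" "kasner_g p m v v \<le> 0" "v \<noteq> 0"
  shows "l (E' m v) \<noteq> 0"
proof
  assume "l (E' m v) = 0"
  then have "E' m v = 0"
    using causal_norm_le[OF E_in[OF assms(1)], of "E' m v"] isometric_E[OF assms(1)] assms(2)
    by simp
  then show False
    using assms(3) linear_0[OF linear_E'[OF assms(1)]] bij_E'[OF assms(1)]
    by (metis bij_is_inj injD)
qed

text \<open>The future cone is convex and \<open>l \<circ> E' m\<close> has no zero on it.\<close>

lemma l_E'_same_sign:
  assumes m: "m \<in> D" and v: "kasner_g p m v v \<le> 0" "fst v > 0"
  shows "l (E' m v) * l (E' m (1, 0)) > 0"
proof (rule ccontr)
  define f where "f w = l (E' m w)" for w
  have f: "linear f"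
    unfolding f_def using linear_compose[OF linear_E'[OF m] linear_l] by (simp add: o_def)
  define a b where "a = f v" and "b = fst v * f (1, 0)"
  have "m \<in> kasner_M" using m D_subset by blast
  note causal_iff = kasner_causal_iff[OF this]
  have b0: "b \<noteq> 0"
    using l_E'_nonzero[OF m, of "(1, 0)"] v(2) by (simp add: b_def f_def kasner_g_def zero_prod_def)
  assume "\<not> l (E' m v) * l (E' m (1, 0)) > 0"
  then have "fst v * (a * f (1, 0)) \<le> 0"
    using v(2) by (simp add: a_def f_def mult_nonneg_nonpos not_less)
  then have ab: "a * b \<le> 0" by (simp add: b_def mult_ac)
  define t where "t = a / (a - b)"
  have t: "0 \<le> t" "t \<le> 1" "(1 - t) * a + t * b = 0"
    using ab b0 unfolding t_def by (auto simp: mult_le_0_iff field_simps)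
  define w where "w = (1 - t) *\<^sub>R v + (t * fst v) *\<^sub>R (1, 0)"
  have w: "fst w = fst v" "snd w = (1 - t) *\<^sub>R snd v"
    by (simp_all add: w_def algebra_simps)
  have "norm ((1 - t) *\<^sub>R kasner_scale p (fst m) (snd v)) \<le> 1 * norm (kasner_scale p (fst m) (snd v))"
    unfolding norm_scaleR using t by (intro mult_right_mono) auto
  then have "kasner_g p m w w \<le> 0"
    using v(1) by (simp add: causal_iff w linear_cmul[OF linear_kasner_scale])
  then have "f w \<noteq> 0"
    unfolding f_def using l_E'_nonzero[OF m] v(2) w(1) by (metis fst_zero less_irrefl)
  moreover have "f w = (1 - t) * a + t * b"
    by (simp add: w_def a_def b_def linear_add[OF f] linear_cmul[OF f] del: scaleR_Pair)
  ultimately show False using t(3) by simp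
qed

lemma l_E'_past_iff:
  assumes m: "m \<in> D" and v: "kasner_g p m v v \<le> 0" "fst v < 0"
  shows "l (E' m v) < 0 \<longleftrightarrow> 0 < l (E' m (1, 0))"
proof -
  have "kasner_g p m (- v) (- v) \<le> 0" using v(1) by (simp add: kasner_g_def)
  then have "l (E' m (- v)) * l (E' m (1, 0)) > 0" using l_E'_same_sign[OF m, of "- v"] v(2) by simp
  then show ?thesis
    by (auto simp: linear_neg[OF linear_E'[OF m]] linear_neg[OF linear_l] zero_less_mult_iff
        mult_less_0_iff)
qed

end

definition past_causal_at :: "real ^ 'n::finite \<Rightarrow> (real \<Rightarrow> 'n spt) \<Rightarrow> real \<Rightarrow> bool" where
  "past_causal_at p c s \<longleftrightarrow>
     (\<exists>v. (c has_vector_derivative v) (at s) \<and> kasner_g p (c s) v v \<le> 0 \<and> fst v < 0)"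

lemma past_causal_at_transform_open:
  assumes "past_causal_at p c s" "open S" "s \<in> S" "\<And>t. t \<in> S \<Longrightarrow> c t = c' t"
  shows "past_causal_at p c' s"
proof -
  obtain v where v: "(c has_vector_derivative v) (at s)" "kasner_g p (c s) v v \<le> 0" "fst v < 0"
    using assms(1) by (auto simp: past_causal_at_def)
  have "(c' has_vector_derivative v) (at s)"
    by (rule has_vector_derivative_transform_within_open[OF v(1) assms(2-4)])
  then show ?thesis
    unfolding past_causal_at_def using v assms(3,4) by (intro exI[of _ v]) simp
qed

locale kasner_patch = kasner_cone_chart p \<Omega> g D E l n k M
  for p :: "real ^ 'n::finite" and \<Omega> g D E l n k M +
  assumes convex_\<Omega>: "convex \<Omega>" and future_E': "m \<in> D \<Longrightarrow> 0 < l (frechet_derivative E (at m) (1, 0))"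
begin

lemma l_E'_past_le:
  assumes m: "m \<in> D" and v: "kasner_g p m v v \<le> 0" "fst v < 0"
  shows "norm (E' m v) \<le> - l (E' m v)"
  using causal_norm_le[OF E_in[OF m], of "E' m v"] isometric_E[OF m] l_E'_past_iff[OF assms]
    future_E'[OF m] v
  by simp

lemma F'_cone:
  assumes y: "y \<in> Y" and v: "v \<in> cone_around n k"
  shows "kasner_g p (F y) (F' y v) (F' y v) < 0" and "0 < fst (F' y v)"
proof -
  have D: "F y \<in> D" by (rule F_in_D[OF y])
  show timelike: "kasner_g p (F y) (F' y v) (F' y v) < 0"
    using isometric_F[OF y] cone_timelike[of y v] y v Y_subset by auto
  have "\<not> fst (F' y v) < 0"
  proof
    assume "fst (F' y v) < 0"
    then show False
      using l_E'_past_iff[OF D less_imp_le[OF timelike]] future_E'[OF D] cone_l_pos[OF v]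
      by (simp add: E'_F'[OF y])
  qed
  then show "0 < fst (F' y v)"
    using kasner_timelike_fst_nonzero[OF F_in_kasner_M[OF y] timelike] by simp
qed

lemma
  assumes ab: "a < b" and cont: "continuous_on {a..b} c"
    and Y: "\<And>s. s \<in> {a..b} \<Longrightarrow> c s \<in> Y"
    and deriv: "\<And>s. s \<in> {a<..<b} \<Longrightarrow> (c has_vector_derivative c' s) (at s)"
    and cone: "\<And>s. s \<in> {a<..<b} \<Longrightarrow> - c' s \<in> cone_around n k"
  shows past_curve_T_less: "T (c b) < T (c a)"
    and past_curve_X_less: "\<bar>X (c b) i - X (c a) i\<bar> < \<eta> i (T (c a)) - \<eta> i (T (c b))"
    and past_curve_in_past_box: "0 < \<tau> \<Longrightarrow> \<tau> \<le> T (c b) \<Longrightarrow> F (c b) \<in> past_box p \<tau> (F (c a))"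
proof -
  have F_cont: "continuous_on {a..b} (\<lambda>s. F (c s))"
    by (rule continuous_on_compose2[OF continuous_on_F cont]) (use Y in auto)
  have F_deriv: "((\<lambda>s. F (c s)) has_vector_derivative F' (c s) (c' s)) (at s)"
    if "s \<in> {a<..<b}" for s
    using F_comp_has_vector_derivative[OF deriv[OF that] Y] that by auto
  have past: "kasner_g p (F (c s)) (F' (c s) (c' s)) (F' (c s) (c' s)) < 0 \<and> fst (F' (c s) (c' s)) < 0"
    if s: "s \<in> {a<..<b}" for s
  proof -
    have "c s \<in> Y" using Y s by simp
    then show ?thesis
      using F'_cone[OF _ cone[OF s], of "c s"] by (simp add: linear_neg[OF linear_F'] kasner_g_def)
  qed
  show less: "T (c b) < T (c a)"
    using kasner_past_curve_fst_less[OF ab F_cont F_in_kasner_M[OF Y] F_deriv past] by simp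
  show "\<bar>X (c b) i - X (c a) i\<bar> < \<eta> i (T (c a)) - \<eta> i (T (c b))" for i
    using kasner_past_curve_snd_less[OF ab F_cont F_in_kasner_M[OF Y] F_deriv past exponent_less_1]
    by simp
  then show "F (c b) \<in> past_box p \<tau> (F (c a))" if "0 < \<tau>" "\<tau> \<le> T (c b)"
    using less that by (intro in_past_boxI exponent_less_1) (auto intro: less_imp_le)
qed

lemma
  assumes v: "v \<in> cone_around n k" and ab: "a < b" and Y: "\<And>s. s \<in> {a..b} \<Longrightarrow> w - s *\<^sub>R v \<in> Y"
  shows past_line_T_less: "T (w - b *\<^sub>R v) < T (w - a *\<^sub>R v)"
    and past_line_X_less:
      "\<bar>X (w - b *\<^sub>R v) i - X (w - a *\<^sub>R v) i\<bar> < \<eta> i (T (w - a *\<^sub>R v)) - \<eta> i (T (w - b *\<^sub>R v))"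
    and past_line_in_past_box:
      "0 < \<tau> \<Longrightarrow> \<tau> \<le> T (w - b *\<^sub>R v) \<Longrightarrow> F (w - b *\<^sub>R v) \<in> past_box p \<tau> (F (w - a *\<^sub>R v))"
proof -
  have cont: "continuous_on {a..b} (\<lambda>s. w - s *\<^sub>R v)" by (intro continuous_intros)
  have deriv: "((\<lambda>s. w - s *\<^sub>R v) has_vector_derivative - v) (at s)" for s
    by (auto intro!: derivative_eq_intros)
  note curve = ab cont Y deriv
  show "T (w - b *\<^sub>R v) < T (w - a *\<^sub>R v)"
    by (rule past_curve_T_less[OF curve]) (use v in simp_all)
  show "\<bar>X (w - b *\<^sub>R v) i - X (w - a *\<^sub>R v) i\<bar> < \<eta> i (T (w - a *\<^sub>R v)) - \<eta> i (T (w - b *\<^sub>R v))"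
    by (rule past_curve_X_less[OF curve]) (use v in simp_all)
  show "F (w - b *\<^sub>R v) \<in> past_box p \<tau> (F (w - a *\<^sub>R v))" if "0 < \<tau>" "\<tau> \<le> T (w - b *\<^sub>R v)"
    by (rule past_curve_in_past_box[OF curve _ that]) (use v in simp_all)
qed

lemma
  assumes Y: "closed_segment z w \<subseteq> Y" and cone: "w - z \<in> insert 0 (cone_around n k)"
    and y: "y \<in> closed_segment z w"
  shows segment_T_le: "T z \<le> T y"
    and segment_in_past_box: "F y \<in> past_box p (T z) (F w)"
proof -
  obtain u where u: "0 \<le> u" "u \<le> 1" "y = w - u *\<^sub>R (w - z)"
    using y unfolding closed_segment_commute[of z] by (auto simp: in_segment algebra_simps)
  have line: "w - s *\<^sub>R (w - z) \<in> Y" if "s \<in> {0..1}" for s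
    using Y that by (simp add: closed_segment_subset_iff)
  have in_Y: "y \<in> Y" "w \<in> Y" "z \<in> Y" using Y y by auto
  show "T z \<le> T y"
  proof (cases "u = 1 \<or> w = z")
    case False
    then have "T (w - 1 *\<^sub>R (w - z)) < T (w - u *\<^sub>R (w - z))"
      using u cone by (intro past_line_T_less line) auto
    then show ?thesis by (simp add: u(3))
  qed (use u in auto)
  then show "F y \<in> past_box p (T z) (F w)"
  proof (cases "u = 0 \<or> w = z")
    case False
    then have "F (w - u *\<^sub>R (w - z)) \<in> past_box p (T z) (F (w - 0 *\<^sub>R (w - z)))"
      using u cone \<open>T z \<le> T y\<close> T_pos[OF in_Y(3)] by (intro past_line_in_past_box line) auto
    then show ?thesis by (simp add: u(3))
  next
    case True
    then have "y = w" using u by auto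
    then show ?thesis
      using T_pos[OF in_Y(3)] \<open>T z \<le> T y\<close> exponent_less_1 by (intro in_past_boxI) simp_all
  qed
qed

text \<open>The Kasner coordinates along the segments stay in a fixed compact box.\<close>

lemma segment_limit:
  assumes z: "z \<longlonglongrightarrow> z'" "z' \<in> Y" and w: "w \<longlonglongrightarrow> w'" "w' \<in> Y"
    and segments: "\<And>i::nat. closed_segment (z i) (w i) \<subseteq> Y \<and> w i - z i \<in> insert 0 (cone_around n k)"
  shows "closed_segment z' w' \<subseteq> Y"
proof
  fix y assume y: "y \<in> closed_segment z' w'"
  then obtain u where u: "0 \<le> u" "u \<le> 1" "y = (1 - u) *\<^sub>R z' + u *\<^sub>R w'"
    by (auto simp: in_segment)
  define f where "f i = (1 - u) *\<^sub>R z i + u *\<^sub>R w i" for i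
  have f: "f i \<in> closed_segment (z i) (w i)" for i
    using u by (auto simp: f_def in_segment)
  define r where "r t = (\<Sum>i\<in>UNIV. horizon (p $ i) t)" for t
  define K where "K = {T z' / 2..T w' + 1} \<times> cball (snd (F w')) (r (T w' + 1) + 1)"
  have Fz: "(\<lambda>i. F (z i)) \<longlonglongrightarrow> F z'" and Fw: "(\<lambda>i. F (w i)) \<longlonglongrightarrow> F w'"
    using z w
    by (auto intro!: isCont_tendsto_compose[of _ F] has_derivative_continuous[OF F_has_derivative])
  have "\<forall>\<^sub>F i in sequentially. T z' / 2 < T (z i) \<and> T (w i) < T w' + 1
      \<and> dist (snd (F (w i))) (snd (F w')) < 1"
    using T_pos[OF z(2)]
    by (intro eventually_conj order_tendstoD(1)[OF tendsto_fst[OF Fz]]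
        order_tendstoD(2)[OF tendsto_fst[OF Fw]]
        tendstoD[OF tendsto_snd[OF Fw]]) auto
  then have "\<forall>\<^sub>F i in sequentially. f i \<in> Y \<and> F (f i) \<in> K"
  proof eventually_elim
    case (elim i)
    have in_Y: "z i \<in> Y" "w i \<in> Y" "f i \<in> Y" using segments[of i] f[of i] by auto
    have box: "F (f i) \<in> past_box p (T (z i)) (F (w i))"
      using segment_in_past_box segments[of i] f[of i] by blast
    have "r (T (w i)) \<le> r (T w' + 1)"
      unfolding r_def
      using elim T_pos[OF in_Y(2)] exponent_less_1 by (intro sum_mono horizon_mono) auto
    moreover have "dist (snd (F w')) (snd (F (f i)))
        \<le> dist (snd (F w')) (snd (F (w i))) + dist (snd (F (w i))) (snd (F (f i)))"
      by (rule dist_triangle)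
    ultimately have "F (f i) \<in> K"
      using box elim by (simp add: past_box_def K_def mem_Times_iff dist_commute r_def)
    then show ?case using in_Y(3) by simp
  qed
  moreover have "f \<longlonglongrightarrow> y"
    unfolding f_def u(3) by (intro tendsto_intros z(1) w(1))
  moreover have "compact K" unfolding K_def by (intro compact_Times compact_Icc compact_cball)
  moreover have "K \<subseteq> kasner_M" using T_pos[OF z(2)] by (auto simp: K_def kasner_M_def)
  moreover have "y \<in> \<Omega>"
    using y closed_segment_subset[OF subsetD[OF Y_subset z(2)] subsetD[OF Y_subset w(2)] convex_\<Omega>]
    by blast
  ultimately show "y \<in> Y" using tendsto_in_Y[OF _ _ _ _ sequentially_bot] by blast
qed

lemma segment_continuation:
  assumes conn: "connected P" and start: "(z0, w0) \<in> P" "closed_segment z0 w0 \<subseteq> Y"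
    and P: "\<And>z w. (z, w) \<in> P \<Longrightarrow> z \<in> Y \<and> w \<in> Y \<and> w - z \<in> insert 0 (cone_around n k)"
    and zw: "(z, w) \<in> P"
  shows "closed_segment z w \<subseteq> Y"
proof -
  define A where "A = P \<inter> {q. closed_segment (fst q) (snd q) \<subseteq> Y}"
  have "openin (top_of_set P) A"
    unfolding A_def by (intro openin_open_Int open_closed_segment_subset open_Y)
  moreover have "closedin (top_of_set P) A"
    unfolding closedin_limpt
  proof (intro conjI allI impI)
    show "A \<subseteq> P" by (auto simp: A_def)
    fix q assume q: "q islimpt A \<and> q \<in> P"
    then obtain f where f: "\<And>i::nat. f i \<in> A" "f \<longlonglongrightarrow> q"
      unfolding islimpt_sequential by blast
    have "closed_segment (fst q) (snd q) \<subseteq> Y"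
    proof (rule segment_limit[OF tendsto_fst[OF f(2)] _ tendsto_snd[OF f(2)]])
      show "fst q \<in> Y" "snd q \<in> Y" using P[of "fst q" "snd q"] q by auto
      show "closed_segment (fst (f i)) (snd (f i)) \<subseteq> Y
          \<and> snd (f i) - fst (f i) \<in> insert 0 (cone_around n k)" for i
        using f(1)[of i] P[of "fst (f i)" "snd (f i)"] by (auto simp: A_def)
    qed
    then show "q \<in> A" using q by (simp add: A_def)
  qed
  moreover have "(z0, w0) \<in> A" using start by (simp add: A_def)
  ultimately have "A = P" using conn unfolding connected_clopen by blast
  then have "(z, w) \<in> A" using zw by simp
  then show ?thesis by (simp add: A_def)
qed

lemma past_causal_curve_norm_le:
  assumes "a \<le> b" and cont: "continuous_on {a..b} c" and D: "\<And>s. s \<in> {a..b} \<Longrightarrow> c s \<in> D"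
    and past: "\<And>s. s \<in> {a<..<b} \<Longrightarrow> past_causal_at p c s"
  shows "norm (E (c b) - E (c a)) \<le> l (E (c a)) - l (E (c b))"
proof (cases "a = b")
  case False
  obtain c' where c': "\<And>s. s \<in> {a<..<b} \<Longrightarrow> (c has_vector_derivative c' s) (at s)
      \<and> kasner_g p (c s) (c' s) (c' s) \<le> 0 \<and> fst (c' s) < 0"
    using past unfolding past_causal_at_def by metis
  have E_cont: "continuous_on {a..b} (\<lambda>s. E (c s))"
    by (rule continuous_on_compose2[OF continuous_on_E cont]) (use D in auto)
  have E_deriv: "((\<lambda>s. E (c s)) has_vector_derivative E' (c s) (c' s)) (at s)"
    if "s \<in> {a<..<b}" for s
    using vector_derivative_diff_chain_within[OF conjunct1[OF c'[OF that]]
        has_derivative_at_withinI[OF E_has_derivative]] D that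
    by (simp add: o_def)
  have "norm (E (c b) - E (c a)) \<le> - l (E (c b)) - - l (E (c a))"
  proof (rule differentiable_bound_general)
    show "a < b" using assms(1) False by simp
    show "continuous_on {a..b} (\<lambda>s. E (c s))" by (rule E_cont)
    show "continuous_on {a..b} (\<lambda>s. - l (E (c s)))"
      by (intro continuous_on_minus bounded_linear.continuous_on[OF bounded_linear_l E_cont])
    fix s assume "a < s" "s < b"
    then have s: "s \<in> {a<..<b}" by simp
    show "((\<lambda>s. E (c s)) has_vector_derivative E' (c s) (c' s)) (at s)" by (rule E_deriv[OF s])
    show "((\<lambda>s. - l (E (c s))) has_vector_derivative - l (E' (c s) (c' s))) (at s)"
      by (intro has_vector_derivative_minus
          bounded_linear.has_vector_derivative[OF bounded_linear_l E_deriv[OF s]])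
    show "norm (E' (c s) (c' s)) \<le> - l (E' (c s) (c' s))"
      using l_E'_past_le[of "c s" "c' s"] c'[OF s] D[of s] s by simp
  qed
  then show ?thesis by simp
qed simp

lemma past_causal_broken_curve_norm_le:
  assumes ab: "a \<le> b" and cont: "continuous_on {a..b} c" and D: "\<And>s. s \<in> {a..b} \<Longrightarrow> c s \<in> D"
    and past: "\<And>s. s \<in> {a<..<b} - {h} \<Longrightarrow> past_causal_at p c s"
  shows "norm (E (c b) - E (c a)) \<le> l (E (c a)) - l (E (c b))"
proof -
  have piece: "norm (E (c t) - E (c s)) \<le> l (E (c s)) - l (E (c t))"
    if "a \<le> s" "s \<le> t" "t \<le> b" "t \<le> h \<or> h \<le> s" for s t
  proof (rule past_causal_curve_norm_le[OF that(2)])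
    show "continuous_on {s..t} c" by (rule continuous_on_subset[OF cont]) (use that in auto)
  qed (use that D past in auto)
  show ?thesis
  proof (cases "b \<le> h \<or> h \<le> a")
    case False
    have "norm (E (c b) - E (c a)) \<le> norm (E (c b) - E (c h)) + norm (E (c h) - E (c a))"
      using norm_triangle_ineq[of "E (c b) - E (c h)" "E (c h) - E (c a)"] by simp
    then show ?thesis using piece[of h b] piece[of a h] False by simp
  qed (use piece ab in auto)
qed

lemma past_causal_broken_curve_in_cball:
  assumes s: "s \<in> {a..b}" and cont: "continuous_on {a..b} c" and D: "\<And>s. s \<in> {a..b} \<Longrightarrow> c s \<in> D"
    and past: "\<And>s. s \<in> {a<..<b} - {h} \<Longrightarrow> past_causal_at p c s"
    and start: "l (E (c a)) \<le> l (E (c b)) + r"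
  shows "E (c s) \<in> cball (E (c b)) r"
proof -
  have norm_le: "norm (E (c t') - E (c t)) \<le> l (E (c t)) - l (E (c t'))"
    if "a \<le> t" "t \<le> t'" "t' \<le> b" for t t'
    using that D past
    by (intro past_causal_broken_curve_norm_le[where h = h] continuous_on_subset[OF cont]) auto
  have "0 \<le> l (E (c a)) - l (E (c s))"
    using order_trans[OF norm_ge_zero norm_le[of a s]] s by simp
  then show ?thesis using norm_le[of s b] s start by (simp add: dist_norm)
qed

text \<open>The curves of the homotopy that lie in the chart are confined to a fixed compact ball.\<close>

lemma past_causal_homotopy_in_D:
  fixes c :: "real \<Rightarrow> real \<Rightarrow> 'n spt"
  assumes ab: "a \<le> b" and cont: "continuous_on ({0..1} \<times> {a..b}) (\<lambda>(u, s). c u s)"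
    and M: "\<And>u s. u \<in> {0..1} \<Longrightarrow> s \<in> {a..b} \<Longrightarrow> c u s \<in> kasner_M"
    and past: "\<And>u s. u \<in> {0..1} \<Longrightarrow> s \<in> {a<..<b} - {h} \<Longrightarrow> past_causal_at p (c u) s"
    and start: "\<And>s. s \<in> {a..b} \<Longrightarrow> c 0 s \<in> D"
    and end_point: "\<And>u. u \<in> {0..1} \<Longrightarrow> c u b = m"
    and starting_points: "\<And>u. u \<in> {0..1} \<Longrightarrow> l (E (c u a)) \<le> l (E m) + r"
    and r: "cball (E m) r \<subseteq> \<Omega>"
    and u: "u \<in> {0..1}" and s: "s \<in> {a..b}"
  shows "c u s \<in> D \<and> E (c u s) \<in> cball (E m) r"
proof -
  have cont_u: "continuous_on {a..b} (c u)" if "u \<in> {0..1}" for u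
    using that continuous_on_compose2[OF cont
        continuous_on_Pair[OF continuous_on_const continuous_on_id], of u "{a..b}"]
    by (simp add: image_subset_iff)
  have cont_s: "continuous_on {0..1} (\<lambda>u. c u s)" if "s \<in> {a..b}" for s
    using that continuous_on_compose2[OF cont
        continuous_on_Pair[OF continuous_on_id continuous_on_const], of s "{0..1}"]
    by (simp add: image_subset_iff)
  define A where "A = {u \<in> {0..1}. \<forall>s\<in>{a..b}. c u s \<in> D}"
  have bound: "E (c u s) \<in> cball (E m) r" if u: "u \<in> A" and s: "s \<in> {a..b}" for u s
  proof -
    have u01: "u \<in> {0..1}" and D: "\<And>s. s \<in> {a..b} \<Longrightarrow> c u s \<in> D" using u by (auto simp: A_def)
    show ?thesis
      using past_causal_broken_curve_in_cball[OF s cont_u[OF u01] D past[OF u01], of h r]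
        end_point[OF u01] starting_points[OF u01] by simp
  qed
  have "openin (top_of_set {0..1}) A"
  proof -
    have "openin (top_of_set ({0..1} \<times> {a..b})) (({0..1} \<times> {a..b}) \<inter> (\<lambda>(u, s). c u s) -` D)"
      by (rule continuous_openin_preimage_gen[OF cont open_D])
    from openin_forall_compact[OF compact_Icc this] show ?thesis
      by (rule back_subst) (auto simp: A_def)
  qed
  moreover have "closedin (top_of_set {0..1}) A"
  proof -
    have "A = (\<Inter>s\<in>{a..b}. {0..1} \<inter> (\<lambda>u. c u s) -` {m' \<in> D. E m' \<in> cball (E m) r})"
      using bound ab by (auto simp: A_def)
    also have "closedin (top_of_set {0..1}) \<dots>"
      using ab cont_s M closedin_E_preimage[OF compact_cball r]
      by (intro closedin_INT continuous_closedin_preimage_gen[where T = kasner_M]) auto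
    finally show ?thesis .
  qed
  moreover have "0 \<in> A" using start by (simp add: A_def)
  ultimately have "A = {0..1}"
    using connected_Icc[of 0 "1::real"] unfolding connected_clopen by blast
  then have "u \<in> A" using u by simp
  then show ?thesis using s bound by (simp add: A_def)
qed

end

section \<open>Curves running into the past boundary\<close>

locale kasner_past_curve = kasner_patch p \<Omega> g D E l n k M
  for p :: "real ^ 'n::finite" and \<Omega> g D E l n k M +
  fixes \<gamma> \<gamma>' :: "real \<Rightarrow> 'n spt" and s0 :: real
  assumes s0_less: "s0 < 1" and \<gamma>_cont: "continuous_on {s0..1} \<gamma>"
    and \<gamma>_in_Y: "s \<in> {s0..<1} \<Longrightarrow> \<gamma> s \<in> Y"
    and \<gamma>_1_in: "\<gamma> 1 \<in> \<Omega>" and \<gamma>_1_notin: "\<gamma> 1 \<notin> Y"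
    and \<gamma>_deriv: "s \<in> {s0<..<1} \<Longrightarrow> (\<gamma> has_vector_derivative \<gamma>' s) (at s)"
    and \<gamma>'_near: "s \<in> {s0<..<1} \<Longrightarrow> norm (\<gamma>' s + n) \<le> k / 2"
begin

abbreviation "T\<gamma> s \<equiv> fst (F (\<gamma> s))"
abbreviation "X\<gamma> s \<equiv> snd (F (\<gamma> s))"
abbreviation "F\<gamma>' s \<equiv> F' (\<gamma> s) (\<gamma>' s)"

lemma T\<gamma>_pos: "s \<in> {s0..<1} \<Longrightarrow> 0 < T\<gamma> s"
  by (rule T_pos[OF \<gamma>_in_Y])

lemma \<gamma>_chord:
  assumes "s0 \<le> s" "s < s'" "s' \<le> 1"
  shows "norm (\<gamma> s - \<gamma> s' - (s' - s) *\<^sub>R n) \<le> k / 2 * (s' - s)"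
proof -
  let ?f = "\<lambda>t. \<gamma> t + t *\<^sub>R n"
  have "norm (?f s' - ?f s) \<le> k / 2 * s' - k / 2 * s"
  proof (rule differentiable_bound_general[OF assms(2), where f' = "\<lambda>t. \<gamma>' t + n"
        and \<phi>' = "\<lambda>_. k / 2"])
    show "continuous_on {s..s'} ?f"
      by (intro continuous_intros continuous_on_subset[OF \<gamma>_cont]) (use assms in auto)
    show "continuous_on {s..s'} (\<lambda>t. k / 2 * t)" by (intro continuous_intros)
    show "(?f has_vector_derivative \<gamma>' t + n) (at t)" if "s < t" "t < s'" for t
      using \<gamma>_deriv[of t] that assms by (auto intro!: derivative_eq_intros)
    show "((\<lambda>t. k / 2 * t) has_vector_derivative k / 2) (at t)" for t
      by (auto intro!: derivative_eq_intros)
    show "norm (\<gamma>' t + n) \<le> k / 2" if "s < t" "t < s'" for t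
      using \<gamma>'_near[of t] that assms by auto
  qed
  moreover have "\<gamma> s - \<gamma> s' - (s' - s) *\<^sub>R n = - (?f s' - ?f s)" by (simp add: algebra_simps)
  ultimately show ?thesis by (simp add: norm_minus_commute algebra_simps)
qed

lemma \<gamma>_chord_in_cone:
  assumes "s0 \<le> s" "s < s'" "s' \<le> 1"
  shows "\<gamma> s - \<gamma> s' \<in> cone_around n k"
proof (rule cone_aroundI[of "s' - s"])
  have "k / 2 * (s' - s) \<le> k * (s' - s)" using k_pos assms(2) by (intro mult_right_mono) auto
  then show "norm (\<gamma> s - \<gamma> s' - (s' - s) *\<^sub>R n) \<le> k * (s' - s)" using \<gamma>_chord[OF assms] by linarith
qed (use assms in simp)

lemma minus_\<gamma>'_in_cone: "s \<in> {s0<..<1} \<Longrightarrow> - \<gamma>' s \<in> cone_around n k"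
  using \<gamma>'_near[of s] k_pos by (intro minus_in_cone_around) simp

lemma F\<gamma>_deriv: "s \<in> {s0<..<1} \<Longrightarrow> ((\<lambda>s. F (\<gamma> s)) has_vector_derivative F\<gamma>' s) (at s)"
  using F_comp_has_vector_derivative[OF \<gamma>_deriv \<gamma>_in_Y] by auto

lemma continuous_on_F\<gamma>: "continuous_on {s0..<1} (\<lambda>s. F (\<gamma> s))"
  by (rule continuous_on_compose2[OF continuous_on_F continuous_on_subset[OF \<gamma>_cont]])
    (use \<gamma>_in_Y in auto)

lemma F\<gamma>'_past:
  assumes s: "s \<in> {s0<..<1}"
  shows "kasner_g p (F (\<gamma> s)) (F\<gamma>' s) (F\<gamma>' s) < 0" and "fst (F\<gamma>' s) < 0"
proof -
  have "\<gamma> s \<in> Y" using \<gamma>_in_Y s by simp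
  then show "kasner_g p (F (\<gamma> s)) (F\<gamma>' s) (F\<gamma>' s) < 0" "fst (F\<gamma>' s) < 0"
    using F'_cone[OF _ minus_\<gamma>'_in_cone[OF s], of "\<gamma> s"]
    by (simp_all add: linear_neg[OF linear_F'] kasner_g_def)
qed

lemma
  assumes s: "s0 \<le> s" "s < s'" "s' < 1"
  shows T\<gamma>_less: "T\<gamma> s' < T\<gamma> s"
    and X\<gamma>_less: "\<bar>X\<gamma> s' $ i - X\<gamma> s $ i\<bar> < \<eta> i (T\<gamma> s) - \<eta> i (T\<gamma> s')"
    and F\<gamma>_in_past_box: "0 < \<tau> \<Longrightarrow> \<tau> \<le> T\<gamma> s' \<Longrightarrow> F (\<gamma> s') \<in> past_box p \<tau> (F (\<gamma> s))"
proof -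
  have cont: "continuous_on {s..s'} \<gamma>"
    by (rule continuous_on_subset[OF \<gamma>_cont]) (use s in auto)
  have Y: "\<gamma> t \<in> Y" if "t \<in> {s..s'}" for t using \<gamma>_in_Y s that by auto
  have deriv: "(\<gamma> has_vector_derivative \<gamma>' t) (at t)" if "t \<in> {s<..<s'}" for t
    using \<gamma>_deriv s that by auto
  have cone: "- \<gamma>' t \<in> cone_around n k" if "t \<in> {s<..<s'}" for t
    using minus_\<gamma>'_in_cone s that by auto
  note curve = s(2) cont Y deriv cone
  show "T\<gamma> s' < T\<gamma> s" by (rule past_curve_T_less[OF curve])
  show "\<bar>X\<gamma> s' $ i - X\<gamma> s $ i\<bar> < \<eta> i (T\<gamma> s) - \<eta> i (T\<gamma> s')"
    by (rule past_curve_X_less[OF curve])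
  show "F (\<gamma> s') \<in> past_box p \<tau> (F (\<gamma> s))" if "0 < \<tau>" "\<tau> \<le> T\<gamma> s'"
    by (rule past_curve_in_past_box[OF curve that])
qed

lemma \<gamma>_tendsto: "(\<gamma> \<longlongrightarrow> \<gamma> 1) (at_left 1)"
  by (rule continuous_on_Icc_at_leftD[OF \<gamma>_cont s0_less])

lemma T\<gamma>_tendsto_0: "(T\<gamma> \<longlongrightarrow> 0) (at_left 1)"
proof (rule order_tendstoI)
  fix e :: real assume e: "e < 0"
  show "\<forall>\<^sub>F s in at_left 1. e < T\<gamma> s"
    using eventually_at_left_real[OF s0_less] by eventually_elim (simp add: less_trans[OF e] T\<gamma>_pos)
next
  fix e :: real assume e: "0 < e"
  have "\<exists>s\<in>{s0..<1}. T\<gamma> s < e"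
  proof (rule ccontr)
    assume "\<not> ?thesis"
    then have ge: "e \<le> T\<gamma> s" if "s \<in> {s0..<1}" for s using that by (simp add: not_less)
    have "\<forall>\<^sub>F s in at_left 1. \<gamma> s \<in> Y \<and> F (\<gamma> s) \<in> past_box p e (F (\<gamma> s0))"
      using eventually_at_left_real[OF s0_less]
      by eventually_elim (use \<gamma>_in_Y F\<gamma>_in_past_box e ge in auto)
    then have "\<gamma> 1 \<in> Y"
      by (rule tendsto_in_Y[OF compact_past_box past_box_subset_kasner_M[OF e] _ \<gamma>_tendsto
            _ \<gamma>_1_in]) simp
    then show False using \<gamma>_1_notin by simp
  qed
  then obtain s where s: "s0 \<le> s" "s < 1" "T\<gamma> s < e" by auto
  show "\<forall>\<^sub>F s' in at_left 1. T\<gamma> s' < e"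
    using eventually_at_left_real[OF s(2)] by eventually_elim (use T\<gamma>_less[of s] s in fastforce)
qed

lemma horizon_T\<gamma>_tendsto_0: "((\<lambda>s. \<eta> i (T\<gamma> s)) \<longlongrightarrow> 0) (at_left 1)"
proof (rule tendsto_horizon_0[OF exponent_less_1 T\<gamma>_tendsto_0])
  show "\<forall>\<^sub>F s in at_left 1. 0 \<le> T\<gamma> s"
    using eventually_at_left_real[OF s0_less] by eventually_elim (simp add: T\<gamma>_pos less_imp_le)
qed

text \<open>The comoving position at which \<open>\<gamma>\<close> meets the singularity. It is the intersection of the
  decreasing intervals of radius \<open>\<eta> i (T\<gamma> s)\<close> around \<open>X\<gamma> s $ i\<close>.\<close>

definition endpoint :: "real ^ 'n" where
  "endpoint = (\<chi> i. INF s\<in>{s0..<1}. X\<gamma> s $ i + \<eta> i (T\<gamma> s))"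

lemma X\<gamma>_endpoint_le:
  assumes "s \<in> {s0..<1}"
  shows "\<bar>X\<gamma> s $ i - endpoint $ i\<bar> \<le> \<eta> i (T\<gamma> s)"
proof -
  let ?S = "(\<lambda>s. X\<gamma> s $ i + \<eta> i (T\<gamma> s)) ` {s0..<1}"
  have intervals_meet: "X\<gamma> s $ i - \<eta> i (T\<gamma> s) \<le> X\<gamma> s' $ i + \<eta> i (T\<gamma> s')"
    if "s \<in> {s0..<1}" "s' \<in> {s0..<1}" for s s'
    using X\<gamma>_less[of s s' i] X\<gamma>_less[of s' s i] that
      horizon_pos[OF T\<gamma>_pos exponent_less_1, of s i] horizon_pos[OF T\<gamma>_pos exponent_less_1, of s' i]
    by (cases s s' rule: linorder_cases) auto
  have "bdd_below ?S" using intervals_meet[OF assms] by (rule bdd_belowI2)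
  then have "endpoint $ i \<le> X\<gamma> s $ i + \<eta> i (T\<gamma> s)"
    using assms by (auto simp: endpoint_def intro: cINF_lower)
  moreover have "X\<gamma> s $ i - \<eta> i (T\<gamma> s) \<le> endpoint $ i"
    using intervals_meet[OF assms] s0_less by (auto simp: endpoint_def intro!: cINF_greatest)
  ultimately show ?thesis by linarith
qed

lemma X\<gamma>_tendsto_endpoint: "(X\<gamma> \<longlongrightarrow> endpoint) (at_left 1)"
proof (rule vec_tendstoI)
  fix i
  have "((\<lambda>s. X\<gamma> s $ i - endpoint $ i) \<longlongrightarrow> 0) (at_left 1)"
  proof (rule Lim_null_comparison[OF _ horizon_T\<gamma>_tendsto_0[of i]])
    show "\<forall>\<^sub>F s in at_left 1. norm (X\<gamma> s $ i - endpoint $ i) \<le> \<eta> i (T\<gamma> s)"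
      using eventually_at_left_real[OF s0_less] by eventually_elim (use X\<gamma>_endpoint_le in auto)
  qed
  then show "((\<lambda>s. X\<gamma> s $ i) \<longlongrightarrow> endpoint $ i) (at_left 1)" using LIM_zero_iff by blast
qed

text \<open>Displacing \<open>\<gamma> s\<close> by \<open>displacement j s' s\<close> gives the curve through \<open>\<gamma> s'\<close> that
  is null in the \<open>j\<close>-th direction.\<close>

definition displacement :: "'n \<Rightarrow> real \<Rightarrow> real \<Rightarrow> real ^ 'n" where
  "displacement j s' s = X\<gamma> s' - X\<gamma> s + (\<eta> j (T\<gamma> s) - \<eta> j (T\<gamma> s')) *\<^sub>R axis j 1"

lemma displacement_self: "displacement j s s = 0"
  by (simp add: displacement_def)

lemma continuous_on_displacement: "continuous_on {s0..<1} (displacement j s')"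
proof -
  have "continuous_on {s0..<1} (\<lambda>s. \<eta> j (T\<gamma> s))"
    by (intro continuous_on_horizon continuous_on_fst continuous_on_F\<gamma> T_pos \<gamma>_in_Y)
  then show ?thesis
    unfolding displacement_def by (intro continuous_intros continuous_on_F\<gamma>)
qed

lemma displacement_deriv:
  assumes s: "s \<in> {s0<..<1}"
  shows "(displacement j s' has_vector_derivative
     (T\<gamma> s powr (- (p $ j)) * fst (F\<gamma>' s)) *\<^sub>R axis j 1 - snd (F\<gamma>' s)) (at s)"
proof -
  have pos: "T\<gamma> s > 0" using T\<gamma>_pos[of s] s by auto
  have dT: "(T\<gamma> has_real_derivative fst (F\<gamma>' s)) (at s)"
    using bounded_linear.has_vector_derivative[OF bounded_linear_fst F\<gamma>_deriv[OF s]]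
    by (simp add: has_real_derivative_iff_has_vector_derivative)
  have dX: "(X\<gamma> has_vector_derivative snd (F\<gamma>' s)) (at s)"
    by (rule bounded_linear.has_vector_derivative[OF bounded_linear_snd F\<gamma>_deriv[OF s]])
  have "((\<lambda>s. \<eta> j (T\<gamma> s) - \<eta> j (T\<gamma> s')) has_real_derivative
      T\<gamma> s powr (- (p $ j)) * fst (F\<gamma>' s)) (at s)"
    using DERIV_diff[OF DERIV_chain2[OF horizon_has_derivative[OF pos exponent_less_1] dT]
        DERIV_const] by simp
  from has_vector_derivative_scaleR[OF this has_vector_derivative_const]
  have "((\<lambda>s. (\<eta> j (T\<gamma> s) - \<eta> j (T\<gamma> s')) *\<^sub>R axis j (1::real)) has_vector_derivative
      (T\<gamma> s powr (- (p $ j)) * fst (F\<gamma>' s)) *\<^sub>R axis j 1) (at s)"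
    by simp
  from has_vector_derivative_add[OF
      has_vector_derivative_diff[OF has_vector_derivative_const dX] this]
  show ?thesis unfolding displacement_def by simp
qed

lemma past_causal_at_shifted:
  assumes s: "s \<in> {s0<..<1}" and \<delta>: "(\<delta> has_vector_derivative \<delta>') (at s)"
    and le: "norm (kasner_scale p (T\<gamma> s) (snd (F\<gamma>' s) + \<delta>')) \<le> \<bar>fst (F\<gamma>' s)\<bar>"
  shows "past_causal_at p (\<lambda>s. (T\<gamma> s, X\<gamma> s + \<delta> s)) s"
  unfolding past_causal_at_def
proof (intro exI conjI)
  show "((\<lambda>s. (T\<gamma> s, X\<gamma> s + \<delta> s)) has_vector_derivative (fst (F\<gamma>' s), snd (F\<gamma>' s) + \<delta>')) (at s)"
    by (intro has_vector_derivative_Pair has_vector_derivative_add \<delta>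
        bounded_linear.has_vector_derivative[OF bounded_linear_fst F\<gamma>_deriv[OF s]]
        bounded_linear.has_vector_derivative[OF bounded_linear_snd F\<gamma>_deriv[OF s]])
  have "(T\<gamma> s, X\<gamma> s + \<delta> s) \<in> kasner_M" using T\<gamma>_pos[of s] s by (simp add: kasner_M_def)
  then show "kasner_g p (T\<gamma> s, X\<gamma> s + \<delta> s) (fst (F\<gamma>' s), snd (F\<gamma>' s) + \<delta>')
      (fst (F\<gamma>' s), snd (F\<gamma>' s) + \<delta>') \<le> 0"
    using le by (simp add: kasner_causal_iff)
  show "fst (fst (F\<gamma>' s), snd (F\<gamma>' s) + \<delta>') < 0" using F\<gamma>'_past(2)[OF s] by simp
qed

lemma F\<gamma>'_causal:
  "s \<in> {s0<..<1} \<Longrightarrow> norm (kasner_scale p (T\<gamma> s) (snd (F\<gamma>' s))) \<le> \<bar>fst (F\<gamma>' s)\<bar>"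
  using F\<gamma>'_past(1) kasner_causal_iff[OF F_in_kasner_M[OF \<gamma>_in_Y], of s p "F\<gamma>' s"]
  by (simp add: less_imp_le)

lemma past_causal_at_translated:
  assumes "s \<in> {s0<..<1}"
  shows "past_causal_at p (\<lambda>s. (T\<gamma> s, X\<gamma> s + d)) s"
  by (rule past_causal_at_shifted[OF assms has_vector_derivative_const])
    (use F\<gamma>'_causal[OF assms] in simp)

lemma past_causal_at_displaced:
  assumes s: "s \<in> {s0<..<1}" and u: "u \<in> {0..1}"
  shows "past_causal_at p (\<lambda>s. (T\<gamma> s, X\<gamma> s + u *\<^sub>R displacement j s' s)) s"
proof (rule past_causal_at_shifted[OF s])
  let ?S = "kasner_scale p (T\<gamma> s)" and ?x = "snd (F\<gamma>' s)" and ?t = "fst (F\<gamma>' s)"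
  let ?a = "(T\<gamma> s powr (- (p $ j)) * ?t) *\<^sub>R axis j (1::real)"
  show "((\<lambda>s. u *\<^sub>R displacement j s' s) has_vector_derivative u *\<^sub>R (?a - ?x)) (at s)"
    by (rule bounded_linear.has_vector_derivative[OF
          bounded_linear_scaleR_right displacement_deriv[OF s]])
  have "?x + u *\<^sub>R (?a - ?x) = (1 - u) *\<^sub>R ?x + u *\<^sub>R ?a" by (simp add: algebra_simps)
  then have "norm (?S (?x + u *\<^sub>R (?a - ?x))) = norm ((1 - u) *\<^sub>R ?S ?x + u *\<^sub>R ?S ?a)"
    by (simp only: linear_add[OF linear_kasner_scale] linear_cmul[OF linear_kasner_scale])
  also have "\<dots> \<le> norm ((1 - u) *\<^sub>R ?S ?x) + norm (u *\<^sub>R ?S ?a)" by (rule norm_triangle_ineq)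
  also have "\<dots> = (1 - u) * norm (?S ?x) + u * \<bar>?t\<bar>"
    using u T\<gamma>_pos[of s] s by (simp add: norm_kasner_scale_axis)
  also have "\<dots> \<le> (1 - u) * \<bar>?t\<bar> + u * \<bar>?t\<bar>"
    using F\<gamma>'_causal[OF s] u by (intro add_right_mono mult_left_mono) auto
  also have "\<dots> = \<bar>?t\<bar>" by (simp add: algebra_simps)
  finally show "norm (?S (?x + u *\<^sub>R (?a - ?x))) \<le> \<bar>?t\<bar>" .
qed

text \<open>These curves follow a translate of \<open>\<gamma>\<close> down to the parameter \<open>h\<close> and then return to \<open>\<gamma> s'\<close>.\<close>

lemma past_causal_at_broken_displaced:
  assumes s: "s \<in> {s0<..<1} - {h}" and u: "u \<in> {0..1}"
  shows "past_causal_at p (\<lambda>s. (T\<gamma> s, X\<gamma> s + u *\<^sub>R displacement j s' (max h s))) s"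
proof (cases "s < h")
  case True
  show ?thesis
    by (rule past_causal_at_transform_open[OF
          past_causal_at_translated[of s "u *\<^sub>R displacement j s' h"], of "{..<h}"])
      (use s True in \<open>auto simp: max_def\<close>)
next
  case False
  show ?thesis
    by (rule past_causal_at_transform_open[OF past_causal_at_displaced[OF _ u, of s j s'],
          of "{h<..}"])
      (use s False in \<open>auto simp: max_def\<close>)
qed

lemma displaced_curve_in_D:
  assumes s: "s0 < s1" "s1 \<le> h" "h \<le> s'" "s' < 1"
    and top: "\<And>u. u \<in> {0..1} \<Longrightarrow> norm (E (T\<gamma> s1, X\<gamma> s1 + u *\<^sub>R displacement j s' h) - \<gamma> 1) \<le> \<epsilon>"
    and bottom: "norm (\<gamma> s' - \<gamma> 1) \<le> \<epsilon>"
    and small: "cball (\<gamma> 1) ((1 + 2 * onorm l) * \<epsilon>) \<subseteq> \<Omega>"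
    and x: "x \<in> {s1..h}"
  shows "(T\<gamma> x, X\<gamma> x + displacement j s' h) \<in> D"
    and "E (T\<gamma> x, X\<gamma> x + displacement j s' h) \<in> cball (\<gamma> 1) ((1 + 2 * onorm l) * \<epsilon>)"
proof -
  define c where "c u s = (T\<gamma> s, X\<gamma> s + u *\<^sub>R displacement j s' (max h s))" for u s
  have Y: "\<gamma> s \<in> Y" if "s \<in> {s1..s'}" for s using \<gamma>_in_Y s that by auto
  have E_F_s': "E (F (\<gamma> s')) = \<gamma> s'" using E_F[OF Y] s by simp
  have ball_sub: "cball (E (F (\<gamma> s'))) (2 * onorm l * \<epsilon>) \<subseteq> cball (\<gamma> 1) ((1 + 2 * onorm l) * \<epsilon>)"
    using bottom by (simp add: cball_subset_cball_iff E_F_s' dist_norm algebra_simps)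
  have "c 1 x \<in> D \<and> E (c 1 x) \<in> cball (E (F (\<gamma> s'))) (2 * onorm l * \<epsilon>)"
  proof (rule past_causal_homotopy_in_D[where c = c and a = s1 and b = s' and h = h])
    have F_cont: "continuous_on ({0..1::real} \<times> {s1..s'}) (\<lambda>q. F (\<gamma> (snd q)))"
      by (rule continuous_on_compose2[OF continuous_on_F\<gamma> continuous_on_snd[OF continuous_on_id]])
        (use s in auto)
    have displacement_cont:
      "continuous_on ({0..1::real} \<times> {s1..s'}) (\<lambda>q. displacement j s' (max h (snd q)))"
      by (rule continuous_on_compose2[OF continuous_on_displacement
            continuous_on_max[OF continuous_on_const continuous_on_snd[OF continuous_on_id]]])
        (use s in auto)
    show "continuous_on ({0..1} \<times> {s1..s'}) (\<lambda>(u, s). c u s)"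
      unfolding c_def case_prod_beta
      by (intro continuous_on_Pair continuous_on_add continuous_on_scaleR
          continuous_on_fst[OF F_cont]
          continuous_on_snd[OF F_cont] displacement_cont continuous_on_fst[OF continuous_on_id])
    show "c u s \<in> kasner_M" if "s \<in> {s1..s'}" for u s
      using T_pos[OF Y[OF that]] by (simp add: c_def kasner_M_def)
    show "past_causal_at p (c u) s" if "u \<in> {0..1}" "s \<in> {s1<..<s'} - {h}" for u s
      unfolding c_def by (rule past_causal_at_broken_displaced) (use that s in auto)
    show "c 0 s \<in> D" if "s \<in> {s1..s'}" for s
      using F_in_D[OF Y[OF that]] by (simp add: c_def)
    show "c u s' = F (\<gamma> s')" for u using s by (simp add: c_def max_def displacement_self)
    show "l (E (c u s1)) \<le> l (E (F (\<gamma> s'))) + 2 * onorm l * \<epsilon>" if "u \<in> {0..1}" for u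
      using l_diff_le[OF top[OF that] bottom] s by (simp add: c_def max_def E_F_s')
    show "cball (E (F (\<gamma> s'))) (2 * onorm l * \<epsilon>) \<subseteq> \<Omega>" using ball_sub small by blast
  qed (use s x in auto)
  moreover have "c 1 x = (T\<gamma> x, X\<gamma> x + displacement j s' h)"
    using x by (simp add: c_def max_absorb1)
  ultimately show "(T\<gamma> x, X\<gamma> x + displacement j s' h) \<in> D"
    "E (T\<gamma> x, X\<gamma> x + displacement j s' h) \<in> cball (\<gamma> 1) ((1 + 2 * onorm l) * \<epsilon>)"
    using ball_sub by auto
qed

definition horizon_displacement :: "'n \<Rightarrow> real \<Rightarrow> real ^ 'n" where
  "horizon_displacement j h = endpoint - X\<gamma> h + \<eta> j (T\<gamma> h) *\<^sub>R axis j 1"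

lemma displacement_tendsto: "((\<lambda>s'. displacement j s' h) \<longlongrightarrow> horizon_displacement j h) (at_left 1)"
proof -
  have "((\<lambda>s'. displacement j s' h) \<longlongrightarrow> endpoint - X\<gamma> h + (\<eta> j (T\<gamma> h) - 0) *\<^sub>R axis j 1) (at_left 1)"
    unfolding displacement_def by (intro tendsto_intros X\<gamma>_tendsto_endpoint horizon_T\<gamma>_tendsto_0)
  then show ?thesis by (simp add: horizon_displacement_def)
qed

lemma horizon_displacement_tendsto_0: "(horizon_displacement j \<longlongrightarrow> 0) (at_left 1)"
proof -
  have "(horizon_displacement j \<longlongrightarrow> endpoint - endpoint + 0 *\<^sub>R axis j 1) (at_left 1)"
    unfolding horizon_displacement_def[abs_def]
    by (intro tendsto_intros X\<gamma>_tendsto_endpoint horizon_T\<gamma>_tendsto_0)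
  then show ?thesis by simp
qed

lemma translated_curve_in_D:
  assumes s: "s0 < s1" "s1 \<le> h" "h < 1"
    and d: "d = horizon_displacement j h" "norm d < e"
    and top: "\<And>v. norm v < e \<Longrightarrow> norm (E (T\<gamma> s1, X\<gamma> s1 + v) - \<gamma> 1) \<le> \<epsilon>"
    and bottom: "\<And>s. s \<in> {s1..<1} \<Longrightarrow> norm (\<gamma> s - \<gamma> 1) \<le> \<epsilon>"
    and small: "cball (\<gamma> 1) ((1 + 2 * onorm l) * \<epsilon>) \<subseteq> \<Omega>"
    and x: "x \<in> {s1..h}"
  shows "(T\<gamma> x, X\<gamma> x + d) \<in> D" and "E (T\<gamma> x, X\<gamma> x + d) \<in> cball (\<gamma> 1) ((1 + 2 * onorm l) * \<epsilon>)"
proof -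
  let ?K = "{m \<in> D. E m \<in> cball (\<gamma> 1) ((1 + 2 * onorm l) * \<epsilon>)}"
  have "\<forall>\<^sub>F s' in at_left 1. norm (displacement j s' h) < e \<and> s' \<in> {h<..<1}"
    using order_tendstoD(2)[OF tendsto_norm[OF displacement_tendsto]] d
      eventually_at_left_real[OF s(3)]
    by (intro eventually_conj) auto
  then have "\<forall>\<^sub>F s' in at_left 1. (T\<gamma> x, X\<gamma> x + displacement j s' h) \<in> ?K"
  proof eventually_elim
    case (elim s')
    have "norm (E (T\<gamma> s1, X\<gamma> s1 + u *\<^sub>R displacement j s' h) - \<gamma> 1) \<le> \<epsilon>" if "u \<in> {0..1}" for u
    proof (rule top)
      have "norm (u *\<^sub>R displacement j s' h) \<le> 1 * norm (displacement j s' h)"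
        unfolding norm_scaleR using that by (intro mult_right_mono) auto
      then show "norm (u *\<^sub>R displacement j s' h) < e" using elim by simp
    qed
    then show ?case
      using displaced_curve_in_D[OF s(1,2) _ _ _ bottom small x, of s'] elim s by auto
  qed
  moreover have "((\<lambda>s'. (T\<gamma> x, X\<gamma> x + displacement j s' h)) \<longlongrightarrow> (T\<gamma> x, X\<gamma> x + d)) (at_left 1)"
    unfolding d(1) by (intro tendsto_intros displacement_tendsto)
  moreover have "(T\<gamma> x, X\<gamma> x + d) \<in> kasner_M"
    using T\<gamma>_pos[of x] x s by (simp add: kasner_M_def)
  ultimately have "(T\<gamma> x, X\<gamma> x + d) \<in> ?K"
    using closedin_tendsto_mem[OF
        closedin_E_preimage[OF compact_cball small] _ _ trivial_limit_at_left_real]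
    by blast
  then show "(T\<gamma> x, X\<gamma> x + d) \<in> D" "E (T\<gamma> x, X\<gamma> x + d) \<in> cball (\<gamma> 1) ((1 + 2 * onorm l) * \<epsilon>)"
    by simp_all
qed

lemma translations_near:
  assumes "s \<in> {s0..<1}" "norm (\<gamma> s - \<gamma> 1) < \<epsilon>"
  obtains e where "e > 0"
    "\<And>v. norm v < e \<Longrightarrow> (T\<gamma> s, X\<gamma> s + v) \<in> D \<and> norm (E (T\<gamma> s, X\<gamma> s + v) - \<gamma> 1) \<le> \<epsilon>"
proof -
  let ?W = "D \<inter> E -` ball (\<gamma> 1) \<epsilon>"
  have "open ?W" by (rule continuous_open_preimage[OF continuous_on_E open_D open_ball])
  moreover have "F (\<gamma> s) \<in> ?W"
    using F_in_D[OF \<gamma>_in_Y] E_F[OF \<gamma>_in_Y] assms by (simp add: dist_norm norm_minus_commute)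
  ultimately obtain e where e: "e > 0" "ball (F (\<gamma> s)) e \<subseteq> ?W" using open_contains_ball by blast
  have "(T\<gamma> s, X\<gamma> s + v) \<in> D \<and> norm (E (T\<gamma> s, X\<gamma> s + v) - \<gamma> 1) \<le> \<epsilon>" if "norm v < e" for v
  proof -
    have "dist (F (\<gamma> s)) (T\<gamma> s, X\<gamma> s + v) = norm v"
      by (cases "F (\<gamma> s)") (simp add: dist_Pair_Pair dist_norm)
    then have "(T\<gamma> s, X\<gamma> s + v) \<in> ball (F (\<gamma> s)) e" using that by simp
    then have "(T\<gamma> s, X\<gamma> s + v) \<in> ?W" using e(2) by blast
    then show ?thesis by (simp add: dist_norm norm_minus_commute)
  qed
  then show thesis using that[OF e(1)] by blast
qed

lemma horizon_translation:
  assumes s1: "s1 \<in> {s0<..<1}" and near: "\<And>s. s \<in> {s1..<1} \<Longrightarrow> norm (\<gamma> s - \<gamma> 1) < \<epsilon>"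
    and small: "cball (\<gamma> 1) ((1 + 2 * onorm l) * \<epsilon>) \<subseteq> \<Omega>"
  obtains h where "s1 < h" "h < 1"
    "\<And>u. u \<in> {0..1} \<Longrightarrow> (T\<gamma> s1, X\<gamma> s1 + u *\<^sub>R horizon_displacement j h) \<in> D
      \<and> norm (E (T\<gamma> s1, X\<gamma> s1 + u *\<^sub>R horizon_displacement j h) - \<gamma> 1) \<le> \<epsilon>"
    "\<And>s. s \<in> {s1..h} \<Longrightarrow> (T\<gamma> s, X\<gamma> s + horizon_displacement j h) \<in> D
      \<and> E (T\<gamma> s, X\<gamma> s + horizon_displacement j h) \<in> cball (\<gamma> 1) ((1 + 2 * onorm l) * \<epsilon>)"
proof -
  have s1': "s0 < s1" "s1 < 1" "s1 \<in> {s0..<1}" using s1 by auto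
  have near_s1: "norm (\<gamma> s1 - \<gamma> 1) < \<epsilon>" using near s1' by simp
  obtain e where e: "e > 0"
    "\<And>v. norm v < e \<Longrightarrow> (T\<gamma> s1, X\<gamma> s1 + v) \<in> D \<and> norm (E (T\<gamma> s1, X\<gamma> s1 + v) - \<gamma> 1) \<le> \<epsilon>"
    using translations_near[OF s1'(3) near_s1] by blast
  have "\<forall>\<^sub>F h in at_left 1. norm (horizon_displacement j h) < e \<and> h \<in> {s1<..<1}"
    using tendstoD[OF horizon_displacement_tendsto_0 e(1)] eventually_at_left_real[OF s1'(2)]
    by (intro eventually_conj) auto
  then obtain h where h: "norm (horizon_displacement j h) < e" "s1 < h" "h < 1"
    using eventually_happens'[OF trivial_limit_at_left_real] by force
  let ?d = "horizon_displacement j h"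
  have "(T\<gamma> s1, X\<gamma> s1 + u *\<^sub>R ?d) \<in> D \<and> norm (E (T\<gamma> s1, X\<gamma> s1 + u *\<^sub>R ?d) - \<gamma> 1) \<le> \<epsilon>"
    if "u \<in> {0..1}" for u
  proof (rule e(2))
    have "norm (u *\<^sub>R ?d) \<le> 1 * norm ?d"
      unfolding norm_scaleR using that by (intro mult_right_mono) auto
    then show "norm (u *\<^sub>R ?d) < e" using h(1) by simp
  qed
  moreover have "(T\<gamma> s, X\<gamma> s + ?d) \<in> D \<and> E (T\<gamma> s, X\<gamma> s + ?d) \<in> cball (\<gamma> 1) ((1 + 2 * onorm l) * \<epsilon>)"
    if "s \<in> {s1..h}" for s
    using translated_curve_in_D[OF s1'(1) _ h(3) refl h(1) _ _ small that] h(2) e(2) near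
    by (auto simp: less_imp_le)
  ultimately show thesis using that[OF h(2,3)] by blast
qed

lemma horizon_point:
  assumes s1: "s1 \<in> {s0<..<1}" and near: "\<And>s. s \<in> {s1..<1} \<Longrightarrow> norm (\<gamma> s - \<gamma> 1) < \<epsilon>"
    and "cball (\<gamma> 1) ((1 + 2 * onorm l) * \<epsilon>) \<subseteq> \<Omega>"
  obtains Z z where "connected Z" "\<gamma> ` {s1..<1} \<subseteq> Z" "Z \<subseteq> Y"
    "Z \<subseteq> cball (\<gamma> 1) ((1 + 2 * onorm l) * \<epsilon>)" "z \<in> Z" "X z j = endpoint $ j + \<eta> j (T z)"
proof -
  let ?B = "cball (\<gamma> 1) ((1 + 2 * onorm l) * \<epsilon>)"
  obtain h where h: "s1 < h" "h < 1"
    and bridge: "\<And>u. u \<in> {0..1} \<Longrightarrow> (T\<gamma> s1, X\<gamma> s1 + u *\<^sub>R horizon_displacement j h) \<in> D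
      \<and> norm (E (T\<gamma> s1, X\<gamma> s1 + u *\<^sub>R horizon_displacement j h) - \<gamma> 1) \<le> \<epsilon>"
    and translate: "\<And>s. s \<in> {s1..h} \<Longrightarrow> (T\<gamma> s, X\<gamma> s + horizon_displacement j h) \<in> D
      \<and> E (T\<gamma> s, X\<gamma> s + horizon_displacement j h) \<in> ?B"
    using horizon_translation[OF assms, of j] by blast
  define b where "b u = E (T\<gamma> s1, X\<gamma> s1 + u *\<^sub>R horizon_displacement j h)" for u
  define t where "t s = E (T\<gamma> s, X\<gamma> s + horizon_displacement j h)" for s
  define Z where "Z = \<gamma> ` {s1..<1} \<union> b ` {0..1} \<union> t ` {s1..h}"
  have "0 \<le> \<epsilon>" using order_trans[OF norm_ge_zero less_imp_le[OF near[of s1]]] s1 by simp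
  then have \<epsilon>_le: "\<epsilon> \<le> (1 + 2 * onorm l) * \<epsilon>" using onorm_l_nonneg by (simp add: algebra_simps)
  have "connected (\<gamma> ` {s1..<1})"
    by (intro connected_continuous_image continuous_on_subset[OF \<gamma>_cont]) (use s1 in auto)
  moreover have "connected (b ` {0..1})"
    unfolding b_def using bridge
    by (intro connected_continuous_image continuous_on_compose2[OF continuous_on_E]
        continuous_intros) auto
  moreover have "connected (t ` {s1..h})"
    unfolding t_def using translate s1 h
    by (intro connected_continuous_image continuous_on_compose2[OF continuous_on_E]
        continuous_intros continuous_on_subset[OF continuous_on_F\<gamma>]) auto
  moreover have "\<gamma> s1 \<in> b ` {0..1}"
    by (rule image_eqI[of _ b 0]) (use s1 E_F[OF \<gamma>_in_Y, of s1] in \<open>simp_all add: b_def\<close>)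
  then have "\<gamma> s1 \<in> \<gamma> ` {s1..<1} \<inter> b ` {0..1}" using s1 by simp
  moreover have "t s1 \<in> b ` {0..1}"
    by (rule image_eqI[of _ b 1]) (simp_all add: b_def t_def)
  then have "t s1 \<in> b ` {0..1} \<inter> t ` {s1..h}" using h by simp
  ultimately have "connected Z" unfolding Z_def by (intro connected_Un) blast+
  moreover have "\<gamma> ` {s1..<1} \<subseteq> Y \<inter> ?B"
    using near \<gamma>_in_Y s1 \<epsilon>_le by (fastforce simp: dist_norm norm_minus_commute)
  moreover have "b ` {0..1} \<subseteq> Y \<inter> ?B"
    using bridge E_in_Y \<epsilon>_le by (fastforce simp: b_def dist_norm norm_minus_commute)
  moreover have "t ` {s1..h} \<subseteq> Y \<inter> ?B"
    using translate E_in_Y by (auto simp: t_def)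
  moreover have "X (t h) j = endpoint $ j + \<eta> j (T (t h))"
    using h translate[of h] by (simp add: F_E t_def horizon_displacement_def)
  ultimately show thesis using that[of Z "t h"] h by (auto simp: Z_def)
qed

end

section \<open>Lines parallel to a chord of the curve\<close>

locale kasner_lines = kasner_past_curve p \<Omega> g D E l n k M \<gamma> \<gamma>' s0
  for p :: "real ^ 'n::finite" and \<Omega> g D E l n k M \<gamma> \<gamma>' s0 +
  fixes s1 \<rho> :: real
  assumes s1: "s1 \<in> {s0<..<1}" and \<rho>_pos: "0 < \<rho>" and cball_subset_Y: "cball (\<gamma> s0) \<rho> \<subseteq> Y"
    and lines_end_in: "w \<in> cball (\<gamma> s0) \<rho> \<Longrightarrow> w - 2 *\<^sub>R (\<gamma> s0 - \<gamma> s1) \<in> \<Omega>"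
    and \<rho>_cone: "\<rho> + norm (\<gamma> s1 - \<gamma> 1) \<le> k / 2 * (s1 - s0)"
    and \<gamma>_near_s1: "s \<in> {s1..<1} \<Longrightarrow> norm (\<gamma> s - \<gamma> s1) < \<rho>"
begin

definition chord :: "'n spt" where "chord = \<gamma> s0 - \<gamma> s1"

definition line :: "'n spt \<Rightarrow> real \<Rightarrow> 'n spt" where "line w t = w - t *\<^sub>R chord"

definition line_in_Y :: "'n spt \<Rightarrow> real \<Rightarrow> bool" where
  "line_in_Y w t \<longleftrightarrow> (\<forall>u\<in>{0..t}. line w u \<in> Y)"

lemma line_0 [simp]: "line w 0 = w"
  by (simp add: line_def)

lemma line_chord_1 [simp]: "line (z + chord) 1 = z"
  by (simp add: line_def)

lemma closed_segment_line_subset: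
  "closed_segment (z :: 'n spt) (z + chord) \<subseteq> Y \<longleftrightarrow> line_in_Y (z + chord) 1"
  using closed_segment_subset_iff[of z "z + chord"] by (simp add: line_in_Y_def line_def)

lemma line_in_YD: "line_in_Y w t \<Longrightarrow> 0 \<le> u \<Longrightarrow> u \<le> t \<Longrightarrow> line w u \<in> Y"
  by (simp add: line_in_Y_def)

lemma chord_add_in_cone:
  assumes "norm e \<le> k / 2 * (s1 - s0)"
  shows "chord + e \<in> cone_around n k"
proof (rule cone_aroundI)
  show "0 < s1 - s0" using s1 by simp
  have "norm (chord - (s1 - s0) *\<^sub>R n) \<le> k / 2 * (s1 - s0)"
    unfolding chord_def using s1 by (intro \<gamma>_chord) auto
  then show "norm (chord + e - (s1 - s0) *\<^sub>R n) \<le> k * (s1 - s0)"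
    using norm_triangle_ineq[of "chord - (s1 - s0) *\<^sub>R n" e] assms by (simp add: algebra_simps)
qed

lemma chord_in_cone: "chord \<in> cone_around n k"
  using chord_add_in_cone[of 0] s1 k_pos by simp

lemma line_in_\<Omega>:
  assumes w: "w \<in> cball (\<gamma> s0) \<rho>" and t: "t \<in> {0..2}"
  shows "line w t \<in> \<Omega>"
proof -
  have "line w t = (1 - t / 2) *\<^sub>R w + (t / 2) *\<^sub>R (w - 2 *\<^sub>R (\<gamma> s0 - \<gamma> s1))"
    by (simp add: line_def chord_def algebra_simps)
  moreover have "w \<in> \<Omega>" using w cball_subset_Y Y_subset by blast
  ultimately show ?thesis
    using convexD[OF convex_\<Omega> _ lines_end_in[OF w], of w "1 - t / 2" "t / 2"] t by simp
qed

lemma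
  assumes "line_in_Y w t'" "0 \<le> t" "t < t'"
  shows line_T_less: "T (line w t') < T (line w t)"
    and line_X_less: "\<bar>X (line w t') i - X (line w t) i\<bar> < \<eta> i (T (line w t)) - \<eta> i (T (line w t'))"
    and line_in_past_box: "0 < \<tau> \<Longrightarrow> \<tau> \<le> T (line w t') \<Longrightarrow> F (line w t') \<in> past_box p \<tau> (F (line w t))"
proof -
  have Y: "w - s *\<^sub>R chord \<in> Y" if "s \<in> {t..t'}" for s
    using assms that by (simp add: line_in_Y_def line_def)
  show "T (line w t') < T (line w t)"
    unfolding line_def by (rule past_line_T_less[OF chord_in_cone assms(3) Y])
  show "\<bar>X (line w t') i - X (line w t) i\<bar> < \<eta> i (T (line w t)) - \<eta> i (T (line w t'))"
    unfolding line_def by (rule past_line_X_less[OF chord_in_cone assms(3) Y])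
  show "F (line w t') \<in> past_box p \<tau> (F (line w t))" if "0 < \<tau>" "\<tau> \<le> T (line w t')"
    using past_line_in_past_box[OF chord_in_cone assms(3) Y that(1)] that(2) by (simp add: line_def)
qed

lemma \<gamma>_s0_in_Y: "\<gamma> s0 \<in> Y"
  using \<gamma>_in_Y s0_less by simp

lemma \<gamma>_segment_to_s0:
  assumes "s \<in> {s0..<1}"
  shows "closed_segment (\<gamma> s) (\<gamma> s0) \<subseteq> Y"
proof (rule segment_continuation)
  let ?P = "(\<lambda>s. (\<gamma> s, \<gamma> s0)) ` {s0..<1}"
  have "continuous_on {s0..<1} (\<lambda>s. (\<gamma> s, \<gamma> s0))"
    by (intro continuous_intros continuous_on_subset[OF \<gamma>_cont]) auto
  then show "connected ?P" by (rule connected_continuous_image) simp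
  show "(\<gamma> s0, \<gamma> s0) \<in> ?P" "(\<gamma> s, \<gamma> s0) \<in> ?P" using s0_less assms by auto
  show "closed_segment (\<gamma> s0) (\<gamma> s0) \<subseteq> Y" using \<gamma>_s0_in_Y by simp
  show "z \<in> Y \<and> w \<in> Y \<and> w - z \<in> insert 0 (cone_around n k)" if zw: "(z, w) \<in> ?P" for z w
  proof -
    obtain s where "z = \<gamma> s" "w = \<gamma> s0" "s \<in> {s0..<1}" using zw by auto
    then show ?thesis
      using \<gamma>_in_Y \<gamma>_s0_in_Y \<gamma>_chord_in_cone[of s0 s] by (cases "s = s0") auto
  qed
qed

lemma line_in_Y_above:
  assumes conn: "connected Z" and start: "\<gamma> s1 \<in> Z" and Z: "Z \<subseteq> Y" "Z \<subseteq> cball (\<gamma> s1) \<rho>"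
    and z: "z \<in> Z"
  shows "line_in_Y (z + chord) 1"
proof -
  let ?P = "(\<lambda>z. (z, z + chord)) ` Z"
  have "closed_segment z (z + chord) \<subseteq> Y"
  proof (rule segment_continuation)
    show "connected ?P" using conn by (intro connected_continuous_image continuous_intros)
    show "(\<gamma> s1, \<gamma> s1 + chord) \<in> ?P" "(z, z + chord) \<in> ?P" using start z by auto
    show "closed_segment (\<gamma> s1) (\<gamma> s1 + chord) \<subseteq> Y"
      using \<gamma>_segment_to_s0[of s1] s1 by (simp add: chord_def)
    show "z \<in> Y \<and> w \<in> Y \<and> w - z \<in> insert 0 (cone_around n k)" if "(z, w) \<in> ?P" for z w
    proof -
      have w: "w = z + chord" "z \<in> Z" using that by auto
      have "norm (\<gamma> s0 - w) = norm (\<gamma> s1 - z)" by (simp add: w chord_def)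
      then have "w \<in> cball (\<gamma> s0) \<rho>" using w(2) Z(2) by (auto simp: dist_norm)
      then show ?thesis using w Z(1) cball_subset_Y chord_in_cone by auto
    qed
  qed
  then show ?thesis by (simp only: closed_segment_line_subset)
qed

lemma
  assumes w: "w \<in> cball (\<gamma> s0) \<rho>"
  shows segment_minus_line_2_in_cone:
      "z \<in> closed_segment w (\<gamma> s0) \<Longrightarrow> z - line w 2 \<in> cone_around n k"
    and \<gamma>_minus_line_2_in_cone: "s \<in> {s0..<1} \<Longrightarrow> \<gamma> s - line w 2 \<in> cone_around n k"
proof -
  assume "z \<in> closed_segment w (\<gamma> s0)"
  then have "norm (z - w) \<le> dist (\<gamma> s0) w" using segment_bound(1) by (simp add: dist_norm)
  then have "norm (z - w) \<le> \<rho>" using w by simp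
  then have "norm (z - w) \<le> k / 2 * (s1 - s0)"
    using \<rho>_cone norm_ge_zero[of "\<gamma> s1 - \<gamma> 1"] by linarith
  then have "chord + (chord + (z - w)) \<in> cone_around n k"
    by (intro cone_around_add chord_in_cone chord_add_in_cone)
  moreover have "chord + (chord + (z - w)) = z - line w 2" by (simp add: line_def scaleR_2)
  ultimately show "z - line w 2 \<in> cone_around n k" by simp
next
  assume s: "s \<in> {s0..<1}"
  have "norm ((\<gamma> 1 - \<gamma> s1) + (\<gamma> s0 - w)) \<le> k / 2 * (s1 - s0)"
    using norm_triangle_ineq[of "\<gamma> 1 - \<gamma> s1" "\<gamma> s0 - w"] w \<rho>_cone
    by (simp add: dist_norm norm_minus_commute)
  then have "(\<gamma> s - \<gamma> 1) + (chord + ((\<gamma> 1 - \<gamma> s1) + (\<gamma> s0 - w))) \<in> cone_around n k"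
    using s by (intro cone_around_add chord_add_in_cone \<gamma>_chord_in_cone) auto
  moreover have "(\<gamma> s - \<gamma> 1) + (chord + ((\<gamma> 1 - \<gamma> s1) + (\<gamma> s0 - w))) = \<gamma> s - line w 2"
    by (simp add: line_def chord_def scaleR_2)
  ultimately show "\<gamma> s - line w 2 \<in> cone_around n k" by simp
qed

text \<open>Otherwise the end point of the line could be joined to all points of \<open>\<gamma>\<close> by future directed
  segments in \<open>Y\<close>, although the Kasner time tends to \<open>0\<close> along \<open>\<gamma>\<close>.\<close>

lemma line_leaves_Y:
  assumes w: "w \<in> cball (\<gamma> s0) \<rho>"
  shows "\<not> line_in_Y w 2"
proof
  assume line: "line_in_Y w 2"
  define r where "r = line w 2"
  have r: "r \<in> Y" using line_in_YD[OF line, of 2] by (simp add: r_def)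
  define Q where "Q = closed_segment w (\<gamma> s0) \<union> \<gamma> ` {s0..<1}"
  have "closed_segment w (\<gamma> s0) \<subseteq> cball (\<gamma> s0) \<rho>"
    by (rule closed_segment_subset[OF w _ convex_cball]) (use \<rho>_pos in simp)
  then have Q: "z \<in> Y \<and> z - r \<in> cone_around n k" if "z \<in> Q" for z
    using that cball_subset_Y \<gamma>_in_Y segment_minus_line_2_in_cone[OF w] \<gamma>_minus_line_2_in_cone[OF w]
    unfolding Q_def r_def by blast
  have "connected Q"
    unfolding Q_def using s0_less
    by (intro connected_Un connected_continuous_image continuous_on_subset[OF \<gamma>_cont]) auto
  then have conn: "connected ((\<lambda>z. (r, z)) ` Q)"
    by (intro connected_continuous_image continuous_intros)
  have "closed_segment r z \<subseteq> Y" if z: "z \<in> Q" for z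
  proof (rule segment_continuation[OF conn])
    show "(r, w) \<in> (\<lambda>z. (r, z)) ` Q" "(r, z) \<in> (\<lambda>z. (r, z)) ` Q" using z by (auto simp: Q_def)
    have "w - s *\<^sub>R (w - r) = line w (2 * s)" for s by (simp add: r_def line_def algebra_simps)
    then show "closed_segment r w \<subseteq> Y"
      using line by (simp add: closed_segment_subset_iff line_in_Y_def)
    show "z \<in> Y \<and> w \<in> Y \<and> w - z \<in> insert 0 (cone_around n k)" if "(z, w) \<in> (\<lambda>z. (r, z)) ` Q" for z w
      using Q r that by auto
  qed
  then have "T r \<le> T\<gamma> s" if "s \<in> {s0..<1}" for s
    using that Q[of "\<gamma> s"] by (intro segment_T_le[of r "\<gamma> s"]) (auto simp: Q_def)
  then have "\<forall>\<^sub>F s in at_left 1. T r \<le> T\<gamma> s"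
    by (intro eventually_mono[OF eventually_at_left_real[OF s0_less]]) auto
  then have "T r \<le> 0" by (intro tendsto_lowerbound[OF T\<gamma>_tendsto_0]) auto
  then show False using T_pos[OF r] by simp
qed

lemma line_limit_in_Y:
  assumes w: "w \<in> cball (\<gamma> s0) \<rho>" and t: "0 < t" "t \<le> 2" and \<tau>: "0 < \<tau>"
    and below: "\<And>u. u \<in> {0..<t} \<Longrightarrow> line w u \<in> Y \<and> \<tau> \<le> T (line w u)"
  shows "line w t \<in> Y" and "\<tau> \<le> T (line w t)"
proof -
  have interval: "\<forall>\<^sub>F u in at_left t. u \<in> {0<..<t}" by (rule eventually_at_left_real[OF t(1)])
  have line_tendsto: "(line w \<longlongrightarrow> line w t) (at_left t)"
    unfolding line_def by (intro tendsto_intros)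
  have box: "F (line w u) \<in> past_box p \<tau> (F w)" if u: "u \<in> {0<..<t}" for u
  proof -
    have "line_in_Y w u" using below u by (auto simp: line_in_Y_def)
    then show ?thesis using line_in_past_box[of w u 0 \<tau>] below[of u] u \<tau> by simp
  qed
  have "\<forall>\<^sub>F u in at_left t. line w u \<in> Y \<and> F (line w u) \<in> past_box p \<tau> (F w)"
    using interval by eventually_elim (use box below in auto)
  then show Y: "line w t \<in> Y"
    by (rule tendsto_in_Y[OF compact_past_box past_box_subset_kasner_M[OF \<tau>] _ line_tendsto])
      (use line_in_\<Omega>[OF w] t in auto)
  have "((\<lambda>u. T (line w u)) \<longlongrightarrow> T (line w t)) (at_left t)"
    by (intro tendsto_fst
        isCont_tendsto_compose[OF has_derivative_continuous[OF F_has_derivative[OF Y]] line_tendsto])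
  moreover have "\<forall>\<^sub>F u in at_left t. \<tau> \<le> T (line w u)"
    using interval by eventually_elim (use below in auto)
  ultimately show "\<tau> \<le> T (line w t)" by (rule tendsto_lowerbound) simp
qed

lemma line_continues_in_Y:
  assumes "line w t \<in> Y" "\<tau> < T (line w t)"
  obtains t' where "t < t'" "\<And>u. u \<in> {t<..<t'} \<Longrightarrow> line w u \<in> Y \<and> \<tau> < T (line w u)"
proof -
  have "isCont (line w) t" unfolding line_def by (intro continuous_intros)
  then have line_tendsto: "(line w \<longlongrightarrow> line w t) (at t)" by (simp add: isCont_def)
  have "\<forall>\<^sub>F u in at t. line w u \<in> Y" by (rule topological_tendstoD[OF line_tendsto open_Y assms(1)])
  moreover have "\<forall>\<^sub>F u in at t. \<tau> < T (line w u)"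
    using has_derivative_continuous[OF F_has_derivative[OF assms(1)]]
    by (intro order_tendstoD(1)[OF _ assms(2)] tendsto_fst
        isCont_tendsto_compose[OF _ line_tendsto])
  ultimately have "\<forall>\<^sub>F u in at t. line w u \<in> Y \<and> \<tau> < T (line w u)" by (rule eventually_conj)
  then have "\<forall>\<^sub>F u in at_right t. line w u \<in> Y \<and> \<tau> < T (line w u)"
    by (simp add: eventually_at_split)
  then show thesis using that by (auto simp: eventually_at_right_field)
qed

lemma line_meets_slice:
  assumes w: "w \<in> cball (\<gamma> s0) \<rho>" and \<tau>: "0 < \<tau>" "\<tau> < T w"
  obtains t where "0 < t" "line_in_Y w t" "T (line w t) = \<tau>"
proof -
  define S where "S = {t \<in> {0..2}. \<forall>u\<in>{0..t}. line w u \<in> Y \<and> \<tau> \<le> T (line w u)}"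
  have "0 \<in> S" using w cball_subset_Y \<tau> by (auto simp: S_def)
  have bdd: "bdd_above S" by (auto simp: S_def intro: bdd_aboveI[of _ 2])
  define t where "t = Sup S"
  have t_ge: "u \<le> t" if "u \<in> S" for u unfolding t_def by (rule cSup_upper[OF that bdd])
  have t: "0 \<le> t" "t \<le> 2"
  proof -
    show "0 \<le> t" by (rule t_ge[OF \<open>0 \<in> S\<close>])
    show "t \<le> 2" unfolding t_def using \<open>0 \<in> S\<close> by (intro cSup_least) (blast, simp add: S_def)
  qed
  have below: "line w u \<in> Y \<and> \<tau> \<le> T (line w u)" if u: "u \<in> {0..<t}" for u
  proof -
    have "u < Sup S" using u by (simp add: t_def)
    then obtain t' where "t' \<in> S" "u < t'" using less_cSupE \<open>0 \<in> S\<close> by blast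
    then show ?thesis using u by (auto simp: S_def)
  qed
  have at_t: "line w t \<in> Y \<and> \<tau> \<le> T (line w t)"
  proof (cases "t = 0")
    case False
    then show ?thesis using line_limit_in_Y[OF w _ t(2) \<tau>(1) below] t(1) by simp
  qed (use \<open>0 \<in> S\<close> in \<open>auto simp: S_def\<close>)
  have upto: "line w u \<in> Y \<and> \<tau> \<le> T (line w u)" if "u \<in> {0..t}" for u
    using below[of u] at_t that by (cases "u = t") auto
  have line_in: "line_in_Y w t" using upto by (simp add: line_in_Y_def)
  then have "t < 2" using line_leaves_Y[OF w] t(2) by (cases "t = 2") auto
  have "T (line w t) = \<tau>"
  proof (rule ccontr)
    assume "T (line w t) \<noteq> \<tau>"
    then have "\<tau> < T (line w t)" using at_t by simp
    then obtain t' where t': "t < t'" "\<And>u. u \<in> {t<..<t'} \<Longrightarrow> line w u \<in> Y \<and> \<tau> < T (line w u)"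
      using line_continues_in_Y at_t by blast
    define u where "u = (t + min t' 2) / 2"
    have u: "t < u" "u < t'" "u < 2" using t'(1) \<open>t < 2\<close> by (auto simp: u_def min_def)
    have "line w x \<in> Y \<and> \<tau> \<le> T (line w x)" if "x \<in> {0..u}" for x
      using upto[of x] t'(2)[of x] that u by (cases "x \<le> t") auto
    then have "u \<in> S" using u t by (simp add: S_def)
    then show False using t_ge u(1) by fastforce
  qed
  moreover have "t \<noteq> 0" using \<open>T (line w t) = \<tau>\<close> \<tau>(2) by auto
  ultimately show thesis using that[of t] t(1) line_in by simp
qed

definition slice_parameter :: "real \<Rightarrow> 'n spt \<Rightarrow> real" where
  "slice_parameter \<tau> w = (THE t. 0 < t \<and> line_in_Y w t \<and> T (line w t) = \<tau>)"

definition slice :: "real \<Rightarrow> 'n spt \<Rightarrow> 'n spt" where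
  "slice \<tau> w = line w (slice_parameter \<tau> w)"

lemma line_T_inj:
  assumes "0 \<le> t" "line_in_Y w t" "0 \<le> t'" "line_in_Y w t'" "T (line w t) = T (line w t')"
  shows "t = t'"
  using line_T_less[of w t t'] line_T_less[of w t' t] assms
  by (cases t t' rule: linorder_cases) auto

lemma slice_parameter_eq:
  assumes "0 < t" "line_in_Y w t"
  shows "slice_parameter (T (line w t)) w = t"
  unfolding slice_parameter_def
  by (rule the_equality) (use assms line_T_inj[of _ w t] in auto)

lemma slice_parameter:
  assumes "w \<in> cball (\<gamma> s0) \<rho>" "0 < \<tau>" "\<tau> < T w"
  shows "0 < slice_parameter \<tau> w" and "line_in_Y w (slice_parameter \<tau> w)" and "T (slice \<tau> w) = \<tau>"
proof -
  obtain t where t: "0 < t" "line_in_Y w t" "T (line w t) = \<tau>"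
    using line_meets_slice[OF assms] by blast
  then have "slice_parameter \<tau> w = t" using slice_parameter_eq[OF t(1,2)] by simp
  then show "0 < slice_parameter \<tau> w" "line_in_Y w (slice_parameter \<tau> w)" "T (slice \<tau> w) = \<tau>"
    using t by (simp_all add: slice_def)
qed

lemma slice_in_Y:
  assumes "w \<in> cball (\<gamma> s0) \<rho>" "0 < \<tau>" "\<tau> < T w"
  shows "slice \<tau> w \<in> Y"
  using line_in_YD[OF slice_parameter(2)[OF assms]] slice_parameter(1)[OF assms]
  by (simp add: slice_def)

lemma slice_eq:
  assumes "line_in_Y (z + chord) 1"
  shows "slice (T z) (z + chord) = z"
  using slice_parameter_eq[OF zero_less_one assms] by (simp add: slice_def)

lemma slice_X_less:
  assumes w: "w \<in> cball (\<gamma> s0) \<rho>" and \<tau>: "0 < \<tau>'" "\<tau>' < \<tau>" "\<tau> < T w"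
  shows "\<bar>X (slice \<tau>' w) i - X (slice \<tau> w) i\<bar> < \<eta> i \<tau> - \<eta> i \<tau>'"
proof -
  have \<tau>_w: "0 < \<tau>" "\<tau>' < T w" using \<tau> by auto
  note t = slice_parameter[OF w \<tau>_w(1) \<tau>(3)] and t' = slice_parameter[OF w \<tau>(1) \<tau>_w(2)]
  have "slice_parameter \<tau> w < slice_parameter \<tau>' w"
  proof (rule ccontr)
    assume "\<not> ?thesis"
    then have "slice_parameter \<tau>' w \<noteq> slice_parameter \<tau> w \<Longrightarrow> T (slice \<tau> w) < T (slice \<tau>' w)"
      unfolding slice_def using t(2) t'(1) by (intro line_T_less) auto
    then show False
      using t(3) t'(3) \<tau>(2)
      by (cases "slice_parameter \<tau>' w = slice_parameter \<tau> w") (auto simp: slice_def)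
  qed
  then show ?thesis
    using line_X_less[OF t'(2), of "slice_parameter \<tau> w" i] t(1,3) t'(3) by (simp add: slice_def)
qed

definition line_domain :: "('n spt \<times> real) set" where
  "line_domain = {q. fst q \<in> ball (\<gamma> s0) \<rho> \<and> 0 < snd q \<and> line_in_Y (fst q) (snd q)}"

lemma open_line_domain: "open line_domain"
proof -
  have "closed_segment (line w t) w \<subseteq> Y \<longleftrightarrow> line_in_Y w t" if t: "0 < t" for w t
  proof -
    have "w - s *\<^sub>R (w - line w t) = line w (t * s)" for s by (simp add: line_def algebra_simps)
    then have "closed_segment (line w t) w \<subseteq> Y \<longleftrightarrow> (\<forall>u\<in>(\<lambda>s. t * s) ` {0..1}. line w u \<in> Y)"
      by (simp add: closed_segment_subset_iff)
    also have "(\<lambda>s. t * s) ` {0..1} = {0..t}" using t by (simp add: image_mult_atLeastAtMost)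
    finally show ?thesis by (simp add: line_in_Y_def)
  qed
  then have "line_domain = fst -` ball (\<gamma> s0) \<rho> \<inter> snd -` {0<..}
      \<inter> (\<lambda>q. (line (fst q) (snd q), fst q)) -` {q. closed_segment (fst q) (snd q) \<subseteq> Y}"
    unfolding line_domain_def by (intro set_eqI) (simp, blast)
  then show ?thesis
    by (simp only: line_def)
      (intro open_Int open_vimage open_ball open_greaterThan open_closed_segment_subset open_Y
          continuous_intros)
qed

lemma line_has_derivative:
  "((\<lambda>q. line (fst q) (snd q)) has_derivative (\<lambda>h. fst h - snd h *\<^sub>R chord)) (at q)"
  unfolding line_def by (auto intro!: derivative_eq_intros)

lemma slicing_has_derivative:
  assumes "line w t \<in> Y"
  shows "((\<lambda>q. (fst q, T (line (fst q) (snd q)))) has_derivative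
    (\<lambda>h. (fst h, fst (F' (line w t) (fst h)) - snd h * fst (F' (line w t) chord)))) (at (w, t))"
proof -
  let ?y = "line w t"
  have "((\<lambda>q. F (line (fst q) (snd q))) has_derivative (\<lambda>h. F' ?y (fst h - snd h *\<^sub>R chord))) (at (w, t))"
    using diff_chain_at[OF line_has_derivative[of "(w, t)"], of F "F' ?y"]
      F_has_derivative[OF assms]
    by (simp add: o_def)
  then have "((\<lambda>q. (fst q, T (line (fst q) (snd q)))) has_derivative
      (\<lambda>h. (fst h, fst (F' ?y (fst h - snd h *\<^sub>R chord))))) (at (w, t))"
    by (intro has_derivative_Pair has_derivative_fst has_derivative_ident)
  then show ?thesis
    by (simp add: linear_diff[OF linear_F'[OF assms]] linear_cmul[OF linear_F'[OF assms]])
qed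

lemma slice_parameter_has_derivative:
  assumes w: "w \<in> ball (\<gamma> s0) \<rho>" and \<tau>: "0 < \<tau>" "\<tau> < T w"
  shows "(slice_parameter \<tau> has_derivative
    (\<lambda>d. fst (F' (slice \<tau> w) d) / fst (F' (slice \<tau> w) chord))) (at w)"
proof -
  have w': "w \<in> cball (\<gamma> s0) \<rho>" using w by simp
  let ?t = "slice_parameter \<tau> w" and ?y = "slice \<tau> w"
  let ?\<Psi> = "\<lambda>q. (fst q, T (line (fst q) (snd q)))"
    and ?G = "\<lambda>q. (fst q, slice_parameter (snd q) (fst q))"
  have y: "?y \<in> Y" by (rule slice_in_Y[OF w' \<tau>])
  have chord: "fst (F' ?y chord) \<noteq> 0" using F'_cone(2)[OF y chord_in_cone] by simp
  let ?\<Psi>' = "\<lambda>h. (fst h, fst (F' ?y (fst h)) - snd h * fst (F' ?y chord))"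
  let ?G' = "\<lambda>h. (fst h, (fst (F' ?y (fst h)) - snd h) / fst (F' ?y chord))"
  have "(?G has_derivative ?G') (at (?\<Psi> (w, ?t)))"
  proof (rule has_derivative_inverse_strong[OF open_line_domain, where f = ?\<Psi>
        and x = "(w, ?t)" and f' = ?\<Psi>'])
    show "(w, ?t) \<in> line_domain"
      using w slice_parameter[OF w' \<tau>] by (simp add: line_domain_def)
    have line: "line (fst q) (snd q) \<in> Y" if "q \<in> line_domain" for q
      using line_in_YD[of "fst q" "snd q" "snd q"] that by (simp add: line_domain_def)
    show "continuous_on line_domain ?\<Psi>"
      by (rule continuous_at_imp_continuous_on)
        (use line has_derivative_continuous[OF slicing_has_derivative] in fastforce)
    show "?G (?\<Psi> q) = q" if "q \<in> line_domain" for q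
      using that by (simp add: line_domain_def slice_parameter_eq prod_eq_iff)
    show "(?\<Psi> has_derivative ?\<Psi>') (at (w, ?t))"
      using slicing_has_derivative[of w ?t] y by (simp add: slice_def)
    show "?\<Psi>' \<circ> ?G' = id" using chord by (auto simp: fun_eq_iff)
  qed
  moreover have "?\<Psi> (w, ?t) = (w, \<tau>)" using slice_parameter(3)[OF w' \<tau>] by (simp add: slice_def)
  ultimately have G: "(?G has_derivative ?G') (at (w, \<tau>))" by simp
  have "((\<lambda>w. (w, \<tau>)) has_derivative (\<lambda>d. (d, 0))) (at w)"
    by (intro has_derivative_Pair has_derivative_ident has_derivative_const)
  from has_derivative_snd[OF diff_chain_at[OF this G]] show ?thesis by (simp add: o_def)
qed

lemma slice_has_derivative:
  assumes w: "w \<in> ball (\<gamma> s0) \<rho>" and \<tau>: "0 < \<tau>" "\<tau> < T w"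
  shows "(slice \<tau> has_derivative
    (\<lambda>d. d - (fst (F' (slice \<tau> w) d) / fst (F' (slice \<tau> w) chord)) *\<^sub>R chord)) (at w)"
  unfolding slice_def[abs_def] line_def
  by (intro has_derivative_diff has_derivative_ident has_derivative_scaleR_left
      slice_parameter_has_derivative[OF assms, unfolded slice_def line_def])

lemma slice_tangent_snd_le:
  assumes y: "y \<in> Y" and e: "e = d - (fst (F' y d) / fst (F' y chord)) *\<^sub>R chord"
  shows "\<bar>snd (F' y e) $ j\<bar> \<le> T y powr (- (p $ j)) * M * norm d"
proof -
  have chord: "fst (F' y chord) \<noteq> 0" using F'_cone(2)[OF y chord_in_cone] by simp
  then have "fst (F' y e) = 0"
    unfolding e by (simp add: linear_diff[OF linear_F'[OF y]] linear_cmul[OF linear_F'[OF y]])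
  then have "(norm (kasner_scale p (T y) (snd (F' y e))))\<^sup>2 = g y e e"
    using kasner_g_eq[OF F_in_kasner_M[OF y], of p "F' y e"] isometric_F[OF y, of e e] by simp
  also have "\<dots> \<le> (M * norm d)\<^sup>2"
    unfolding e using transversal_le[OF _ chord_in_cone] y Y_subset by blast
  finally have "norm (kasner_scale p (T y) (snd (F' y e))) \<le> M * norm d"
    by (rule power2_le_imp_le) (simp add: M_nonneg)
  then have "T y powr (- (p $ j)) * norm (kasner_scale p (T y) (snd (F' y e)))
      \<le> T y powr (- (p $ j)) * (M * norm d)"
    by (intro mult_left_mono) auto
  then show ?thesis
    using kasner_scale_component_le[OF T_pos[OF y], of "snd (F' y e)" j p] by (simp add: mult.assoc)
qed

lemma slice_X_Lipschitz:
  assumes w: "w \<in> ball (\<gamma> s0) \<rho>" "w' \<in> ball (\<gamma> s0) \<rho>"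
    and \<tau>: "0 < \<tau>" "\<And>w. w \<in> ball (\<gamma> s0) \<rho> \<Longrightarrow> \<tau> < T w"
  shows "\<bar>X (slice \<tau> w) j - X (slice \<tau> w') j\<bar> \<le> \<tau> powr (- (p $ j)) * M * norm (w - w')"
proof -
  let ?S' = "\<lambda>w d. d - (fst (F' (slice \<tau> w) d) / fst (F' (slice \<tau> w) chord)) *\<^sub>R chord"
  have "norm (X (slice \<tau> w) j - X (slice \<tau> w') j) \<le> \<tau> powr (- (p $ j)) * M * norm (w - w')"
  proof (rule differentiable_bound[OF convex_ball _ _ w])
    fix v assume v: "v \<in> ball (\<gamma> s0) \<rho>"
    then have v': "v \<in> cball (\<gamma> s0) \<rho>" by simp
    have y: "slice \<tau> v \<in> Y" by (rule slice_in_Y[OF v' \<tau>(1) \<tau>(2)[OF v]])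
    have "((\<lambda>w. F (slice \<tau> w)) has_derivative (\<lambda>d. F' (slice \<tau> v) (?S' v d))) (at v)"
      using diff_chain_at[OF slice_has_derivative[OF v \<tau>(1) \<tau>(2)[OF v]] F_has_derivative[OF y]]
      by (simp add: o_def)
    from bounded_linear.has_derivative[OF
        bounded_linear_compose[OF bounded_linear_vec_nth bounded_linear_snd] this]
    show "((\<lambda>w. X (slice \<tau> w) j) has_derivative (\<lambda>d. snd (F' (slice \<tau> v) (?S' v d)) $ j))
        (at v within ball (\<gamma> s0) \<rho>)"
      by (rule has_derivative_at_withinI)
    show "onorm (\<lambda>d. snd (F' (slice \<tau> v) (?S' v d)) $ j) \<le> \<tau> powr (- (p $ j)) * M"
      using slice_tangent_snd_le[OF y refl] slice_parameter(3)[OF v' \<tau>(1) \<tau>(2)[OF v]]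
      by (intro onorm_le) simp
  qed
  then show ?thesis by simp
qed

lemma slice_\<gamma>:
  assumes "s \<in> {s1..<1}"
  shows "slice (T\<gamma> s) (\<gamma> s + chord) = \<gamma> s" and "\<gamma> s + chord \<in> ball (\<gamma> s0) \<rho>"
proof -
  have "line_in_Y (\<gamma> s + chord) 1"
  proof (rule line_in_Y_above)
    show "connected (\<gamma> ` {s1..<1})"
      using s1 by (intro connected_continuous_image continuous_on_subset[OF \<gamma>_cont]) auto
    show "\<gamma> ` {s1..<1} \<subseteq> Y" using \<gamma>_in_Y s1 by auto
    show "\<gamma> ` {s1..<1} \<subseteq> cball (\<gamma> s1) \<rho>"
      using \<gamma>_near_s1 by (auto simp: dist_norm norm_minus_commute less_imp_le)
  qed (use s1 assms in auto)
  then show "slice (T\<gamma> s) (\<gamma> s + chord) = \<gamma> s" by (rule slice_eq)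
  show "\<gamma> s + chord \<in> ball (\<gamma> s0) \<rho>"
    using \<gamma>_near_s1[OF assms] by (simp add: chord_def dist_norm norm_minus_commute algebra_simps)
qed

lemma eventually_T\<gamma>_less: "\<forall>\<^sub>F s in at_left 1. \<forall>w\<in>cball (\<gamma> s0) \<rho>. T\<gamma> s < T w"
proof -
  have "continuous_on (cball (\<gamma> s0) \<rho>) T"
    by (intro continuous_on_fst continuous_on_subset[OF continuous_on_F cball_subset_Y])
  moreover have "cball (\<gamma> s0) \<rho> \<noteq> {}" using \<rho>_pos by simp
  ultimately obtain w0 where w0: "w0 \<in> cball (\<gamma> s0) \<rho>" "\<forall>w\<in>cball (\<gamma> s0) \<rho>. T w0 \<le> T w"
    using continuous_attains_inf[OF compact_cball] by blast
  then have "0 < T w0" using T_pos cball_subset_Y by blast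
  from order_tendstoD(2)[OF T\<gamma>_tendsto_0 this] show ?thesis
    by eventually_elim (use w0(2) in fastforce)
qed

text \<open>The diameter of the slices of constant Kasner time is bounded in the chart, while their metric
  blows up in the direction \<open>j\<close>. Hence all lines end at the same \<open>j\<close>-th coordinate.\<close>

lemma slice_X_tendsto_endpoint:
  assumes j: "p $ j < 0" and w: "w \<in> ball (\<gamma> s0) \<rho>"
  shows "((\<lambda>s. X (slice (T\<gamma> s) w) j) \<longlongrightarrow> endpoint $ j) (at_left 1)"
proof -
  have "((\<lambda>s. T\<gamma> s powr (- (p $ j)) * M * (2 * \<rho>)) \<longlongrightarrow> 0 powr (- (p $ j)) * M * (2 * \<rho>)) (at_left 1)"
  proof (intro tendsto_mult tendsto_const tendsto_powr2 T\<gamma>_tendsto_0)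
    show "\<forall>\<^sub>F s in at_left 1. 0 \<le> T\<gamma> s"
      using eventually_at_left_real[OF s0_less] by eventually_elim (simp add: T\<gamma>_pos less_imp_le)
  qed (use j in simp)
  then have blow_up: "((\<lambda>s. T\<gamma> s powr (- (p $ j)) * M * (2 * \<rho>)) \<longlongrightarrow> 0) (at_left 1)" by simp
  have "\<forall>\<^sub>F s in at_left 1. s \<in> {s1<..<1}" using s1 by (intro eventually_at_left_real) simp
  then have "\<forall>\<^sub>F s in at_left 1. norm (X (slice (T\<gamma> s) w) j - X\<gamma> s $ j)
      \<le> T\<gamma> s powr (- (p $ j)) * M * (2 * \<rho>)"
    using eventually_T\<gamma>_less
  proof eventually_elim
    case (elim s)
    then have s: "s \<in> {s1..<1}" "0 < T\<gamma> s" using T\<gamma>_pos s1 by auto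
    have "norm (X (slice (T\<gamma> s) w) j - X\<gamma> s $ j)
        \<le> T\<gamma> s powr (- (p $ j)) * M * norm (w - (\<gamma> s + chord))"
      using slice_X_Lipschitz[OF w slice_\<gamma>(2)[OF s(1)] s(2), of j] elim(2)
      by (simp add: slice_\<gamma>(1)[OF s(1)])
    also have "\<dots> \<le> T\<gamma> s powr (- (p $ j)) * M * (2 * \<rho>)"
    proof (intro mult_left_mono)
      show "norm (w - (\<gamma> s + chord)) \<le> 2 * \<rho>"
        using dist_triangle_less_add[of w "\<gamma> s0" \<rho> "\<gamma> s + chord" \<rho>] w slice_\<gamma>(2)[OF s(1)]
        by (simp add: dist_commute dist_norm)
    qed (use M_nonneg in simp)
    finally show ?case .
  qed
  then have "((\<lambda>s. X (slice (T\<gamma> s) w) j - X\<gamma> s $ j) \<longlongrightarrow> 0) (at_left 1)"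
    by (rule Lim_null_comparison[OF _ blow_up])
  from tendsto_add[OF this tendsto_vec_nth[OF X\<gamma>_tendsto_endpoint, of j]] show ?thesis by simp
qed

lemma strictly_inside_horizon:
  assumes j: "p $ j < 0" and z: "line_in_Y (z + chord) 1" "z + chord \<in> ball (\<gamma> s0) \<rho>"
  shows "\<bar>X z j - endpoint $ j\<bar> < \<eta> j (T z)"
proof -
  define w where "w = z + chord"
  have w: "w \<in> cball (\<gamma> s0) \<rho>" using z(2) by (simp add: w_def)
  have "z \<in> Y" using line_in_YD[OF z(1), of 1] by simp
  then have Tz: "0 < T z" by (rule T_pos)
  have Tw: "T z < T w" using line_T_less[OF z(1), of 0] by (simp add: w_def)
  define \<tau> where "\<tau> = T z / 2"
  have \<tau>: "0 < \<tau>" "\<tau> < T z" using Tz by (auto simp: \<tau>_def)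
  have slice_z: "slice (T z) w = z" unfolding w_def by (rule slice_eq[OF z(1)])
  have "\<bar>X (slice \<tau> w) j - X z j\<bar> < \<eta> j (T z) - \<eta> j \<tau>"
    using slice_X_less[OF w \<tau> Tw] by (simp add: slice_z)
  moreover have "\<bar>endpoint $ j - X (slice \<tau> w) j\<bar> \<le> \<eta> j \<tau>"
  proof (rule tendsto_upperbound)
    show "((\<lambda>s. \<bar>X (slice (T\<gamma> s) w) j - X (slice \<tau> w) j\<bar>)
        \<longlongrightarrow> \<bar>endpoint $ j - X (slice \<tau> w) j\<bar>) (at_left 1)"
      using z(2) by (intro tendsto_intros slice_X_tendsto_endpoint[OF j]) (simp add: w_def)
    show "\<forall>\<^sub>F s in at_left 1. \<bar>X (slice (T\<gamma> s) w) j - X (slice \<tau> w) j\<bar> \<le> \<eta> j \<tau>"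
      using order_tendstoD(2)[OF T\<gamma>_tendsto_0 \<tau>(1)] eventually_at_left_real[OF s0_less]
    proof eventually_elim
      case (elim s)
      then have T\<gamma>: "0 < T\<gamma> s" by (intro T\<gamma>_pos) auto
      then show ?case
        using slice_X_less[OF w T\<gamma> elim(1), of j] \<tau>(2) Tw horizon_pos[OF T\<gamma> exponent_less_1, of j]
        by simp
    qed
  qed simp
  ultimately show ?thesis by linarith
qed

end

lemma diff_2_scaleR_diff_in_ball:
  fixes b b' w y :: "'a::real_normed_vector"
  assumes "norm (w - b) \<le> R / 4" "norm (b - y) < R / 4" "norm (b' - y) < R / 4"
  shows "w - 2 *\<^sub>R (b - b') \<in> ball y R"
proof -
  have "w - 2 *\<^sub>R (b - b') - y = (w - b) - (b - y) + 2 *\<^sub>R (b' - y)"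
    by (simp add: scaleR_2 algebra_simps)
  also have "norm \<dots> \<le> norm (w - b) + norm (b - y) + 2 * norm (b' - y)"
    by (intro norm_triangle_mono norm_triangle_ineq4) simp
  also have "\<dots> < R" using assms by simp
  finally show ?thesis by (simp add: dist_norm norm_minus_commute)
qed

context kasner_past_curve
begin

lemma \<gamma>_near_1:
  assumes "0 < \<epsilon>"
  obtains s1 where "s1 \<in> {s0<..<1}" "(1 - s0) / 2 \<le> s1 - s0"
    "\<And>s. s \<in> {s1..<1} \<Longrightarrow> norm (\<gamma> s - \<gamma> 1) < \<epsilon>"
proof -
  have "\<forall>\<^sub>F s in at_left 1. dist (\<gamma> s) (\<gamma> 1) < \<epsilon>" by (rule tendstoD[OF \<gamma>_tendsto assms])
  then obtain a where a: "a < 1" "\<And>s. a < s \<Longrightarrow> s < 1 \<Longrightarrow> norm (\<gamma> s - \<gamma> 1) < \<epsilon>"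
    by (auto simp: eventually_at_left_field dist_norm)
  show thesis
  proof (rule that[of "(max a s0 + 1) / 2"])
    show "norm (\<gamma> s - \<gamma> 1) < \<epsilon>" if "s \<in> {(max a s0 + 1) / 2..<1}" for s
      using a that by (auto simp: max_def split: if_splits)
  qed (use a(1) s0_less in \<open>auto simp: max_def field_simps\<close>)
qed

lemma kasner_lines_exist:
  assumes R: "ball (\<gamma> 1) R \<subseteq> \<Omega>" "norm (\<gamma> s0 - \<gamma> 1) < R / 4"
  obtains s1 \<rho> \<epsilon> where "kasner_lines p \<Omega> g D E l n k M \<gamma> \<gamma>' s0 s1 \<rho>"
    "\<And>s. s \<in> {s1..<1} \<Longrightarrow> norm (\<gamma> s - \<gamma> 1) < \<epsilon>"
    "cball (\<gamma> 1) ((1 + 2 * onorm l) * \<epsilon>) \<subseteq> \<Omega> \<inter> ball (\<gamma> s1) \<rho>"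
proof -
  define \<kappa> where "\<kappa> = 1 + 2 * onorm l"
  have \<kappa>: "1 \<le> \<kappa>" using onorm_l_nonneg by (simp add: \<kappa>_def)
  have R_pos: "0 < R" using R(2) norm_ge_zero[of "\<gamma> s0 - \<gamma> 1"] by linarith
  obtain r where r: "r > 0" "cball (\<gamma> s0) r \<subseteq> Y"
    using open_Y \<gamma>_in_Y[of s0] s0_less open_contains_cball by (metis atLeastLessThan_iff order_refl)
  define \<rho> where "\<rho> = min r (min (R / 4) (k * (1 - s0) / 8))"
  have \<rho>: "0 < \<rho>" "\<rho> \<le> r" "\<rho> \<le> R / 4" "\<rho> \<le> k * (1 - s0) / 8"
    using r(1) R_pos k_pos s0_less by (auto simp: \<rho>_def)
  define \<epsilon> where "\<epsilon> = \<rho> / (\<kappa> + 1)"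
  have "(\<kappa> + 1) * \<epsilon> = \<rho>" using \<kappa> by (simp add: \<epsilon>_def)
  then have \<epsilon>: "0 < \<epsilon>" "\<kappa> * \<epsilon> + \<epsilon> = \<rho>" using \<rho>(1) \<kappa> by (simp add: \<epsilon>_def, simp add: distrib_right)
  have \<epsilon>_le: "\<epsilon> \<le> \<kappa> * \<epsilon>" using mult_right_mono[OF \<kappa>, of \<epsilon>] \<epsilon>(1) by simp
  then have \<epsilon>_less: "\<epsilon> < \<rho>" using \<epsilon> by linarith
  obtain s1 where s1: "s1 \<in> {s0<..<1}" "(1 - s0) / 2 \<le> s1 - s0"
    and near: "\<And>s. s \<in> {s1..<1} \<Longrightarrow> norm (\<gamma> s - \<gamma> 1) < \<epsilon>"
    using \<gamma>_near_1[OF \<epsilon>(1)] by blast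
  have near_s1: "norm (\<gamma> s1 - \<gamma> 1) < \<epsilon>" using near s1(1) by simp
  have cball_sub: "cball (\<gamma> 1) (\<kappa> * \<epsilon>) \<subseteq> \<Omega> \<inter> ball (\<gamma> s1) \<rho>"
  proof -
    have "ball (\<gamma> s1) \<rho> \<subseteq> ball (\<gamma> 1) R"
      using near_s1 \<epsilon>_less \<rho>(3) R_pos by (simp add: ball_subset_ball_iff dist_norm)
    moreover have "cball (\<gamma> 1) (\<kappa> * \<epsilon>) \<subseteq> ball (\<gamma> s1) \<rho>"
      using near_s1 \<epsilon>(2) by (simp add: cball_subset_ball_iff dist_norm norm_minus_commute)
    ultimately show ?thesis using R(1) by blast
  qed
  have "kasner_lines p \<Omega> g D E l n k M \<gamma> \<gamma>' s0 s1 \<rho>"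
  proof
    show "cball (\<gamma> s0) \<rho> \<subseteq> Y" using r(2) \<rho>(2) by (auto simp: subset_iff)
    show "norm (\<gamma> s - \<gamma> s1) < \<rho>" if "s \<in> {s1..<1}" for s
    proof -
      have "\<gamma> s \<in> cball (\<gamma> 1) (\<kappa> * \<epsilon>)"
        using near[OF that] \<epsilon>_le by (simp add: dist_norm norm_minus_commute)
      then have "\<gamma> s \<in> ball (\<gamma> s1) \<rho>" using cball_sub by blast
      then show ?thesis by (simp add: dist_norm norm_minus_commute)
    qed
    have "k * ((1 - s0) / 2) \<le> k * (s1 - s0)" using s1(2) k_pos by (intro mult_left_mono) auto
    then show "\<rho> + norm (\<gamma> s1 - \<gamma> 1) \<le> k / 2 * (s1 - s0)" using near_s1 \<epsilon>_less \<rho>(4) by simp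
    show "w - 2 *\<^sub>R (\<gamma> s0 - \<gamma> s1) \<in> \<Omega>" if w: "w \<in> cball (\<gamma> s0) \<rho>" for w
    proof -
      have "norm (w - \<gamma> s0) \<le> R / 4" using w \<rho>(3) by (simp add: dist_norm norm_minus_commute)
      moreover have "norm (\<gamma> s1 - \<gamma> 1) < R / 4" using near_s1 \<epsilon>_less \<rho>(3) by simp
      ultimately show ?thesis using diff_2_scaleR_diff_in_ball[OF _ R(2)] R(1) by blast
    qed
  qed (fact s1(1) \<rho>(1))+
  then show thesis using that near cball_sub unfolding \<kappa>_def by blast
qed

lemma no_past_curve:
  assumes j: "p $ j < 0" and R: "ball (\<gamma> 1) R \<subseteq> \<Omega>" "norm (\<gamma> s0 - \<gamma> 1) < R / 4"
  shows False
proof -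
  obtain s1 \<rho> \<epsilon> where lines: "kasner_lines p \<Omega> g D E l n k M \<gamma> \<gamma>' s0 s1 \<rho>"
    and near: "\<And>s. s \<in> {s1..<1} \<Longrightarrow> norm (\<gamma> s - \<gamma> 1) < \<epsilon>"
    and small: "cball (\<gamma> 1) ((1 + 2 * onorm l) * \<epsilon>) \<subseteq> \<Omega> \<inter> ball (\<gamma> s1) \<rho>"
    using kasner_lines_exist[OF R] by blast
  interpret kasner_lines p \<Omega> g D E l n k M \<gamma> \<gamma>' s0 s1 \<rho> by (rule lines)
  obtain Z z where Z: "connected Z" "\<gamma> ` {s1..<1} \<subseteq> Z" "Z \<subseteq> Y"
    and Z_small: "Z \<subseteq> cball (\<gamma> 1) ((1 + 2 * onorm l) * \<epsilon>)"
    and z: "z \<in> Z" "X z j = endpoint $ j + \<eta> j (T z)"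
    using horizon_point[OF s1 near, of j] small by blast
  have Z_ball: "Z \<subseteq> ball (\<gamma> s1) \<rho>" using Z_small small by blast
  then have "line_in_Y (z + chord) 1"
    using Z s1 z(1) by (intro line_in_Y_above) (auto simp: less_imp_le)
  moreover have "z \<in> ball (\<gamma> s1) \<rho>" using Z_ball z(1) by blast
  then have "z + chord \<in> ball (\<gamma> s0) \<rho>" by (simp add: chord_def dist_norm algebra_simps)
  ultimately have "\<bar>X z j - endpoint $ j\<bar> < \<eta> j (T z)" by (rule strictly_inside_horizon[OF j])
  then show False using z(2) by simp
qed

end

section \<open>From past boundary points to curves in a chart\<close>

lemma closedin_Collect_eq_on:
  fixes f h :: "'a::topological_space \<Rightarrow> 'b::t2_space"
  assumes "continuous_on S f" "continuous_on S h"
  shows "closedin (top_of_set S) {x \<in> S. f x = h x}"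
proof -
  have "closedin (top_of_set S) (S \<inter> (\<lambda>x. (f x, h x)) -` {y. \<exists>x. y = (x, x)})"
    by (intro continuous_closedin_preimage continuous_on_Pair assms closed_diagonal)
  then show ?thesis by (rule back_subst) auto
qed

lemma Cinf_on_imp_differentiable_on: "Cinf_on S f \<Longrightarrow> f differentiable_on S"
  unfolding Cinf_on_def by (blast intro: iter_derivs.base)

lemma Cinf_on_imp_continuous_on_derivative:
  "Cinf_on S f \<Longrightarrow> continuous_on S (\<lambda>x. frechet_derivative f (at x within S) v)"
  unfolding Cinf_on_def
  by (blast intro: iter_derivs.intros differentiable_imp_continuous_on)

lemma closedin_graph_comp:
  fixes \<iota> :: "'a::topological_space \<Rightarrow> 'm::t2_space" and \<phi> :: "'m \<Rightarrow> 'b::topological_space"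
  assumes "continuous_on S \<iota>" and \<phi>: "inj_on \<phi> U" "continuous_on (\<phi> ` U) (inv_into U \<phi>)"
    and B: "B \<subseteq> \<phi> ` U"
  shows "closedin (top_of_set (S \<times> B)) ((\<lambda>m. (m, (\<phi> \<circ> \<iota>) m)) ` (S \<inter> \<iota> -` (U \<inter> \<phi> -` B)))"
proof -
  have "closedin (top_of_set (S \<times> B)) {x \<in> S \<times> B. \<iota> (fst x) = inv_into U \<phi> (snd x)}"
    using B by (intro closedin_Collect_eq_on continuous_on_compose2[OF assms(1)]
        continuous_on_compose2[OF \<phi>(2)] continuous_on_fst continuous_on_snd continuous_on_id) auto
  moreover have "\<iota> m = inv_into U \<phi> y \<longleftrightarrow> \<iota> m \<in> U \<and> y = \<phi> (\<iota> m)" if "y \<in> B" for m y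
    using that B \<phi>(1) by (auto simp: f_inv_into_f inv_into_into)
  then have "{x \<in> S \<times> B. \<iota> (fst x) = inv_into U \<phi> (snd x)}
      = (\<lambda>m. (m, (\<phi> \<circ> \<iota>) m)) ` (S \<inter> \<iota> -` (U \<inter> \<phi> -` B))"
    by auto
  ultimately show ?thesis by simp
qed

lemma extension_kasner_chart:
  fixes p :: "real ^ 'n::finite"
    and A :: "('m::{t2_space,second_countable_topology} set \<times> ('m \<Rightarrow> 'n spt)) set"
  assumes exponents: "\<And>i. p $ i < 1" and ext: "kasner_C0_extension p A G \<iota>" and U_\<phi>: "(U, \<phi>) \<in> A"
    and B: "open B" "B \<subseteq> \<phi> ` U"
  shows "kasner_chart p B (G (U, \<phi>)) (kasner_M \<inter> \<iota> -` (U \<inter> \<phi> -` B)) (\<phi> \<circ> \<iota>)"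
proof -
  define D0 where "D0 = kasner_M \<inter> \<iota> -` U"
  define D where "D = kasner_M \<inter> \<iota> -` (U \<inter> \<phi> -` B)"
  define E where "E = \<phi> \<circ> \<iota>"
  have "chart U \<phi>" and emb: "smooth_isometric_embedding p A G \<iota>"
    and lorentz: "\<And>y. y \<in> \<phi> ` U \<Longrightarrow> lorentzian_form (G (U, \<phi>) y)"
    using ext U_\<phi> by (fastforce simp: kasner_C0_extension_def lorentzian_C0_manifold_def
        smooth_atlas_def C0_lorentz_metric_def)+
  then have U: "open U" "inj_on \<phi> U" "continuous_on U \<phi>" "continuous_on (\<phi> ` U) (inv_into U \<phi>)"
    by (auto simp: chart_def)
  have inj: "inj_on \<iota> kasner_M" and cont: "continuous_on kasner_M \<iota>" and smooth: "Cinf_on D0 E"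
    and iso: "\<And>x v w. x \<in> D0 \<Longrightarrow>
      G (U, \<phi>) (E x) (frechet_derivative E (at x) v) (frechet_derivative E (at x) w) = kasner_g p x v w"
    using emb U_\<phi> unfolding smooth_isometric_embedding_def D0_def E_def by (fastforce simp: o_def)+
  have open_D0: "open D0" unfolding D0_def
    by (rule continuous_open_preimage[OF cont open_kasner_M U(1)])
  have D_D0: "D \<subseteq> D0" by (auto simp: D_def D0_def)
  have "kasner_chart p B (G (U, \<phi>)) D E"
  proof
    show "p $ i < 1" for i by (rule exponents)
    show "bilinear (G (U, \<phi>) y)" if "y \<in> B" for y
      using lorentz B(2) that lorentzian_form_bilinear by blast
    show "open D"
      unfolding D_def
      by (intro continuous_open_preimage[OF cont open_kasner_M] continuous_open_preimage U B)
    show "inj_on E D"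
      unfolding D_def E_def using inj U(2) by (auto simp: inj_on_def)
    show "E differentiable_on D"
      using Cinf_on_imp_differentiable_on[OF smooth] D_D0 by (rule differentiable_on_subset)
    show "continuous_on D (\<lambda>m. frechet_derivative E (at m) v)" for v
    proof (rule continuous_on_subset[OF _ D_D0])
      show "continuous_on D0 (\<lambda>m. frechet_derivative E (at m) v)"
        using Cinf_on_imp_continuous_on_derivative[OF smooth, of v] at_within_open[OF _ open_D0]
        by (simp cong: continuous_on_cong_simp)
    qed
    show "closedin (top_of_set (kasner_M \<times> B)) ((\<lambda>m. (m, E m)) ` D)"
      using closedin_graph_comp[OF cont U(2,4) B(2)] by (simp add: D_def E_def)
  qed (use D_D0 iso in \<open>auto simp: D_def E_def\<close>)
  then show ?thesis by (simp add: D_def E_def)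
qed

lemma (in kasner_cone_chart) oriented_patch:
  assumes "convex \<Omega>"
  shows "kasner_patch p \<Omega> g {m \<in> D. 0 < l (E' m (1, 0))} E l n k M"
proof -
  let ?f = "\<lambda>m. l (E' m (1, 0))" and ?graph = "\<lambda>D. (\<lambda>m. (m, E m)) ` D"
  let ?D = "{m \<in> D. 0 < ?f m}"
  have f_cont: "continuous_on D ?f"
    by (rule bounded_linear.continuous_on[OF bounded_linear_l continuous_derivative_E])
  have f_nonzero: "?f m \<noteq> 0" if "m \<in> D" for m
    using l_E'_nonzero[OF that, of "(1, 0)"] by (simp add: kasner_g_def zero_prod_def)
  have "?D = D \<inter> ?f -` {0<..}" by auto
  then have "open ?D"
    using continuous_open_preimage[OF f_cont open_D open_greaterThan[of 0]] by simp
  moreover have "closedin (top_of_set (kasner_M \<times> \<Omega>)) (?graph ?D)"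
  proof (rule closedin_trans[OF _ closed_graph])
    have "closedin (top_of_set (?graph D)) (?graph D \<inter> (\<lambda>q. ?f (fst q)) -` {0..})"
      by (intro continuous_closedin_preimage continuous_on_compose2[OF f_cont] continuous_on_fst
          continuous_on_id) auto
    moreover have "?graph D \<inter> (\<lambda>q. ?f (fst q)) -` {0..} = ?graph ?D"
      using f_nonzero by (force simp: order_le_less)
    ultimately show "closedin (top_of_set (?graph D)) (?graph ?D)" by simp
  qed
  ultimately show ?thesis
    using exponent_less_1 bilinear_g D_subset inj_E E_in E_differentiable isometric_E
      continuous_on_subset[OF continuous_derivative_E] cone_field_axioms assms
    by (intro kasner_patch.intro kasner_cone_chart.intro kasner_chart.intro
        kasner_patch_axioms.intro)
      (auto intro: inj_on_subset differentiable_on_subset)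
qed

lemma timelike_curve01_in_chart:
  assumes \<sigma>: "timelike_curve01 A G \<sigma>" and U_\<phi>: "(U, \<phi>) \<in> A" and U: "open U" "\<sigma> 1 \<in> U"
  obtains a \<gamma>' where "0 \<le> a" "a < 1" "\<sigma> ` {a..1} \<subseteq> U"
    "continuous_on {a..1} (\<phi> \<circ> \<sigma>)" "continuous_on {a..1} \<gamma>'"
    "\<And>s. s \<in> {a<..<1} \<Longrightarrow> (\<phi> \<circ> \<sigma> has_vector_derivative \<gamma>' s) (at s)"
    "G (U, \<phi>) (\<phi> (\<sigma> 1)) (\<gamma>' 1) (\<gamma>' 1) < 0"
proof -
  define S where "S = {0..1} \<inter> \<sigma> -` U"
  define \<gamma> where "\<gamma> = \<phi> \<circ> \<sigma>"
  define \<gamma>' where "\<gamma>' t = frechet_derivative \<gamma> (at t within S) 1" for t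
  have cont: "continuous_on {0..1} \<sigma>" and smooth: "Cinf_on S \<gamma>"
    and timelike: "\<And>t. t \<in> S \<Longrightarrow> G (U, \<phi>) (\<gamma> t) (\<gamma>' t) (\<gamma>' t) < 0"
    using \<sigma> U_\<phi> unfolding timelike_curve01_def smooth_curve01_def S_def \<gamma>_def \<gamma>'_def
    by (fastforce simp: Let_def)+
  have "1 \<in> S" using U(2) by (simp add: S_def)
  have "openin (top_of_set {0..1}) S"
    unfolding S_def by (rule continuous_openin_preimage_gen[OF cont U(1)])
  then obtain d where d: "d > 0" "ball 1 d \<inter> {0..1} \<subseteq> S"
    using \<open>1 \<in> S\<close> unfolding openin_contains_ball by blast
  define a where "a = max 0 (1 - d / 2)"
  have a: "0 \<le> a" "a < 1" "{a..1} \<subseteq> S"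
    using d by (auto simp: a_def dist_real_def subset_iff)
  have deriv: "(\<gamma> has_vector_derivative \<gamma>' s) (at s)" if s: "s \<in> {a<..<1}" for s
  proof -
    have "s \<in> interior S" using s a(3) by (intro interiorI[of "{a<..<1}"]) auto
    then have at: "at s within S = at s" by (rule at_within_interior)
    have "s \<in> S" using s a(3) by auto
    then have "(\<gamma> has_derivative frechet_derivative \<gamma> (at s within S)) (at s within S)"
      using Cinf_on_imp_differentiable_on[OF smooth] frechet_derivative_works
      by (auto simp: differentiable_on_def)
    then have deriv: "(\<gamma> has_derivative frechet_derivative \<gamma> (at s within S)) (at s)"
      by (simp add: at)
    have "frechet_derivative \<gamma> (at s within S) x = x *\<^sub>R \<gamma>' s" for x
      using linear_cmul[OF has_derivative_linear[OF deriv], of x 1] by (simp add: \<gamma>'_def)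
    then have "frechet_derivative \<gamma> (at s within S) = (\<lambda>x. x *\<^sub>R \<gamma>' s)" by (rule ext)
    then show ?thesis using deriv by (simp add: has_vector_derivative_def)
  qed
  have "continuous_on S \<gamma>"
    using Cinf_on_imp_differentiable_on[OF smooth] by (rule differentiable_imp_continuous_on)
  moreover have "continuous_on S \<gamma>'"
    using Cinf_on_imp_continuous_on_derivative[OF smooth, of 1] by (simp add: \<gamma>'_def[abs_def])
  moreover have "\<sigma> ` {a..1} \<subseteq> U" using a(3) by (auto simp: S_def)
  ultimately show thesis
    using a deriv timelike[OF \<open>1 \<in> S\<close>] continuous_on_subset[OF _ a(3)]
    by (intro that[of a \<gamma>']) (simp_all add: \<gamma>_def)
qed

lemma kasner_pdtl_curve_eventually_past:
  assumes "kasner_pdtl_curve p {0..<1} c"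
  shows "\<forall>\<^sub>F s in at_left 1. \<forall>v. (c has_vector_derivative v) (at s) \<longrightarrow> kasner_pdtl_vec p (c s) v"
proof -
  obtain J where J: "finite J" "\<And>a b s. a < b \<Longrightarrow> {a..b} \<subseteq> {0..<1} \<Longrightarrow> {a<..<b} \<inter> J = {} \<Longrightarrow> s \<in> {a..b} \<Longrightarrow>
      kasner_pdtl_vec p (c s) (frechet_derivative c (at s within {a..b}) 1)"
    using assms unfolding kasner_pdtl_curve_def by metis
  have "\<forall>\<^sub>F s in at_left 1. s \<in> {0<..<1} \<and> (\<forall>x\<in>J. s \<noteq> x)"
    using J(1) by (intro eventually_conj eventually_at_left_real eventually_ball_finite ballI
        eventually_neq_at_within) auto
  then obtain a where a: "a < 1" "\<And>s. a < s \<Longrightarrow> s < 1 \<Longrightarrow> s \<in> {0<..<1} \<and> s \<notin> J"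
    unfolding eventually_at_left_field by blast
  have "kasner_pdtl_vec p (c s) v"
    if s: "s \<in> {a<..<1}" and v: "(c has_vector_derivative v) (at s)" for s v
  proof -
    define u w where "u = (a + s) / 2" and "w = (s + 1) / 2"
    have uw: "a < u" "u < s" "s < w" "w < 1" using s by (auto simp: u_def w_def)
    have "at s within {u..w} = at s" using uw by (intro at_within_Icc_at) auto
    moreover have "(c has_derivative (\<lambda>x. x *\<^sub>R v)) (at s)"
      using v by (simp add: has_vector_derivative_def)
    ultimately have "frechet_derivative c (at s within {u..w}) 1 = v"
      using frechet_derivative_at[symmetric] by fastforce
    moreover have "kasner_pdtl_vec p (c s) (frechet_derivative c (at s within {u..w}) 1)"
    proof (rule J(2))
      have "x \<in> {0<..<1} \<and> x \<notin> J" if "x \<in> {u..w}" for x using a(2)[of x] that uw by simp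
      then show "{u..w} \<subseteq> {0..<1}" "{u<..<w} \<inter> J = {}" by fastforce+
    qed (use uw in auto)
    ultimately show ?thesis by simp
  qed
  then show ?thesis
    by (intro eventually_mono[OF eventually_at_left_real[OF a(1)]]) simp
qed

lemma interior_of_chart_image:
  assumes "open U" "inj_on \<phi> U" "continuous_on U \<phi>" and V: "open V" "V \<subseteq> \<phi> ` (U \<inter> S)"
    and q: "q \<in> U" "\<phi> q \<in> V"
  shows "q \<in> interior S"
proof (rule interiorI)
  show "open (U \<inter> \<phi> -` V)" by (rule continuous_open_preimage[OF assms(3,1) V(1)])
  show "q \<in> U \<inter> \<phi> -` V" using q by simp
  show "U \<inter> \<phi> -` V \<subseteq> S"
  proof
    fix x assume x: "x \<in> U \<inter> \<phi> -` V"
    then obtain y where "y \<in> U \<inter> S" "\<phi> x = \<phi> y" using V(2) by blast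
    then show "x \<in> S" using x inj_onD[OF assms(2), of x y] by auto
  qed
qed

lemma past_boundaryE:
  fixes p :: "real ^ 'n::finite"
    and A :: "('m::{t2_space,second_countable_topology} set \<times> ('m \<Rightarrow> 'n spt)) set"
  assumes ext: "kasner_C0_extension p A G \<iota>" and q: "q \<in> past_boundary p A G \<iota>"
  obtains U \<phi> \<gamma> a \<gamma>' m where "(U, \<phi>) \<in> A" "\<gamma> 1 \<in> \<phi> ` U"
    "\<And>V. open V \<Longrightarrow> V \<subseteq> \<phi> ` (U \<inter> \<iota> ` kasner_M) \<Longrightarrow> \<gamma> 1 \<notin> V"
    "a < 1" "continuous_on {a..1} \<gamma>" "continuous_on {a..1} \<gamma>'" "G (U, \<phi>) (\<gamma> 1) (\<gamma>' 1) (\<gamma>' 1) < 0"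
    "\<And>s. s \<in> {a<..<1} \<Longrightarrow> (\<gamma> has_vector_derivative \<gamma>' s) (at s)"
    "\<And>s. s \<in> {a<..<1} \<Longrightarrow> m s \<in> kasner_M \<and> \<iota> (m s) \<in> U \<and> \<phi> (\<iota> (m s)) = \<gamma> s"
    "\<forall>\<^sub>F s in at_left 1. \<forall>v. (m has_vector_derivative v) (at s) \<longrightarrow> kasner_pdtl_vec p (m s) v"
proof -
  obtain \<sigma> where frontier: "\<sigma> 1 \<in> frontier (\<iota> ` kasner_M)" and \<sigma>: "timelike_curve01 A G \<sigma>"
    and \<sigma>_M: "\<sigma> ` {0..<1} \<subseteq> \<iota> ` kasner_M"
      and past: "kasner_pdtl_curve p {0..<1} (inv_into kasner_M \<iota> \<circ> \<sigma>)"
    using q unfolding past_boundary_def by blast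
  have atlas: "smooth_atlas A"
    using ext by (auto simp: kasner_C0_extension_def lorentzian_C0_manifold_def)
  then have "\<sigma> 1 \<in> \<Union> (fst ` A)" by (simp add: smooth_atlas_def)
  then obtain U \<phi> where U_\<phi>: "(U, \<phi>) \<in> A" and \<sigma>_U: "\<sigma> 1 \<in> U" by auto
  have U: "open U" "inj_on \<phi> U" "continuous_on U \<phi>"
    using atlas U_\<phi> by (auto simp: smooth_atlas_def chart_def)
  obtain a \<gamma>' where a: "0 \<le> a" "a < 1" "\<sigma> ` {a..1} \<subseteq> U"
    and curve: "continuous_on {a..1} (\<phi> \<circ> \<sigma>)" "continuous_on {a..1} \<gamma>'"
      "\<And>s. s \<in> {a<..<1} \<Longrightarrow> (\<phi> \<circ> \<sigma> has_vector_derivative \<gamma>' s) (at s)"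
      "G (U, \<phi>) (\<phi> (\<sigma> 1)) (\<gamma>' 1) (\<gamma>' 1) < 0"
    using timelike_curve01_in_chart[OF \<sigma> U_\<phi> U(1) \<sigma>_U] by blast
  show thesis
  proof (rule that[of U \<phi> "\<phi> \<circ> \<sigma>" a \<gamma>' "inv_into kasner_M \<iota> \<circ> \<sigma>"])
    show "(\<phi> \<circ> \<sigma>) 1 \<in> \<phi> ` U" using \<sigma>_U by simp
    show "(\<phi> \<circ> \<sigma>) 1 \<notin> V" if "open V" "V \<subseteq> \<phi> ` (U \<inter> \<iota> ` kasner_M)" for V
      using interior_of_chart_image[OF U that \<sigma>_U] frontier by (auto simp: frontier_def)
    show "(inv_into kasner_M \<iota> \<circ> \<sigma>) s \<in> kasner_M \<and> \<iota> ((inv_into kasner_M \<iota> \<circ> \<sigma>) s) \<in> U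
        \<and> \<phi> (\<iota> ((inv_into kasner_M \<iota> \<circ> \<sigma>) s)) = (\<phi> \<circ> \<sigma>) s" if s: "s \<in> {a<..<1}" for s
    proof -
      have "\<sigma> s \<in> \<iota> ` kasner_M" "\<sigma> s \<in> U" using \<sigma>_M a s by auto
      then show ?thesis by (simp add: inv_into_into f_inv_into_f)
    qed
    show "\<forall>\<^sub>F s in at_left 1. \<forall>v. (inv_into kasner_M \<iota> \<circ> \<sigma> has_vector_derivative v) (at s) \<longrightarrow>
        kasner_pdtl_vec p ((inv_into kasner_M \<iota> \<circ> \<sigma>) s) v"
      by (rule kasner_pdtl_curve_eventually_past[OF past])
  qed (use U_\<phi> a(2) curve in simp_all)
qed

context kasner_cone_chart
begin

lemma past_directed_imp_oriented:
  assumes S: "open S" "s \<in> S" and m: "\<And>s. s \<in> S \<Longrightarrow> m s \<in> D \<and> E (m s) = \<gamma> s"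
    and \<gamma>: "(\<gamma> has_vector_derivative v) (at s)" "- v \<in> cone_around n k"
    and past: "\<And>w. (m has_vector_derivative w) (at s) \<Longrightarrow> kasner_pdtl_vec p (m s) w"
  shows "0 < l (E' (m s) (1, 0))"
proof -
  have \<gamma>_Y: "\<gamma> s \<in> Y" "F (\<gamma> s) = m s" if "s \<in> S" for s
    using m[OF that] E_in_Y F_E by metis+
  have "((\<lambda>s. F (\<gamma> s)) has_vector_derivative F' (\<gamma> s) v) (at s)"
    by (rule F_comp_has_vector_derivative[OF \<gamma>(1) \<gamma>_Y(1)[OF S(2)]])
  then have "(m has_vector_derivative F' (\<gamma> s) v) (at s)"
    by (rule has_vector_derivative_transform_within_open[OF _ S \<gamma>_Y(2)])
  then have "kasner_pdtl_vec p (m s) (F' (\<gamma> s) v)" by (rule past)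
  then have "kasner_g p (m s) (F' (\<gamma> s) v) (F' (\<gamma> s) v) \<le> 0" "fst (F' (\<gamma> s) v) < 0"
    by (simp_all add: kasner_pdtl_vec_def kasner_g_def)
  moreover have "E' (m s) (F' (\<gamma> s) v) = v"
    using E'_F'[OF \<gamma>_Y(1)[OF S(2)]] by (simp add: \<gamma>_Y(2)[OF S(2)])
  moreover have "l v < 0" using cone_l_pos[OF \<gamma>(2)] by (simp add: linear_neg[OF linear_l])
  ultimately show ?thesis using l_E'_past_iff[of "m s" "F' (\<gamma> s) v"] m[OF S(2)] by simp
qed

lemma oriented_past_curve:
  assumes \<Omega>: "convex \<Omega>" "\<gamma> 1 \<in> \<Omega>" "\<gamma> 1 \<notin> Y" and s0: "a < s0" "s0 < 1"
    and cont: "continuous_on {s0..1} \<gamma>"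
    and m: "\<And>s. s \<in> {a<..<1} \<Longrightarrow> m s \<in> D \<and> E (m s) = \<gamma> s"
    and deriv: "\<And>s. s \<in> {a<..<1} \<Longrightarrow> (\<gamma> has_vector_derivative \<gamma>' s) (at s)"
    and near: "\<And>s. s \<in> {a<..<1} \<Longrightarrow> norm (\<gamma>' s + n) \<le> k / 2"
    and past: "\<And>s v. s \<in> {a<..<1} \<Longrightarrow> (m has_vector_derivative v) (at s) \<Longrightarrow> kasner_pdtl_vec p (m s) v"
  shows "kasner_past_curve p \<Omega> g {m \<in> D. 0 < l (E' m (1, 0))} E l n k M \<gamma> \<gamma>' s0"
proof -
  interpret patch: kasner_patch p \<Omega> g "{m \<in> D. 0 < l (E' m (1, 0))}" E l n k M
    by (rule oriented_patch[OF \<Omega>(1)])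
  show ?thesis
  proof
    show "\<gamma> 1 \<notin> patch.Y" using \<Omega>(3) by (auto simp: patch.Y_def Y_def)
    show "\<gamma> s \<in> patch.Y" if "s \<in> {s0..<1}" for s
    proof -
      have s: "s \<in> {a<..<1}" using that s0 by auto
      have "- \<gamma>' s \<in> cone_around n k"
        using near[OF s] k_pos by (intro minus_in_cone_around) simp
      then have "0 < l (E' (m s) (1, 0))"
        using past_directed_imp_oriented[OF open_greaterThanLessThan s m deriv[OF s] _ past[OF s]]
        by blast
      then show ?thesis using m[OF s] patch.E_in_Y[of "m s"] by simp
    qed
  qed (use \<Omega> s0 cont deriv near in auto)
qed

end

lemma past_boundary_past_curve:
  fixes p :: "real ^ 'n::finite"
    and A :: "('m::{t2_space,second_countable_topology} set \<times> ('m \<Rightarrow> 'n spt)) set"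
  assumes exponents: "\<And>i. p $ i < 1" and ext: "kasner_C0_extension p A G \<iota>"
    and q: "q \<in> past_boundary p A G \<iota>"
  obtains \<gamma> R g D E l n k M \<gamma>' s0 where "kasner_past_curve p (ball (\<gamma> 1) R) g D E l n k M \<gamma> \<gamma>' s0"
    "norm (\<gamma> s0 - \<gamma> 1) < R / 4"
proof -
  obtain U \<phi> \<gamma> a \<gamma>' m where U_\<phi>: "(U, \<phi>) \<in> A" and \<gamma>_1: "\<gamma> 1 \<in> \<phi> ` U"
    and boundary: "\<And>V. open V \<Longrightarrow> V \<subseteq> \<phi> ` (U \<inter> \<iota> ` kasner_M) \<Longrightarrow> \<gamma> 1 \<notin> V"
    and a: "a < 1" and cont: "continuous_on {a..1} \<gamma>" "continuous_on {a..1} \<gamma>'"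
    and timelike: "G (U, \<phi>) (\<gamma> 1) (\<gamma>' 1) (\<gamma>' 1) < 0"
    and deriv: "\<And>s. s \<in> {a<..<1} \<Longrightarrow> (\<gamma> has_vector_derivative \<gamma>' s) (at s)"
    and m: "\<And>s. s \<in> {a<..<1} \<Longrightarrow> m s \<in> kasner_M \<and> \<iota> (m s) \<in> U \<and> \<phi> (\<iota> (m s)) = \<gamma> s"
    and past: "\<forall>\<^sub>F s in at_left 1. \<forall>v. (m has_vector_derivative v) (at s) \<longrightarrow> kasner_pdtl_vec p (m s) v"
    using past_boundaryE[OF ext q] by blast
  define g where "g = G (U, \<phi>)"
  have lorentz: "\<And>y. y \<in> \<phi> ` U \<Longrightarrow> lorentzian_form (g y)"
    and g_cont: "\<And>v w. continuous_on (\<phi> ` U) (\<lambda>y. g y v w)" and open_U: "open (\<phi> ` U)"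
    using ext U_\<phi> unfolding g_def
    by (fastforce simp: kasner_C0_extension_def lorentzian_C0_manifold_def C0_lorentz_metric_def
        smooth_atlas_def chart_def)+
  define n where "n = - \<gamma>' 1"
  have "g (\<gamma> 1) n n < 0"
    using timelike bilinear_scaleR_scaleR[OF lorentzian_form_bilinear[OF lorentz[OF \<gamma>_1]],
        of "- 1" "\<gamma>' 1" "- 1" "\<gamma>' 1"]
    by (simp add: n_def g_def)
  then obtain R l k M where R: "R > 0" "ball (\<gamma> 1) R \<subseteq> \<phi> ` U"
    and cones: "cone_field (ball (\<gamma> 1) R) g l n k M"
    using lorentzian_family_cone_field[OF open_U \<gamma>_1 g_cont lorentz] by blast
  define D where "D = kasner_M \<inter> \<iota> -` (U \<inter> \<phi> -` ball (\<gamma> 1) R)"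
  interpret kasner_cone_chart p "ball (\<gamma> 1) R" g D "\<phi> \<circ> \<iota>" l n k M
    unfolding D_def using cones extension_kasner_chart[OF exponents ext U_\<phi> open_ball R(2)]
    by (intro kasner_cone_chart.intro) (simp_all add: g_def)
  have "\<forall>\<^sub>F s in at_left 1. s \<in> {a<..<1} \<and> dist (\<gamma> s) (\<gamma> 1) < R / 4 \<and> dist (\<gamma>' s) (\<gamma>' 1) < k / 2
      \<and> (\<forall>v. (m has_vector_derivative v) (at s) \<longrightarrow> kasner_pdtl_vec p (m s) v)"
    using R(1) k_pos
    by (intro eventually_conj eventually_at_left_real a tendstoD continuous_on_Icc_at_leftD[OF _ a]
        cont past) simp_all
  then obtain b where b: "b < 1" and near: "\<And>s. b < s \<Longrightarrow> s < 1 \<Longrightarrow>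
      s \<in> {a<..<1} \<and> norm (\<gamma> s - \<gamma> 1) < R / 4 \<and> norm (\<gamma>' s + n) < k / 2
      \<and> (\<forall>v. (m has_vector_derivative v) (at s) \<longrightarrow> kasner_pdtl_vec p (m s) v)"
    unfolding eventually_at_left_field dist_norm n_def diff_conv_add_uminus by blast
  define s0 where "s0 = (b + 1) / 2"
  have s0: "b < s0" "s0 < 1" "a < s0" using b near[of s0] by (auto simp: s0_def)
  have "kasner_past_curve p (ball (\<gamma> 1) R) g {m \<in> D. 0 < l (E' m (1, 0))} (\<phi> \<circ> \<iota>) l n k M \<gamma> \<gamma>' s0"
  proof (rule oriented_past_curve[OF convex_ball _ _ s0(1,2)])
    have "Y \<subseteq> \<phi> ` (U \<inter> \<iota> ` kasner_M)" unfolding Y_def by (auto simp: D_def)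
    then show "\<gamma> 1 \<notin> Y" by (rule boundary[OF open_Y])
    show "continuous_on {s0..1} \<gamma>" by (rule continuous_on_subset[OF cont(1)]) (use s0 in auto)
    show "m s \<in> D \<and> (\<phi> \<circ> \<iota>) (m s) = \<gamma> s" if "s \<in> {b<..<1}" for s
      using near[of s] m[of s] that R(1) by (simp add: D_def dist_norm norm_minus_commute)
  qed (use near R(1) deriv in \<open>auto simp: less_imp_le\<close>)
  then show thesis using that near[of s0] s0 by blast
qed

theorem theorem4p2:
  fixes p :: "real ^ 'n::finite"
    and A :: "('m::{t2_space,second_countable_topology} set \<times> ('m \<Rightarrow> 'n spt)) set"
    and G :: "'m set \<times> ('m \<Rightarrow> 'n spt) \<Rightarrow> 'n spt \<Rightarrow> 'n spt \<Rightarrow> 'n spt \<Rightarrow> real"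
    and \<iota> :: "'n spt \<Rightarrow> 'm"
  assumes "CARD('n) \<ge> 3"
    and "(\<Sum>i\<in>UNIV. p $ i) = 1"
    and "(\<Sum>i\<in>UNIV. (p $ i)^2) = 1"
    and "\<exists>i. p $ i < 0"
  shows "\<not> (kasner_C0_extension p A G \<iota> \<and> past_boundary p A G \<iota> \<noteq> {})"
proof
  assume "kasner_C0_extension p A G \<iota> \<and> past_boundary p A G \<iota> \<noteq> {}"
  then obtain q where ext: "kasner_C0_extension p A G \<iota>" and q: "q \<in> past_boundary p A G \<iota>" by blast
  obtain j where j: "p $ j < 0" using assms(4) by blast
  have exponents: "p $ i < 1" for i by (rule kasner_exponent_less_1[OF assms(3) j])
  obtain \<gamma> R g D E l n k M \<gamma>' s0 where
    curve: "kasner_past_curve p (ball (\<gamma> 1) R) g D E l n k M \<gamma> \<gamma>' s0"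
      and near: "norm (\<gamma> s0 - \<gamma> 1) < R / 4"
    by (rule past_boundary_past_curve[OF exponents ext q])
  show False by (rule kasner_past_curve.no_past_curve[OF curve j order_refl near])
qed

end
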